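(* Let $Y$ be a Haar system Hardy space of the form $Y=X_0(\mathbf r)$, let $D:Y\to Y$ be a bounded Haar multiplier, and let $c\in\Lambda(D)$, where $\Lambda(D)$ is the set of all cluster points $c\in\mathbb R$ of the sequence $(\langle r_n,Dr_n\rangle)_{n=0}^\infty$. Then the following assertions are true: (i) For every $\eta>0$, $cI_Y$ projectionally factors through $D$ with constant $1$ and error $\eta$. (ii) If $c\ne0$, then the identity $I_Y$ factors through $D$ with constant $(1/|c|)^+$. (iii) The identity $I_Y$ either factors through $D$ or through $I_Y-D$ with constant $2^+$; more precisely, with constant $\min(1/|c|,1/|1-c|)^+$, where $1/0=\infty$.
   Context: All Banach spaces are real. Haar system: $\mathcal D$ is the set of dyadic intervals $[\frac{i-1}{2^j},\frac{i}{2^j})$, $j\ge0$, $1\le i\le 2^j$; $\mathcal D_n=\{I\in\mathcal D:|I|=2^{-n}\}$. $I^+$, $I^-$ are the left and right halves of $I$. $h_I=\chi_{I^+}-\chi_{I^-}$ for $I\in\mathcal D$, $h_\varnothing=\chi_{[0,1)}$, $\mathcal D^+=\mathcal D\cup\{\varnothing\}$. The bijection $\iota:\mathcal D\to\mathbb N$, $[\frac{i}{2^j},\frac{i+1}{2^j})\mapsto 2^j+i$, together with $\iota(\varnothing)=0$, defines the linear order on $\mathcal D^+$. $H=\operatorname{span}\{h_I:I\in\mathcal D^+\}$, $H_0=\operatorname{span}\{h_I:I\in\mathcal D\}$. Rademacher functions: $r_n=\sum_{I\in\mathcal D_n}h_I$, $n\ge0$. Haar system space: the completion $X$ of $H$ under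 a norm $\|\cdot\|_X$ such that $\|x\|_X=\|y\|_X$ whenever $x,y\in H$ and $|x|,|y|$ have the same distribution, and $\|\chi_{[0,1)}\|_X=1$. Haar system Hardy space: let $\mathcal R=\{(r_{\iota(I)})_{I\in\mathcal D^+},(r_0)_{I\in\mathcal D^+}\}$. For a Haar system space $X$ and $\mathbf r=(r_I)_{I\in\mathcal D^+}\in\mathcal R$, $X(\mathbf r)$ is the completion of $H$ under $\|\sum_{I\in\mathcal D^+}a_Ih_I\|_{X(\mathbf r)}=\big\|s\mapsto\int_0^1|\sum_{I\in\mathcal D^+}r_I(u)a_Ih_I(s)|\,du\big\|_X$, and $X_0(\mathbf r)$ is the closure of $H_0$ in $X(\mathbf r)$. $(h_I)_{I\in\mathcal D}$ is a monotone Schauder basis of $X_0(\mathbf r)$. Each $g\in H_0$ is identified with the bounded functional on $Y$ that extends $f\mapsto\langle g,f\rangle=\int_0^1fg$, $f\in H_0$. A Haar multiplier is a linear operator $D$ with $Dh_I=d_Ih_I$, $I\in\mathcal D$, for scalars $d_I$. Factorization: for $S,T\in\mathcal B(Y)$, $C,\eta\ge0$: $S$ factors through $T$ with constant $C$ and error $\eta$ if there are $A,B\in\mathcal B(Y)$ with $\|A\|\|B\|\le C$ and $\|S-ATB\|\le\eta$; it does so projectionally if in addition $AB=I_Y$. Without mention of error, the error is $0$. "With constant $C^+$" means with constant $C+\gamma$ for every $\gamma>0$. *)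

theory Defs
  imports "HOL-Analysis.Analysis"
begin

definition dyadic :: "real set set" where
  "dyadic = {{(real i - 1) / 2 ^ j ..< real i / 2 ^ j} | i j :: nat. 1 \<le> i \<and> i \<le> 2 ^ j}"

definition dyadic_level :: "nat \<Rightarrow> real set set" where
  "dyadic_level n = {I \<in> dyadic. measure lborel I = 1 / 2 ^ n}"

text \<open>The additional index of the constant function is the empty set.\<close>

definition dyadic_plus :: "real set set" where
  "dyadic_plus = insert {} dyadic"

definition left_half :: "real set \<Rightarrow> real set" where
  "left_half I = {Inf I ..< (Inf I + Sup I) / 2}"

definition right_half :: "real set \<Rightarrow> real set" where
  "right_half I = {(Inf I + Sup I) / 2 ..< Sup I}"

definition haar :: "real set \<Rightarrow> real \<Rightarrow> real" where
  "haar I s = (if I = {} then indicator {0..<1} s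
               else indicator (left_half I) s - indicator (right_half I) s)"

text \<open>For \<open>I = [i/2^j, (i+1)/2^j)\<close> the quotient below equals \<open>2^j + i\<close>;
  see \<open>iota_dyadic\<close>.\<close>

definition iota :: "real set \<Rightarrow> nat" where
  "iota I = (if I = {} then 0 else nat \<lfloor>(1 + Inf I) / (Sup I - Inf I)\<rfloor>)"

lemma iota_dyadic: "iota {real i / 2 ^ j ..< (real i + 1) / 2 ^ j} = 2 ^ j + i"
proof -
  have lt: "real i / 2 ^ j < (real i + 1) / 2 ^ j"
    by (simp add: divide_strict_right_mono)
  have "(1 + real i / 2 ^ j) / ((real i + 1) / 2 ^ j - real i / 2 ^ j) = real (2 ^ j + i)"
    by (simp add: field_simps)
  then show ?thesis
    using lt by (simp only: iota_def cInf_atLeastLessThan cSup_atLeastLessThan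
      floor_of_nat nat_int) auto
qed

lemma iota_empty: "iota {} = 0"
  by (simp add: iota_def)

text \<open>Linear spans of Haar functions, as sets of functions on the real line that vanish
  outside \<open>[0,1)\<close>.  Elements of \<open>haar_H\<close> that agree almost everywhere are equal, so
  no quotient is needed.\<close>

definition haar_span :: "real set set \<Rightarrow> (real \<Rightarrow> real) set" where
  "haar_span S = {\<lambda>s. \<Sum>I\<in>A. a I * haar I s | A a. finite A \<and> A \<subseteq> S}"

definition haar_H :: "(real \<Rightarrow> real) set" where
  "haar_H = haar_span dyadic_plus"

definition haar_H0 :: "(real \<Rightarrow> real) set" where
  "haar_H0 = haar_span dyadic"

definition rademacher :: "nat \<Rightarrow> real \<Rightarrow> real" where
  "rademacher n s = (\<Sum>I\<in>dyadic_level n. haar I s)"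

definition rademacher_families :: "(real set \<Rightarrow> real \<Rightarrow> real) set" where
  "rademacher_families = {\<lambda>I. rademacher (iota I), \<lambda>I. rademacher 0}"


definition same_distribution :: "(real \<Rightarrow> real) \<Rightarrow> (real \<Rightarrow> real) \<Rightarrow> bool" where
  "same_distribution x y \<longleftrightarrow>
     distr (restrict_space lborel {0..<1}) borel x = distr (restrict_space lborel {0..<1}) borel y"

text \<open>A Haar system space \<open>X\<close> is given by its norm \<open>N\<close> on \<open>haar_H\<close>.  The values of \<open>N\<close>
  outside \<open>haar_H\<close> are irrelevant, and so are the elements of the completion outside
  \<open>haar_H\<close>: in the norm of \<open>X(r)\<close> below, \<open>N\<close> is only applied to elements of \<open>haar_H\<close>.\<close>

definition haar_system_norm :: "((real \<Rightarrow> real) \<Rightarrow> real) \<Rightarrow> bool" where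
  "haar_system_norm N \<longleftrightarrow>
     (\<forall>x\<in>haar_H. 0 \<le> N x \<and> (N x = 0 \<longleftrightarrow> x = (\<lambda>s. 0))) \<and>
     (\<forall>x\<in>haar_H. \<forall>c. N (\<lambda>s. c * x s) = \<bar>c\<bar> * N x) \<and>
     (\<forall>x\<in>haar_H. \<forall>y\<in>haar_H. N (\<lambda>s. x s + y s) \<le> N x + N y) \<and>
     (\<forall>x\<in>haar_H. \<forall>y\<in>haar_H.
        same_distribution (\<lambda>s. \<bar>x s\<bar>) (\<lambda>s. \<bar>y s\<bar>) \<longrightarrow> N x = N y) \<and>
     N (indicator {0..<1}) = 1"

text \<open>The Banach space \<open>'x\<close>, together with the canonical map \<open>J\<close> of \<open>haar_H\<close> into it, is the
  completion \<open>X(r)\<close> of \<open>haar_H\<close>.  The values of \<open>J\<close> outside \<open>haar_H\<close> are irrelevant.\<close>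

definition is_hardy_space ::
  "((real \<Rightarrow> real) \<Rightarrow> real) \<Rightarrow> (real set \<Rightarrow> real \<Rightarrow> real) \<Rightarrow> ((real \<Rightarrow> real) \<Rightarrow> 'x::banach) \<Rightarrow> bool"
  where
  "is_hardy_space N r J \<longleftrightarrow>
     (\<forall>x\<in>haar_H. \<forall>y\<in>haar_H. J (\<lambda>s. x s + y s) = J x + J y) \<and>
     (\<forall>x\<in>haar_H. \<forall>c. J (\<lambda>s. c * x s) = c *\<^sub>R J x) \<and>
     (\<forall>A a. finite A \<and> A \<subseteq> dyadic_plus \<longrightarrow>
        norm (J (\<lambda>s. \<Sum>I\<in>A. a I * haar I s)) =
        N (\<lambda>s. LBINT u:{0..1}. \<bar>\<Sum>I\<in>A. r I u * a I * haar I s\<bar>)) \<and>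
     closure (J ` haar_H) = UNIV"

text \<open>The Banach space \<open>'y\<close> is the closed subspace \<open>X\<^sub>0(r) = closure (J ` haar_H0)\<close> of
  \<open>X(r)\<close>, turned into a type so that \<open>'y \<Rightarrow>\<^sub>L 'y\<close> is the space of its bounded operators:
  \<open>E\<close> is the inclusion into \<open>X(r)\<close> and \<open>j\<close> is \<open>J\<close> restricted to \<open>haar_H0\<close>.\<close>

definition is_hardy_space0 ::
  "((real \<Rightarrow> real) \<Rightarrow> 'x::banach) \<Rightarrow> ('y::banach \<Rightarrow> 'x) \<Rightarrow> ((real \<Rightarrow> real) \<Rightarrow> 'y) \<Rightarrow> bool" where
  "is_hardy_space0 J E j \<longleftrightarrow>
     linear E \<and> (\<forall>y. norm (E y) = norm y) \<and> range E = closure (J ` haar_H0) \<and>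
     (\<forall>f\<in>haar_H0. E (j f) = J f)"

text \<open>The bounded functional on \<open>Y\<close> identified with \<open>g \<in> haar_H0\<close>.  It is unique because
  \<open>j ` haar_H0\<close> is dense in \<open>Y\<close>.\<close>

definition haar_functional ::
  "((real \<Rightarrow> real) \<Rightarrow> 'y::real_normed_vector) \<Rightarrow> (real \<Rightarrow> real) \<Rightarrow> 'y \<Rightarrow>\<^sub>L real" where
  "haar_functional j g =
     (THE \<phi>. \<forall>f\<in>haar_H0. blinfun_apply \<phi> (j f) = (LBINT s:{0..1}. f s * g s))"


definition haar_multiplier ::
  "((real \<Rightarrow> real) \<Rightarrow> 'y::real_normed_vector) \<Rightarrow> ('y \<Rightarrow>\<^sub>L 'y) \<Rightarrow> bool" where
  "haar_multiplier j D \<longleftrightarrow>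
     (\<exists>d :: real set \<Rightarrow> real. \<forall>I\<in>dyadic. blinfun_apply D (j (haar I)) = d I *\<^sub>R j (haar I))"

definition rademacher_pairing ::
  "((real \<Rightarrow> real) \<Rightarrow> 'y::real_normed_vector) \<Rightarrow> ('y \<Rightarrow>\<^sub>L 'y) \<Rightarrow> nat \<Rightarrow> real" where
  "rademacher_pairing j D n =
     blinfun_apply (haar_functional j (rademacher n)) (blinfun_apply D (j (rademacher n)))"

definition cluster_points :: "(nat \<Rightarrow> real) \<Rightarrow> real set" where
  "cluster_points x = {c. \<forall>U. open U \<and> c \<in> U \<longrightarrow> (\<exists>\<^sub>F n in sequentially. x n \<in> U)}"

definition factors_through ::
  "('y::real_normed_vector \<Rightarrow>\<^sub>L 'y) \<Rightarrow> ('y \<Rightarrow>\<^sub>L 'y) \<Rightarrow> real \<Rightarrow> real \<Rightarrow> bool" where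
  "factors_through S T C \<eta> \<longleftrightarrow>
     (\<exists>A B :: 'y \<Rightarrow>\<^sub>L 'y. norm A * norm B \<le> C \<and> norm (S - (A o\<^sub>L T o\<^sub>L B)) \<le> \<eta>)"

definition projectionally_factors_through ::
  "('y::real_normed_vector \<Rightarrow>\<^sub>L 'y) \<Rightarrow> ('y \<Rightarrow>\<^sub>L 'y) \<Rightarrow> real \<Rightarrow> real \<Rightarrow> bool" where
  "projectionally_factors_through S T C \<eta> \<longleftrightarrow>
     (\<exists>A B :: 'y \<Rightarrow>\<^sub>L 'y. norm A * norm B \<le> C \<and> norm (S - (A o\<^sub>L T o\<^sub>L B)) \<le> \<eta> \<and>
        A o\<^sub>L B = id_blinfun)"

text \<open>Factorization with constant \<open>C\<^sup>+\<close> and without error.\<close>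

definition factors_through_plus ::
  "('y::real_normed_vector \<Rightarrow>\<^sub>L 'y) \<Rightarrow> ('y \<Rightarrow>\<^sub>L 'y) \<Rightarrow> real \<Rightarrow> bool" where
  "factors_through_plus S T C \<longleftrightarrow> (\<forall>\<gamma>>0. factors_through S T (C + \<gamma>) 0)"

text \<open>The minimum is taken in \<open>ereal\<close>, where \<open>1 / 0 = \<infinity>\<close>.  It is always finite.\<close>

definition min_const :: "real \<Rightarrow> real" where
  "min_const c = real_of_ereal (min (1 / ereal \<bar>c\<bar>) (1 / ereal \<bar>1 - c\<bar>))"

lemma min_const_0: "min_const 0 = 1" and min_const_1: "min_const 1 = 1"
  by (simp_all add: min_const_def one_ereal_def)

lemma min_const_eq:
  assumes "c \<noteq> 0" "c \<noteq> 1"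
  shows "min_const c = min (1 / \<bar>c\<bar>) (1 / \<bar>1 - c\<bar>)"
  using assms by (simp add: min_const_def one_ereal_def min_def)

end

(*
Under the Haar system, [0,1) is the binary tree of digit sequences. The norm of X(r) is
invariant under automorphisms of this tree (which map h_I to +-h_J with |I| = |J|) and under the
map B that replaces the digits by a subsequence of digits: both preserve the distribution of the
function of s whose norm in X is taken. Averaging over automorphisms then gives a contractive
left inverse A of B, and the compression A U^-1 D U B of a Haar multiplier D, for an
automorphism U, is the Haar multiplier whose entries are averages of the entries of D over
intervals of equal length.

The subsequence and U are chosen so that these averages are almost constant. Along a subsequence
of levels, the averages of the entries over each dyadic interval converge to a finitely additive
set function lambda of bounded density, of total mass c. The level n_k is so large that averages
at this level are close to lambda, and the swaps at this level are signs balancing the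
differences of lambda on the two halves of the intervals. The averages at a node and at its
parent then differ by summable amounts, so the compression is close in norm to c times the
identity. The errors along a branch need not tend to 0, hence closeness comes from the total
variation of the entries along the edges of the tree and not from a sum over all entries.
*)

theory Submission
  imports Defs "HOL-Complex_Analysis.Great_Picard"
begin

section \<open>Operators on Banach spaces\<close>

text \<open>The pairing of r_n with D r_n is the mean of the entries of D over all intervals of
  length 2^-n; hence a cluster point c is the total mass of lambda. The entries at level n_k
  themselves need not be close to a density of lambda: only their sums over intervals of length 2^-p
  are, with p = n_(k-1) + 1. This suffices because no digit from p to n_k - 1 is selected, so that a
  fiber of the selection consists of complete subtrees below words of length p. All levels n_k are
  fixed before the automorphism. This is possible because the approximation is uniform over all
  words of length p, and because signs chosen greedily leave an imbalance of at most one term, C /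
  2^n_k, whatever the automorphism does at earlier levels. Normalisation by the measure 2^-k of a
  fiber gives 2^k C / 2^n_k, which is small for large n_k. The identity A B = I yields A (I - D) B =
  I - A D B, so that one pair of operators serves D with the scalar c and I - D with 1 - c. Since c
  or 1 - c has absolute value at least 1/2, one of the two constants is at most 2.\<close>

lemma blinfun_extension_dense:
  fixes g :: "'a::real_normed_vector \<Rightarrow> 'b::banach"
  assumes V: "subspace V" "closure V = UNIV" and C: "0 \<le> C"
    and add: "\<And>x y. x \<in> V \<Longrightarrow> y \<in> V \<Longrightarrow> g (x + y) = g x + g y"
    and scale: "\<And>c x. x \<in> V \<Longrightarrow> g (c *\<^sub>R x) = c *\<^sub>R g x"
    and bound: "\<And>x. x \<in> V \<Longrightarrow> norm (g x) \<le> C * norm x"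
  obtains P :: "'a \<Rightarrow>\<^sub>L 'b" where "\<And>x. x \<in> V \<Longrightarrow> blinfun_apply P x = g x" "norm P \<le> C"
proof -
  have diff: "g (x - y) = g x - g y" if "x \<in> V" "y \<in> V" for x y
    using add[of x "(-1) *\<^sub>R y"] scale[of y "-1"] that V(1)
    by (simp add: subspace_neg)
  have "C-lipschitz_on V g"
  proof (rule lipschitz_onI)
    fix x y assume "x \<in> V" "y \<in> V"
    then show "dist (g x) (g y) \<le> C * dist x y"
      using bound[of "x - y"] diff[of x y] V(1) by (simp add: dist_norm subspace_diff)
  qed (rule C)
  then have "uniformly_continuous_on V g"
    by (rule lipschitz_on_uniformly_continuous)
  then obtain h where h: "uniformly_continuous_on (closure V) h" "\<And>x. x \<in> V \<Longrightarrow> g x = h x"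
    by (rule uniformly_continuous_on_extension_on_closure) blast
  have cont: "continuous_on UNIV h"
    using uniformly_continuous_imp_continuous[OF h(1)] V(2) by simp
  have lim: "(\<lambda>n. h (x n)) \<longlonglongrightarrow> h l" if "x \<longlonglongrightarrow> l" for x l
    using continuous_on_tendsto_compose[OF cont that] by simp
  have approx: "\<exists>x. (\<forall>n. x n \<in> V) \<and> x \<longlonglongrightarrow> l" for l
    using V(2) closure_sequential[of l V] by auto
  have hb: "norm (h x) \<le> C * norm x" for x
  proof -
    obtain u where u: "\<forall>n. u n \<in> V" "u \<longlonglongrightarrow> x"
      using approx by meson
    have "(\<lambda>n. norm (h (u n))) \<longlonglongrightarrow> norm (h x)"
      using lim u(2) by (intro tendsto_intros) blast+
    moreover have "(\<lambda>n. C * norm (u n)) \<longlonglongrightarrow> C * norm x"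
      using u(2) by (intro tendsto_intros)
    moreover have "norm (h (u n)) \<le> C * norm (u n)" for n
      using bound[of "u n"] h(2) u(1) by simp
    ultimately show ?thesis
      by (intro LIMSEQ_le[of "\<lambda>n. norm (h (u n))" _ "\<lambda>n. C * norm (u n)"]) auto
  qed
  have bl: "bounded_linear h"
  proof (rule bounded_linear_intro)
    fix x y
    obtain u v where u: "\<forall>n. u n \<in> V" "u \<longlonglongrightarrow> x" and v: "\<forall>n. v n \<in> V" "v \<longlonglongrightarrow> y"
      using approx by meson
    have "(\<lambda>n. h (u n + v n)) \<longlonglongrightarrow> h (x + y)"
      using lim tendsto_add[OF u(2) v(2)] by blast
    moreover have "h (u n + v n) = h (u n) + h (v n)" for n
      using add[of "u n" "v n"] h(2) u(1) v(1) V(1) by (metis subspace_add)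
    moreover have "(\<lambda>n. h (u n) + h (v n)) \<longlonglongrightarrow> h x + h y"
      using lim u(2) v(2) by (intro tendsto_add) blast+
    ultimately show "h (x + y) = h x + h y"
      using LIMSEQ_unique by auto
  next
    fix c x
    obtain u where u: "\<forall>n. u n \<in> V" "u \<longlonglongrightarrow> x"
      using approx by meson
    have "(\<lambda>n. h (c *\<^sub>R u n)) \<longlonglongrightarrow> h (c *\<^sub>R x)"
      using u(2) by (intro lim tendsto_intros)
    moreover have "h (c *\<^sub>R u n) = c *\<^sub>R h (u n)" for n
      using scale[of "u n" c] h(2) u(1) V(1) by (metis subspace_scale)
    moreover have "(\<lambda>n. c *\<^sub>R h (u n)) \<longlonglongrightarrow> c *\<^sub>R h x"
      using lim u(2) by (intro tendsto_intros) blast+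
    ultimately show "h (c *\<^sub>R x) = c *\<^sub>R h x"
      using LIMSEQ_unique by auto
  next
    fix x show "norm (h x) \<le> norm x * C"
      using hb[of x] by (simp add: mult.commute)
  qed
  have "norm (Blinfun h) \<le> C"
    using C bl hb by (intro norm_blinfun_bound) (auto simp: bounded_linear_Blinfun_apply)
  then show thesis
    using that[of "Blinfun h"] bl h(2) by (simp add: bounded_linear_Blinfun_apply)
qed

lemma norm_blinfun_le: "norm P \<le> C \<Longrightarrow> norm (blinfun_apply P y) \<le> C * norm y"
  by (rule order_trans[OF norm_blinfun mult_right_mono]) auto

text \<open>The estimate |c| |x| \<le> |S x| + \<eta> |x| gives injectivity and the norm of the
  inverse. Surjectivity comes from the fixed point of x -> (y + Z x) / c, a contraction with factor
  \<eta> / |c|, where Z is the difference between the scalar operator and S.\<close>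

lemma blinfun_inverse_near_scalar:
  fixes S :: "'a::banach \<Rightarrow>\<^sub>L 'a"
  assumes "norm (c *\<^sub>R id_blinfun - S) \<le> \<eta>" "\<eta> < \<bar>c\<bar>"
  obtains R where "R o\<^sub>L S = id_blinfun" "norm R \<le> 1 / (\<bar>c\<bar> - \<eta>)"
proof -
  let ?Z = "c *\<^sub>R id_blinfun - S"
  have eta: "0 \<le> \<eta>"
    using assms(1) norm_ge_zero order_trans by blast
  have c: "c \<noteq> 0"
    using assms eta by auto
  have Zb: "norm (blinfun_apply ?Z x) \<le> \<eta> * norm x" for x
    using assms(1) by (rule norm_blinfun_le)
  have lower: "(\<bar>c\<bar> - \<eta>) * norm x \<le> norm (blinfun_apply S x)" for x
  proof -
    have "c *\<^sub>R x = blinfun_apply S x + blinfun_apply ?Z x"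
      by (simp add: blinfun.diff_left blinfun.scaleR_left)
    then have "\<bar>c\<bar> * norm x \<le> norm (blinfun_apply S x) + norm (blinfun_apply ?Z x)"
      by (metis norm_scaleR norm_triangle_ineq)
    then show ?thesis
      using Zb[of x] by (simp add: algebra_simps)
  qed
  have inj: "x = y" if "blinfun_apply S x = blinfun_apply S y" for x y
    using lower[of "x - y"] that assms(2) by (simp add: blinfun.diff_right mult_le_0_iff)
  have surj: "\<exists>x. blinfun_apply S x = y" for y
  proof -
    let ?f = "\<lambda>x. (1 / c) *\<^sub>R (y + blinfun_apply ?Z x)"
    have "\<exists>!x. ?f x = x"
    proof (rule banach_fix_type)
      show "0 \<le> \<eta> / \<bar>c\<bar>" "\<eta> / \<bar>c\<bar> < 1"
        using eta assms(2) by auto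
      show "\<forall>x x'. dist (?f x) (?f x') \<le> \<eta> / \<bar>c\<bar> * dist x x'"
      proof (intro allI)
        fix x x'
        have "?f x - ?f x' = (1 / c) *\<^sub>R blinfun_apply ?Z (x - x')"
          by (simp only: blinfun.diff_right scaleR_right_diff_distrib scaleR_right_distrib) simp
        then show "dist (?f x) (?f x') \<le> \<eta> / \<bar>c\<bar> * dist x x'"
          using Zb[of "x - x'"] c by (simp add: dist_norm divide_simps)
      qed
    qed
    then obtain x where "(1 / c) *\<^sub>R (y + blinfun_apply ?Z x) = x"
      by blast
    then have "c *\<^sub>R ((1 / c) *\<^sub>R (y + blinfun_apply ?Z x)) = c *\<^sub>R x"
      by simp
    then have "y + blinfun_apply ?Z x = c *\<^sub>R x"
      using c by simp
    then have "blinfun_apply S x = y"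
      by (simp add: blinfun.diff_left blinfun.scaleR_left)
    then show ?thesis ..
  qed
  define h where "h y = (SOME x. blinfun_apply S x = y)" for y
  have Sh: "blinfun_apply S (h y) = y" for y
    unfolding h_def using someI_ex[OF surj] .
  have hb: "norm (h y) \<le> norm y * (1 / (\<bar>c\<bar> - \<eta>))" for y
    using lower[of "h y"] assms(2) by (simp add: Sh field_simps)
  have bl: "bounded_linear h"
    by (rule bounded_linear_intro[OF _ _ hb]; rule inj) (simp_all add: Sh blinfun.add_right blinfun.scaleR_right)
  have "norm (Blinfun h) \<le> 1 / (\<bar>c\<bar> - \<eta>)"
    using hb assms(2) by (intro norm_blinfun_bound) (auto simp: bl bounded_linear_Blinfun_apply mult.commute)
  moreover have "Blinfun h o\<^sub>L S = id_blinfun"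
    by (rule blinfun_eqI, rule inj) (simp add: bl bounded_linear_Blinfun_apply Sh)
  ultimately show thesis
    using that by blast
qed

lemma factors_through_of_near_scalar:
  fixes T A B :: "'a::banach \<Rightarrow>\<^sub>L 'a"
  assumes "norm A * norm B \<le> 1" "norm (c *\<^sub>R id_blinfun - (A o\<^sub>L T o\<^sub>L B)) \<le> \<eta>" "\<eta> < \<bar>c\<bar>"
  shows "factors_through id_blinfun T (1 / (\<bar>c\<bar> - \<eta>)) 0"
proof -
  obtain R where R: "R o\<^sub>L (A o\<^sub>L T o\<^sub>L B) = id_blinfun" "norm R \<le> 1 / (\<bar>c\<bar> - \<eta>)"
    using blinfun_inverse_near_scalar assms(2,3) by blast
  have "norm (R o\<^sub>L A) * norm B \<le> norm R * (norm A * norm B)"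
    by (metis mult.assoc mult_right_mono norm_blinfun_compose norm_ge_zero)
  also have "\<dots> \<le> 1 / (\<bar>c\<bar> - \<eta>) * 1"
    using R(2) assms by (intro mult_mono) auto
  finally have "norm (R o\<^sub>L A) * norm B \<le> 1 / (\<bar>c\<bar> - \<eta>)"
    by simp
  moreover have "((R o\<^sub>L A) o\<^sub>L T) o\<^sub>L B = id_blinfun"
    unfolding R(1)[symmetric] by (rule blinfun_eqI) simp
  ultimately show ?thesis
    unfolding factors_through_def by (intro exI[of _ "R o\<^sub>L A"] exI[of _ B]) simp
qed

lemma factors_through_plus_of_near_scalar:
  fixes T :: "'a::banach \<Rightarrow>\<^sub>L 'a"
  assumes c: "c \<noteq> 0"
    and near: "\<And>\<eta>. 0 < \<eta> \<Longrightarrow> \<exists>A B :: 'a \<Rightarrow>\<^sub>L 'a. norm A * norm B \<le> 1 \<and>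
      norm (c *\<^sub>R id_blinfun - (A o\<^sub>L T o\<^sub>L B)) \<le> \<eta>"
  shows "factors_through_plus id_blinfun T (1 / \<bar>c\<bar>)"
  unfolding factors_through_plus_def
proof (intro allI impI)
  fix \<gamma> :: real assume g: "0 < \<gamma>"
  define K where "K = 1 / \<bar>c\<bar> + \<gamma>"
  \<comment> \<open>The tolerance solves 1 / (|c| - \<eta>) = K, so that inverting the near-scalar
    operator costs exactly the permitted constant.\<close>
  define \<eta> where "\<eta> = \<bar>c\<bar> - 1 / K"
  have K: "K > 1 / \<bar>c\<bar>" "K > 0"
    using g c by (auto simp: K_def add_pos_pos)
  then have "1 / K < \<bar>c\<bar>"
    using c by (simp add: field_simps)
  then have "0 < \<eta>" "\<eta> < \<bar>c\<bar>" "1 / (\<bar>c\<bar> - \<eta>) = K"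
    using K by (auto simp: \<eta>_def)
  moreover from this(1) obtain A B :: "'a \<Rightarrow>\<^sub>L 'a" where "norm A * norm B \<le> 1"
      "norm (c *\<^sub>R id_blinfun - (A o\<^sub>L T o\<^sub>L B)) \<le> \<eta>"
    using near by blast
  ultimately have "factors_through id_blinfun T K 0"
    using factors_through_of_near_scalar by metis
  then show "factors_through id_blinfun T (1 / \<bar>c\<bar> + \<gamma>) 0"
    by (simp add: K_def)
qed

lemma factors_through_plus_mono:
  assumes "factors_through_plus S T C" "C \<le> C'"
  shows "factors_through_plus S T C'"
  unfolding factors_through_plus_def
proof (intro allI impI)
  fix \<gamma> :: real assume "0 < \<gamma>"
  with assms(2) have "0 < C' - C + \<gamma>"
    by simp
  then have "factors_through S T (C + (C' - C + \<gamma>)) 0"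
    using assms(1) unfolding factors_through_plus_def by blast
  moreover have "C + (C' - C + \<gamma>) = C' + \<gamma>"
    by simp
  ultimately show "factors_through S T (C' + \<gamma>) 0"
    by simp
qed

lemma factorization_dichotomy:
  fixes T :: "'a::banach \<Rightarrow>\<^sub>L 'a"
  assumes proj: "\<And>\<eta>. 0 < \<eta> \<Longrightarrow> projectionally_factors_through (c *\<^sub>R id_blinfun) T 1 \<eta>"
  shows "(c \<noteq> 0 \<longrightarrow> factors_through_plus id_blinfun T (1 / \<bar>c\<bar>)) \<and>
    (factors_through_plus id_blinfun T 2 \<or> factors_through_plus id_blinfun (id_blinfun - T) 2) \<and>
    (factors_through_plus id_blinfun T (min_const c) \<or>
     factors_through_plus id_blinfun (id_blinfun - T) (min_const c))"
proof -
  have 1: "factors_through_plus id_blinfun T (1 / \<bar>c\<bar>)" if "c \<noteq> 0"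
  proof (rule factors_through_plus_of_near_scalar[OF that])
    fix \<eta> :: real assume "0 < \<eta>"
    then show "\<exists>A B :: 'a \<Rightarrow>\<^sub>L 'a. norm A * norm B \<le> 1 \<and>
        norm (c *\<^sub>R id_blinfun - (A o\<^sub>L T o\<^sub>L B)) \<le> \<eta>"
      using proj[of \<eta>] unfolding projectionally_factors_through_def by metis
  qed
  have 2: "factors_through_plus id_blinfun (id_blinfun - T) (1 / \<bar>1 - c\<bar>)" if "c \<noteq> 1"
  proof (rule factors_through_plus_of_near_scalar)
    fix \<eta> :: real assume "0 < \<eta>"
    then obtain A B :: "'a \<Rightarrow>\<^sub>L 'a" where AB: "norm A * norm B \<le> 1" "A o\<^sub>L B = id_blinfun"
      "norm (c *\<^sub>R id_blinfun - (A o\<^sub>L T o\<^sub>L B)) \<le> \<eta>"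
      using proj unfolding projectionally_factors_through_def by blast
    have "blinfun_apply A (blinfun_apply B x) = x" for x
      using AB(2) by (metis blinfun_apply_blinfun_compose blinfun_apply_id_blinfun id_apply)
    \<comment> \<open>Here A B = I is used: the two errors are negatives of each other and have the
      same norm.\<close>
    then have "(1 - c) *\<^sub>R id_blinfun - (A o\<^sub>L (id_blinfun - T) o\<^sub>L B) =
      - (c *\<^sub>R id_blinfun - (A o\<^sub>L T o\<^sub>L B))"
      by (intro blinfun_eqI) (simp add: blinfun.diff_left blinfun.diff_right blinfun.minus_left blinfun.add_left
          blinfun.scaleR_left algebra_simps)
    then show "\<exists>A B :: 'a \<Rightarrow>\<^sub>L 'a. norm A * norm B \<le> 1 \<and>
        norm ((1 - c) *\<^sub>R id_blinfun - (A o\<^sub>L (id_blinfun - T) o\<^sub>L B)) \<le> \<eta>"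
      using AB by (metis norm_minus_cancel)
  qed (use that in simp)
  \<comment> \<open>At c = 0 and c = 1 one of the two reciprocals is infinite; the other operator is
    then the one to use, with constant 1.\<close>
  consider "c = 0" | "c = 1" | "c \<noteq> 0" "c \<noteq> 1" by blast
  then have 3: "factors_through_plus id_blinfun T (min_const c) \<or>
     factors_through_plus id_blinfun (id_blinfun - T) (min_const c)"
    using 1 2 by cases (auto simp: min_const_0 min_const_1 min_const_eq min_def)
  have "min_const c \<le> 2"
  proof -
    consider "c = 0" | "c = 1" | "c \<noteq> 0" "c \<noteq> 1" by blast
    then show ?thesis
    proof cases
      case 3
      then have "1 / 2 \<le> \<bar>c\<bar> \<or> 1 / 2 \<le> \<bar>1 - c\<bar>"
        by linarith
      then have "1 / \<bar>c\<bar> \<le> 2 \<or> 1 / \<bar>1 - c\<bar> \<le> 2"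
        using 3 by (auto simp: field_simps)
      then show ?thesis
        using 3 by (auto simp: min_const_eq min_def)
    qed (auto simp: min_const_0 min_const_1)
  qed
  then show ?thesis
    using 1 3 factors_through_plus_mono by blast
qed

section \<open>Words and tree automorphisms\<close>

text \<open>The length is stored together with the set of nonzero digits because the set alone does
  not show trailing zeros.\<close>

definition words :: "nat \<Rightarrow> (nat \<times> nat set) set" where
  "words M = Sigma {..<M} (\<lambda>k. Pow {..<k})"

text \<open>\<open>True\<close> stands for the digit 1, the right half of an interval, where its
  Haar function is negative. It also stands for a swap of the two halves, which reverses the sign of
  the Haar function.\<close>

definition sg :: "bool \<Rightarrow> real" where
  "sg b = (if b then -1 else 1)"

text \<open>The tree automorphism that swaps the halves of the word (i, R) whenever
  \<open>\<theta> i R\<close> holds. The prefix R is taken before the automorphism acts, so the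
  swaps are attached to nodes of the source tree, and digit i of the image depends only on the
  digits up to i.\<close>

definition twist :: "(nat \<Rightarrow> nat set \<Rightarrow> bool) \<Rightarrow> nat \<Rightarrow> nat set \<Rightarrow> nat set" where
  "twist \<theta> k S = {i. i < k \<and> (i \<in> S) \<noteq> \<theta> i (S \<inter> {..<i})}"

definition sel :: "(nat \<Rightarrow> nat) \<Rightarrow> nat \<Rightarrow> nat set \<Rightarrow> nat set" where
  "sel n k S = {i. i < k \<and> n i \<in> S}"

text \<open>The length \<open>l\<close> is independent of \<open>k\<close> because a fiber over
  fixed selected digits is followed through several lengths, from the last selected digit up to
  \<open>n k\<close>.\<close>

definition fiber :: "(nat \<Rightarrow> nat) \<Rightarrow> nat \<Rightarrow> nat \<Rightarrow> nat set \<Rightarrow> nat set set" where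
  "fiber n k l T = {S. S \<subseteq> {..<l} \<and> sel n k S = T}"

lemma finite_words [simp]: "finite (words M)"
  by (auto simp: words_def)

lemma words_mono: "M \<le> M' \<Longrightarrow> words M \<subseteq> words M'"
  by (auto simp: words_def)

lemma in_words_iff: "(k, T) \<in> words M \<longleftrightarrow> k < M \<and> T \<subseteq> {..<k}"
  by (auto simp: words_def)

lemma sum_words: "sum f (words M) = (\<Sum>k<M. \<Sum>T\<in>Pow {..<k}. f (k, T))"
  unfolding words_def by (subst sum.Sigma) auto

lemma sg_mult_self [simp]: "sg b * sg b = 1" "sg b * (sg b * x) = x" "\<bar>sg b\<bar> = 1"
  by (auto simp: sg_def)

lemma finite_fiber [simp]: "finite (fiber n k l T)"
  by (rule finite_subset[of _ "Pow {..<l}"]) (auto simp: fiber_def)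

lemma twist_subset [simp]: "twist \<theta> k S \<subseteq> {..<k}"
  by (auto simp: twist_def)

lemma twist_prefix:
  assumes "j \<le> k"
  shows "twist \<theta> k S \<inter> {..<j} = twist \<theta> j (S \<inter> {..<j})"
proof (rule set_eqI)
  fix i
  show "i \<in> twist \<theta> k S \<inter> {..<j} \<longleftrightarrow> i \<in> twist \<theta> j (S \<inter> {..<j})"
  proof (cases "i < j")
    case True
    then have "S \<inter> {..<j} \<inter> {..<i} = S \<inter> {..<i}"
      by auto
    then show ?thesis
      using True assms by (simp add: twist_def)
  qed (simp add: twist_def)
qed

lemma inj_on_twist: "inj_on (twist \<theta> k) (Pow {..<k})"
proof (rule inj_onI)
  fix S S' assume S: "S \<in> Pow {..<k}" "S' \<in> Pow {..<k}" "twist \<theta> k S = twist \<theta> k S'"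
  have "i < k \<longrightarrow> (i \<in> S) = (i \<in> S')" for i
  proof (induction i rule: less_induct)
    case (less i)
    show ?case
    proof
      assume "i < k"
      then have "S \<inter> {..<i} = S' \<inter> {..<i}"
        using less by auto
      moreover have "(i \<in> twist \<theta> k S) = (i \<in> twist \<theta> k S')"
        using S(3) by simp
      ultimately show "(i \<in> S) = (i \<in> S')"
        using \<open>i < k\<close> by (auto simp: twist_def)
    qed
  qed
  then show "S = S'"
    using S(1,2) by auto
qed

lemma bij_betw_twist: "bij_betw (twist \<theta> k) (Pow {..<k}) (Pow {..<k})"
proof -
  have "twist \<theta> k ` Pow {..<k} = Pow {..<k}"
  proof (rule card_subset_eq)
    show "twist \<theta> k ` Pow {..<k} \<subseteq> Pow {..<k}"
      using twist_subset by blast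
    show "card (twist \<theta> k ` Pow {..<k}) = card (Pow {..<k})"
      by (rule card_image[OF inj_on_twist])
  qed simp
  then show ?thesis
    using inj_on_twist by (simp add: bij_betw_def)
qed

text \<open>Flips of the unselected digits act simply transitively on the words of length
  \<open>n k\<close> with given selected digits. Any \<open>T'\<close> may be the base point, which
  serves both to count a fiber and to write an average over it as an average over flips.\<close>

lemma bij_betw_sym_diff_fiber:
  assumes n: "strict_mono n" and T': "T' \<subseteq> {..<n k}"
  shows "bij_betw (sym_diff T') (Pow ({..<n k} - range n)) (fiber n k (n k) (sel n k T'))"
proof (rule bij_betwI[where g = "sym_diff T'"])
  have *: "n i < n k \<longleftrightarrow> i < k" for i
    using n by (simp add: strict_mono_less)
  show "sym_diff T' \<in> Pow ({..<n k} - range n) \<rightarrow> fiber n k (n k) (sel n k T')"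
    using T' by (auto simp: fiber_def sel_def)
  show "sym_diff T' \<in> fiber n k (n k) (sel n k T') \<rightarrow> Pow ({..<n k} - range n)"
  proof
    fix S assume S: "S \<in> fiber n k (n k) (sel n k T')"
    then have "sel n k S = sel n k T'" "S \<subseteq> {..<n k}"
      by (auto simp: fiber_def)
    then have "n i \<in> S \<longleftrightarrow> n i \<in> T'" if "i < k" for i
      using that by (auto simp: sel_def set_eq_iff)
    then show "sym_diff T' S \<in> Pow ({..<n k} - range n)"
      using T' * \<open>S \<subseteq> {..<n k}\<close> by auto
  qed
qed auto

lemma card_unselected:
  assumes n: "strict_mono (n :: nat \<Rightarrow> nat)"
  shows "card ({..<n k} - range n) = n k - k"
proof -
  have "{..<n k} - range n = {..<n k} - n ` {..<k}"
    using n by (auto simp: strict_mono_less)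
  moreover have "n ` {..<k} \<subseteq> {..<n k}"
    using n by (auto simp: strict_mono_less)
  moreover have "card (n ` {..<k}) = k"
    using n by (simp add: card_image strict_mono_imp_inj_on)
  ultimately show ?thesis
    by (simp add: card_Diff_subset)
qed

lemma card_fiber:
  assumes n: "strict_mono n" and T: "T \<subseteq> {..<k}"
  shows "card (fiber n k (n k) T) = 2 ^ (n k - k)"
proof -
  have "sel n k (n ` T) = T"
    using n T by (auto simp: sel_def strict_mono_eq)
  moreover have "n ` T \<subseteq> {..<n k}"
    using n T by (auto simp: strict_mono_less)
  ultimately show ?thesis
    using bij_betw_same_card[OF bij_betw_sym_diff_fiber[OF n, of "n ` T" k]]
    by (simp add: card_Pow card_unselected[OF n])
qed

text \<open>The word \<open>(k, T)\<close> with \<open>T \<subseteq> {..<k}\<close> is the dyadic interval of length \<open>1 / 2 ^ k\<close> whose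
  points have the set of nonzero binary digits \<open>T\<close> among the first \<open>k\<close> digits, and \<open>e (k, T)\<close> is
  the Haar function of this interval.\<close>

locale haar_tree =
  fixes e :: "nat \<times> nat set \<Rightarrow> 'y::banach"
  assumes dense: "closure {y. \<exists>M a. y = (\<Sum>w\<in>words M. a w *\<^sub>R e w)} = UNIV"
    and nonzero: "T \<subseteq> {..<k} \<Longrightarrow> e (k, T) \<noteq> 0"
    and twist_isometry:
      "norm (\<Sum>(k, T)\<in>words M. (a (k, twist \<theta> k T) * sg (\<theta> k T)) *\<^sub>R e (k, T)) =
       norm (\<Sum>w\<in>words M. a w *\<^sub>R e w)"
    and select_isometry: "strict_mono n \<Longrightarrow>
       norm (\<Sum>k<M. \<Sum>S\<in>Pow {..<n k}. a (k, sel n k S) *\<^sub>R e (n k, S)) =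
       norm (\<Sum>w\<in>words M. a w *\<^sub>R e w)"
begin

section \<open>Operators determined by their values on the Haar functions\<close>

lemma dense_closed_induct:
  assumes "closed {y. Q y}" "\<And>M a. Q (\<Sum>w\<in>words M. a w *\<^sub>R e w)"
  shows "Q y"
proof -
  have "closure {y. \<exists>M a. y = (\<Sum>w\<in>words M. a w *\<^sub>R e w)} \<subseteq> {y. Q y}"
    using assms by (intro closure_minimal) auto
  then show ?thesis
    using dense by auto
qed

lemma sum_words_pad:
  fixes f :: "nat \<times> nat set \<Rightarrow> 'b::real_vector"
  assumes "M \<le> M'"
  shows "(\<Sum>w\<in>words M. a w *\<^sub>R f w) = (\<Sum>w\<in>words M'. (if w \<in> words M then a w else 0) *\<^sub>R f w)"
  by (rule sum.mono_neutral_cong_left) (use words_mono[OF assms] in auto)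

text \<open>On finite sums the operator is defined through arbitrarily chosen coefficients. The
  bound, applied to the difference of two representations of one vector, shows that the value does
  not depend on the choice; it then also permits the extension to the closure.\<close>

lemma operator_exists:
  fixes f :: "nat \<times> nat set \<Rightarrow> 'b::banach"
  assumes C: "0 \<le> C"
    and bound: "\<And>M a. norm (\<Sum>w\<in>words M. a w *\<^sub>R f w) \<le> C * norm (\<Sum>w\<in>words M. a w *\<^sub>R e w)"
  obtains P :: "'y \<Rightarrow>\<^sub>L 'b"
    where "\<And>k T. T \<subseteq> {..<k} \<Longrightarrow> blinfun_apply P (e (k, T)) = f (k, T)" "norm P \<le> C"
proof -
  define V where "V = {y. \<exists>M a. y = (\<Sum>w\<in>words M. a w *\<^sub>R e w)}"
  define c where "c y = (SOME c. y = (\<Sum>w\<in>words (fst c). snd c w *\<^sub>R e w))" for y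
  define g where "g y = (\<Sum>w\<in>words (fst (c y)). snd (c y) w *\<^sub>R f w)" for y
  have common: "\<exists>K a' b'. (\<Sum>w\<in>words M. a w *\<^sub>R e w) = (\<Sum>w\<in>words K. a' w *\<^sub>R e w) \<and>
      (\<Sum>w\<in>words M. a w *\<^sub>R f w) = (\<Sum>w\<in>words K. a' w *\<^sub>R f w) \<and>
      (\<Sum>w\<in>words M'. b w *\<^sub>R e w) = (\<Sum>w\<in>words K. b' w *\<^sub>R e w) \<and>
      (\<Sum>w\<in>words M'. b w *\<^sub>R f w) = (\<Sum>w\<in>words K. b' w *\<^sub>R f w)" for M M' a b
    by (rule exI[of _ "max M M'"], rule exI[of _ "\<lambda>w. if w \<in> words M then a w else 0"],
        rule exI[of _ "\<lambda>w. if w \<in> words M' then b w else 0"])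
      (intro conjI sum_words_pad max.cobounded1 max.cobounded2)
  have g: "g (\<Sum>w\<in>words M. a w *\<^sub>R e w) = (\<Sum>w\<in>words M. a w *\<^sub>R f w)" for M a
  proof -
    let ?y = "\<Sum>w\<in>words M. a w *\<^sub>R e w"
    have "\<exists>c. ?y = (\<Sum>w\<in>words (fst c). snd c w *\<^sub>R e w)"
      by (rule exI[of _ "(M, a)"]) simp
    then have y: "?y = (\<Sum>w\<in>words (fst (c ?y)). snd (c ?y) w *\<^sub>R e w)"
      unfolding c_def by (rule someI_ex)
    obtain K a' b' where ab:
      "?y = (\<Sum>w\<in>words K. a' w *\<^sub>R e w)"
      "(\<Sum>w\<in>words M. a w *\<^sub>R f w) = (\<Sum>w\<in>words K. a' w *\<^sub>R f w)"
      "(\<Sum>w\<in>words (fst (c ?y)). snd (c ?y) w *\<^sub>R e w) = (\<Sum>w\<in>words K. b' w *\<^sub>R e w)"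
      "g ?y = (\<Sum>w\<in>words K. b' w *\<^sub>R f w)"
      using common[where M = M and a = a and M' = "fst (c ?y)" and b = "snd (c ?y)"] unfolding g_def by blast
    have "(\<Sum>w\<in>words K. (a' w - b' w) *\<^sub>R e w) = 0"
      using ab(1,3) y by (simp add: scaleR_left_diff_distrib sum_subtractf)
    then have "(\<Sum>w\<in>words K. (a' w - b' w) *\<^sub>R f w) = 0"
      using bound[where M = K and a = "\<lambda>w. a' w - b' w"] by simp
    then show ?thesis
      using ab(2,4) by (simp add: scaleR_left_diff_distrib sum_subtractf)
  qed
  have V: "(\<Sum>w\<in>words M. a w *\<^sub>R e w) \<in> V" for M a
    unfolding V_def by (intro CollectI exI[of _ M] exI[of _ a] refl)
  have add: "x + y \<in> V \<and> g (x + y) = g x + g y" if xy: "x \<in> V" "y \<in> V" for x y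
  proof -
    obtain M a where x: "x = (\<Sum>w\<in>words M. a w *\<^sub>R e w)"
      using xy unfolding V_def by blast
    obtain M' b where y: "y = (\<Sum>w\<in>words M'. b w *\<^sub>R e w)"
      using xy unfolding V_def by blast
    obtain K a' b' where ab: "x = (\<Sum>w\<in>words K. a' w *\<^sub>R e w)" "y = (\<Sum>w\<in>words K. b' w *\<^sub>R e w)"
      using common[where M = M and a = a and M' = M' and b = b] x y by auto
    then have "x + y = (\<Sum>w\<in>words K. (a' w + b' w) *\<^sub>R e w)"
      by (simp add: scaleR_left_distrib sum.distrib)
    then show ?thesis
      using V[of "\<lambda>w. a' w + b' w" K] g[of "\<lambda>w. a' w + b' w" K] g[of a' K] g[of b' K] ab
      by (simp add: scaleR_left_distrib sum.distrib)
  qed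
  have scale: "r *\<^sub>R x \<in> V \<and> g (r *\<^sub>R x) = r *\<^sub>R g x" if x: "x \<in> V" for r x
  proof -
    obtain M a where a: "x = (\<Sum>w\<in>words M. a w *\<^sub>R e w)"
      using x unfolding V_def by blast
    then have "r *\<^sub>R x = (\<Sum>w\<in>words M. (r * a w) *\<^sub>R e w)"
      by (simp add: scaleR_right.sum)
    then show ?thesis
      using V[of "\<lambda>w. r * a w" M] g[of "\<lambda>w. r * a w" M] g[of a M] a
      by (simp add: scaleR_right.sum)
  qed
  have "0 \<in> V"
    unfolding V_def by (auto intro!: exI[of _ 0] simp: words_def)
  then have "subspace V"
    using add scale by (auto simp: subspace_def)
  moreover have "closure V = UNIV"
    using dense by (simp add: V_def)
  moreover have "norm (g x) \<le> C * norm x" if "x \<in> V" for x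
    using that bound g by (auto simp: V_def)
  ultimately obtain P where P: "\<And>x. x \<in> V \<Longrightarrow> blinfun_apply P x = g x" "norm P \<le> C"
    using blinfun_extension_dense[of V C g] C add scale by blast
  have "blinfun_apply P (e (k, T)) = f (k, T)" if "T \<subseteq> {..<k}" for k T
  proof -
    have "(k, T) \<in> words (Suc k)"
      using that by (auto simp: words_def)
    then have *: "(\<Sum>w\<in>words (Suc k). (if w = (k, T) then 1 else 0) *\<^sub>R e w) = e (k, T)"
      "(\<Sum>w\<in>words (Suc k). (if w = (k, T) then 1 else 0) *\<^sub>R f w) = f (k, T)"
      by (simp_all add: if_distrib[of "\<lambda>r. r *\<^sub>R _"] cong: if_cong)
    then show ?thesis
      using V[of "\<lambda>w. if w = (k, T) then 1 else 0" "Suc k"]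
        g[of "\<lambda>w. if w = (k, T) then 1 else 0" "Suc k"] P(1)[of "e (k, T)"] *
      by simp
  qed
  then show thesis
    using that P(2) by blast
qed

lemma apply_sum_words:
  "blinfun_apply P (\<Sum>w\<in>words M. a w *\<^sub>R e w) = (\<Sum>w\<in>words M. a w *\<^sub>R blinfun_apply P (e w))"
  by (simp add: blinfun.sum_right blinfun.scaleR_right)

lemma operator_eqI:
  assumes "\<And>k T. T \<subseteq> {..<k} \<Longrightarrow> blinfun_apply P (e (k, T)) = blinfun_apply Q (e (k, T))"
  shows "P = Q"
proof (rule blinfun_eqI, rule dense_closed_induct)
  show "closed {y. blinfun_apply P y = blinfun_apply Q y}"
    by (intro closed_Collect_eq continuous_intros)
  show "blinfun_apply P (\<Sum>w\<in>words M. a w *\<^sub>R e w) = blinfun_apply Q (\<Sum>w\<in>words M. a w *\<^sub>R e w)" for M a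
    unfolding apply_sum_words using assms by (intro sum.cong) (auto simp: words_def)
qed

lemma norm_operator_le:
  assumes "0 \<le> C"
    and "\<And>M a. norm (blinfun_apply P (\<Sum>w\<in>words M. a w *\<^sub>R e w)) \<le> C * norm (\<Sum>w\<in>words M. a w *\<^sub>R e w)"
  shows "norm P \<le> C"
proof (rule norm_blinfun_bound[OF assms(1)], rule dense_closed_induct)
  show "closed {y. norm (blinfun_apply P y) \<le> C * norm y}"
    by (intro closed_Collect_le continuous_intros)
qed (rule assms(2))

lemma isometry_exists:
  assumes "\<And>M a. norm (\<Sum>w\<in>words M. a w *\<^sub>R f w) = norm (\<Sum>w\<in>words M. a w *\<^sub>R e w)"
  shows "\<exists>P :: 'y \<Rightarrow>\<^sub>L 'y. (\<forall>k T. T \<subseteq> {..<k} \<longrightarrow> blinfun_apply P (e (k, T)) = f (k, T)) \<and>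
    (\<forall>y. norm (blinfun_apply P y) = norm y) \<and> norm P \<le> 1"
proof -
  obtain P :: "'y \<Rightarrow>\<^sub>L 'y" where P: "\<And>k T. T \<subseteq> {..<k} \<Longrightarrow> blinfun_apply P (e (k, T)) = f (k, T)" "norm P \<le> 1"
    using operator_exists[of 1 f] assms by auto
  have "norm (blinfun_apply P y) = norm y" for y
  proof (rule dense_closed_induct)
    show "closed {y. norm (blinfun_apply P y) = norm y}"
      by (intro closed_Collect_eq continuous_intros)
    fix M a
    have "blinfun_apply P (\<Sum>w\<in>words M. a w *\<^sub>R e w) = (\<Sum>w\<in>words M. a w *\<^sub>R f w)"
      unfolding apply_sum_words using P(1) by (intro sum.cong) (auto simp: words_def)
    then show "norm (blinfun_apply P (\<Sum>w\<in>words M. a w *\<^sub>R e w)) = norm (\<Sum>w\<in>words M. a w *\<^sub>R e w)"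
      using assms by simp
  qed
  then show ?thesis
    using P by blast
qed

section \<open>Isometries induced by automorphisms and by the selection of digits\<close>

lemma sum_reindex_twist: "(\<Sum>T\<in>Pow {..<k}. h (twist \<theta> k T)) = (\<Sum>T\<in>Pow {..<k}. h T)"
  using sum.reindex_bij_betw[OF bij_betw_twist] .

lemma untwist_exists: "\<exists>v. \<forall>k T. T \<subseteq> {..<k} \<longrightarrow> v k (twist \<theta> k T) = T"
  by (rule exI[of _ "\<lambda>k. inv_into (Pow {..<k}) (twist \<theta> k)"]) (simp add: inj_on_twist)

text \<open>The push-forward of functions under the automorphism; the sign records that a swap of
  the halves reverses the Haar function.\<close>

lemma twist_operator:
  "\<exists>U :: 'y \<Rightarrow>\<^sub>L 'y.
    (\<forall>k T. T \<subseteq> {..<k} \<longrightarrow> blinfun_apply U (e (k, T)) = sg (\<theta> k T) *\<^sub>R e (k, twist \<theta> k T)) \<and>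
    norm U \<le> 1"
proof -
  obtain v where v: "\<And>k T. T \<subseteq> {..<k} \<Longrightarrow> v k (twist \<theta> k T) = T"
    using untwist_exists by blast
  define f where "f = (\<lambda>(k, T). sg (\<theta> k T) *\<^sub>R e (k, twist \<theta> k T))"
  have "norm (\<Sum>w\<in>words M. a w *\<^sub>R f w) = norm (\<Sum>w\<in>words M. a w *\<^sub>R e w)" for M a
  proof -
    \<comment> \<open>\<open>b\<close> is \<open>a\<close> transported by the inverse of the
      automorphism, so that \<open>twist_isometry\<close> applied to \<open>b\<close> returns
      \<open>a\<close>.\<close>
    define b where "b = (\<lambda>(k, T). a (k, v k T) * sg (\<theta> k (v k T)))"
    have "(\<Sum>w\<in>words M. a w *\<^sub>R f w) = (\<Sum>k<M. \<Sum>T\<in>Pow {..<k}. b (k, twist \<theta> k T) *\<^sub>R e (k, twist \<theta> k T))"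
      unfolding sum_words by (intro sum.cong refl) (simp add: f_def b_def v)
    also have "\<dots> = (\<Sum>w\<in>words M. b w *\<^sub>R e w)"
      unfolding sum_words by (intro sum.cong refl sum_reindex_twist)
    finally have "norm (\<Sum>w\<in>words M. a w *\<^sub>R f w) = norm (\<Sum>w\<in>words M. b w *\<^sub>R e w)"
      by simp
    also have "\<dots> = norm (\<Sum>(k, T)\<in>words M. (b (k, twist \<theta> k T) * sg (\<theta> k T)) *\<^sub>R e (k, T))"
      by (rule twist_isometry[symmetric])
    also have "(\<Sum>(k, T)\<in>words M. (b (k, twist \<theta> k T) * sg (\<theta> k T)) *\<^sub>R e (k, T)) =
        (\<Sum>w\<in>words M. a w *\<^sub>R e w)"
      by (intro sum.cong refl) (auto simp: in_words_iff b_def v mult.assoc)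
    finally show ?thesis .
  qed
  then obtain U :: "'y \<Rightarrow>\<^sub>L 'y" where U: "\<forall>k T. T \<subseteq> {..<k} \<longrightarrow> blinfun_apply U (e (k, T)) = f (k, T)"
      "\<forall>y. norm (blinfun_apply U y) = norm y" "norm U \<le> 1"
    using isometry_exists[of f] by blast
  show ?thesis
    by (rule exI[of _ U]) (simp add: U f_def)
qed

text \<open>The inverse operator, which is the pull-back. Both operators carry the sign of the same
  node, so the signs cancel in the composition; the words \<open>twist \<theta> k T\<close> exhaust
  level k.\<close>

lemma untwist_operator:
  "\<exists>U :: 'y \<Rightarrow>\<^sub>L 'y.
    (\<forall>k T. T \<subseteq> {..<k} \<longrightarrow> blinfun_apply U (e (k, twist \<theta> k T)) = sg (\<theta> k T) *\<^sub>R e (k, T)) \<and>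
    norm U \<le> 1"
proof -
  obtain v where v: "\<And>k T. T \<subseteq> {..<k} \<Longrightarrow> v k (twist \<theta> k T) = T"
    using untwist_exists by blast
  define f where "f = (\<lambda>(k, T). sg (\<theta> k (v k T)) *\<^sub>R e (k, v k T))"
  have "norm (\<Sum>w\<in>words M. a w *\<^sub>R f w) = norm (\<Sum>w\<in>words M. a w *\<^sub>R e w)" for M a
  proof -
    have "(\<Sum>w\<in>words M. a w *\<^sub>R f w) =
        (\<Sum>k<M. \<Sum>T\<in>Pow {..<k}. a (k, twist \<theta> k T) *\<^sub>R f (k, twist \<theta> k T))"
      unfolding sum_words by (intro sum.cong refl sum_reindex_twist[symmetric])
    also have "\<dots> = (\<Sum>(k, T)\<in>words M. (a (k, twist \<theta> k T) * sg (\<theta> k T)) *\<^sub>R e (k, T))"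
      unfolding sum_words by (intro sum.cong refl) (simp add: f_def v)
    finally show ?thesis
      by (simp only: twist_isometry)
  qed
  then obtain U :: "'y \<Rightarrow>\<^sub>L 'y" where U: "\<forall>k T. T \<subseteq> {..<k} \<longrightarrow> blinfun_apply U (e (k, T)) = f (k, T)"
      "\<forall>y. norm (blinfun_apply U y) = norm y" "norm U \<le> 1"
    using isometry_exists[of f] by blast
  show ?thesis
    by (rule exI[of _ U]) (simp add: U f_def v)
qed

text \<open>Composition with the map that keeps only the digits at the positions \<open>n i\<close>:
  the digit that decides the sign of the Haar function of (k, T) becomes the digit
  \<open>n k\<close>, so this function turns into the sum of the Haar functions over the fiber at
  that level.\<close>

lemma select_operator:
  assumes "strict_mono n"
  shows "\<exists>B :: 'y \<Rightarrow>\<^sub>L 'y.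
    (\<forall>k T. T \<subseteq> {..<k} \<longrightarrow> blinfun_apply B (e (k, T)) = (\<Sum>S\<in>fiber n k (n k) T. e (n k, S))) \<and>
    (\<forall>y. norm (blinfun_apply B y) = norm y) \<and> norm B \<le> 1"
proof -
  define f where "f = (\<lambda>(k, T). (\<Sum>S\<in>fiber n k (n k) T. e (n k, S)))"
  have "norm (\<Sum>w\<in>words M. a w *\<^sub>R f w) = norm (\<Sum>w\<in>words M. a w *\<^sub>R e w)" for M a
  proof -
    have "(\<Sum>T\<in>Pow {..<k}. a (k, T) *\<^sub>R f (k, T)) =
        (\<Sum>S\<in>Pow {..<n k}. a (k, sel n k S) *\<^sub>R e (n k, S))" for k
    proof -
      have "(\<Sum>T\<in>Pow {..<k}. a (k, T) *\<^sub>R f (k, T)) =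
          (\<Sum>T\<in>Pow {..<k}. \<Sum>S\<in>{S \<in> Pow {..<n k}. sel n k S = T}. a (k, sel n k S) *\<^sub>R e (n k, S))"
        by (intro sum.cong refl) (simp add: f_def fiber_def scaleR_right.sum)
      also have "\<dots> = (\<Sum>S\<in>Pow {..<n k}. a (k, sel n k S) *\<^sub>R e (n k, S))"
        by (rule sum.group) (auto simp: sel_def)
      finally show ?thesis .
    qed
    then show ?thesis
      using select_isometry[OF assms, of a M] by (simp add: sum_words)
  qed
  then obtain B :: "'y \<Rightarrow>\<^sub>L 'y" where B: "\<forall>k T. T \<subseteq> {..<k} \<longrightarrow> blinfun_apply B (e (k, T)) = f (k, T)"
      "\<forall>y. norm (blinfun_apply B y) = norm y" "norm B \<le> 1"
    using isometry_exists[of f] by blast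
  show ?thesis
    by (rule exI[of _ B]) (simp add: B f_def)
qed

text \<open>This mean keeps the vectors fixed by \<open>U\<close>, annihilates those whose sign
  \<open>U\<close> reverses, and is a contraction if \<open>U\<close> is one.\<close>

definition half_sum :: "('y \<Rightarrow>\<^sub>L 'y) \<Rightarrow> ('y \<Rightarrow>\<^sub>L 'y)" where
  "half_sum U = (1 / 2) *\<^sub>R (id_blinfun + U)"

lemma norm_id_blinfun_le: "norm (id_blinfun :: 'y \<Rightarrow>\<^sub>L 'y) \<le> 1"
  by (rule norm_blinfun_bound) auto

lemma half_sum_apply: "blinfun_apply (half_sum U) y = (1 / 2) *\<^sub>R (y + blinfun_apply U y)"
  by (simp add: half_sum_def blinfun.add_left blinfun.scaleR_left)

lemma norm_half_sum: "norm U \<le> 1 \<Longrightarrow> norm (half_sum U) \<le> 1"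
  using norm_triangle_ineq[of id_blinfun U] norm_id_blinfun_le by (simp add: half_sum_def)

lemma norm_compose_le_1:
  "norm P \<le> 1 \<Longrightarrow> norm Q \<le> 1 \<Longrightarrow> norm ((P :: 'y \<Rightarrow>\<^sub>L 'y) o\<^sub>L (Q :: 'y \<Rightarrow>\<^sub>L 'y)) \<le> 1"
  by (rule order_trans[OF norm_blinfun_compose]) (simp add: mult_le_one)

text \<open>The coefficients at level \<open>M\<close> below the word \<open>(k, T)\<close> change sign under the automorphism
  that swaps the halves of these intervals, while all coefficients of lower level are fixed;
  averaging removes the former, level by level from the top.\<close>

lemma kill_descendants:
  assumes "p \<le> M" "k \<le> p"
  shows "\<exists>K :: 'y \<Rightarrow>\<^sub>L 'y. norm K \<le> 1 \<and>
    (\<forall>l S. S \<subseteq> {..<l} \<longrightarrow> l < M \<or> S \<inter> {..<k} \<noteq> T \<longrightarrow>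
      blinfun_apply K (e (l, S)) = (if p \<le> l \<and> S \<inter> {..<k} = T then 0 else e (l, S)))"
  using assms(1)
proof (induction M rule: dec_induct)
  case base
  show ?case
    by (rule exI[of _ id_blinfun]) (auto simp: norm_id_blinfun_le)
next
  case (step M)
  then obtain K :: "'y \<Rightarrow>\<^sub>L 'y" where K: "norm K \<le> 1"
    "\<And>l S. S \<subseteq> {..<l} \<Longrightarrow> l < M \<or> S \<inter> {..<k} \<noteq> T \<Longrightarrow>
      blinfun_apply K (e (l, S)) = (if p \<le> l \<and> S \<inter> {..<k} = T then 0 else e (l, S))"
    by blast
  define \<theta> where "\<theta> i S \<longleftrightarrow> i = M \<and> S \<inter> {..<k} = T" for i S
  obtain U :: "'y \<Rightarrow>\<^sub>L 'y" where U: "norm U \<le> 1"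
    "\<And>l S. S \<subseteq> {..<l} \<Longrightarrow> blinfun_apply U (e (l, S)) = sg (\<theta> l S) *\<^sub>R e (l, twist \<theta> l S)"
    using twist_operator[of \<theta>] by blast
  have kM: "k \<le> M"
    using assms(2) step.hyps by simp
  have prefix: "S \<inter> {..<M} \<inter> {..<k} = S \<inter> {..<k}" for S
    using kM by auto
  have tw: "twist \<theta> l S = S" if "S \<subseteq> {..<l}" "l \<le> M \<or> S \<inter> {..<k} \<noteq> T" for l S
    using that prefix by (auto simp: twist_def \<theta>_def)
  have low: "blinfun_apply (half_sum U) (e (l, S)) = (if l = M \<and> S \<inter> {..<k} = T then 0 else e (l, S))"
    if "S \<subseteq> {..<l}" "l \<le> M \<or> S \<inter> {..<k} \<noteq> T" for l S
    using U(2)[OF that(1)] tw[OF that] by (auto simp: half_sum_apply \<theta>_def sg_def scaleR_half_double)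
  show ?case
  \<comment> \<open>The level \<open>M\<close> is removed before \<open>K\<close> acts: inside the
    subtree \<open>K\<close> is controlled only at levels below \<open>M\<close>, and there
    \<open>half_sum U\<close> is the identity.\<close>
  proof (intro exI[of _ "K o\<^sub>L half_sum U"] conjI allI impI)
    show "norm (K o\<^sub>L half_sum U) \<le> 1"
      by (intro norm_compose_le_1 norm_half_sum K U)
    fix l S assume S: "S \<subseteq> {..<l}" "l < Suc M \<or> S \<inter> {..<k} \<noteq> T"
    then show "blinfun_apply (K o\<^sub>L half_sum U) (e (l, S)) =
        (if p \<le> l \<and> S \<inter> {..<k} = T then 0 else e (l, S))"
    proof (cases "l = M \<and> S \<inter> {..<k} = T")
      case True
      then show ?thesis
        using low[OF S(1)] step.hyps(1) by (simp add: blinfun.zero_right)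
    next
      case False
      then have *: "l < M \<or> S \<inter> {..<k} \<noteq> T"
        using S(2) by auto
      then have "l \<le> M \<or> S \<inter> {..<k} \<noteq> T"
        by auto
      then have "blinfun_apply (half_sum U) (e (l, S)) = e (l, S)"
        using low[OF S(1)] False by simp
      then show ?thesis
        using K(2)[OF S(1) *] by simp
    qed
  qed
qed

text \<open>\<open>K\<close> removes all levels above k and \<open>K'\<close> removes the word (k,
  T) from the remaining ones, so (I - K') K is the projection onto one coordinate. It is a
  difference of two contractions, whence the factor 2.\<close>

lemma coefficient_bound:
  assumes w: "(k, T) \<in> words M"
  shows "norm (a (k, T) *\<^sub>R e (k, T)) \<le> 2 * norm (\<Sum>w\<in>words M. a w *\<^sub>R e w)"
proof -
  have kT: "k < M" "T \<subseteq> {..<k}"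
    using w by (auto simp: words_def)
  let ?y = "\<Sum>w\<in>words M. a w *\<^sub>R e w"
  obtain K :: "'y \<Rightarrow>\<^sub>L 'y" where K: "norm K \<le> 1"
    "\<And>l S. S \<subseteq> {..<l} \<Longrightarrow> l < M \<Longrightarrow> blinfun_apply K (e (l, S)) = (if Suc k \<le> l then 0 else e (l, S))"
    using kill_descendants[of "Suc k" M 0 "{}"] kT by auto
  obtain K' :: "'y \<Rightarrow>\<^sub>L 'y" where K': "norm K' \<le> 1"
    "\<And>l S. S \<subseteq> {..<l} \<Longrightarrow> l < Suc k \<Longrightarrow> blinfun_apply K' (e (l, S)) = (if k \<le> l \<and> S \<inter> {..<k} = T then 0 else e (l, S))"
    using kill_descendants[of k "Suc k" k T] kT by auto
  have "blinfun_apply (K - (K' o\<^sub>L K)) (e (l, S)) = (if (l, S) = (k, T) then e (l, S) else 0)"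
    if "(l, S) \<in> words M" for l S
  proof -
    have lS: "S \<subseteq> {..<l}" "l < M"
      using that by (auto simp: words_def)
    consider "l < k" | "l = k" | "Suc k \<le> l"
      by linarith
    then show ?thesis
      using lS K(2)[OF lS] K'(2)[OF lS(1)] kT
      by cases (auto simp: blinfun.diff_left blinfun.zero_right Int_absorb2)
  qed
  then have "blinfun_apply (K - (K' o\<^sub>L K)) (e v) = (if v = (k, T) then e v else 0)" if "v \<in> words M" for v
    using that by (cases v) blast
  then have "blinfun_apply (K - (K' o\<^sub>L K)) ?y = (\<Sum>w\<in>words M. if w = (k, T) then a w *\<^sub>R e w else 0)"
    unfolding apply_sum_words by (intro sum.cong) simp_all
  then have "blinfun_apply (K - (K' o\<^sub>L K)) ?y = a (k, T) *\<^sub>R e (k, T)"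
    using w by simp
  moreover have "norm (K - (K' o\<^sub>L K)) \<le> 2"
    using norm_triangle_ineq4[of K "K' o\<^sub>L K"] norm_compose_le_1[OF K'(1) K(1)] K(1) by simp
  ultimately show ?thesis
    using norm_blinfun_le[of "K - (K' o\<^sub>L K)" 2 ?y] by simp
qed

text \<open>Summation by parts: the jump of \<open>z\<close> at a word multiplies the projection onto the Haar functions
  supported in the corresponding interval, which has norm at most 2.\<close>

lemma multiplier_bound:
  assumes z: "\<And>k T. T \<subseteq> {..<k} \<Longrightarrow> blinfun_apply Z (e (k, T)) = z k T *\<^sub>R e (k, T)"
    and root: "\<bar>z 0 {}\<bar> \<le> \<delta>"
    and step: "\<And>k T. T \<subseteq> {..<Suc k} \<Longrightarrow> \<bar>z (Suc k) T - z k (T \<inter> {..<k})\<bar> \<le> \<epsilon> k"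
    and total: "\<And>M. \<delta> + (\<Sum>k<M. 2 ^ (k + 2) * \<epsilon> k) \<le> \<eta>"
  shows "norm Z \<le> \<eta>"
proof (rule norm_operator_le)
  show eta: "0 \<le> \<eta>"
    using root total[of 0] by simp
  fix M a
  let ?y = "\<Sum>w\<in>words M. a w *\<^sub>R e w"
  define jump where "jump k T = z (Suc k) T - z k (T \<inter> {..<k})" for k T
  have "\<exists>R :: 'y \<Rightarrow>\<^sub>L 'y. norm R \<le> 2 \<and> (\<forall>l S. (l, S) \<in> words M \<longrightarrow>
      blinfun_apply R (e (l, S)) = (if k \<le> l \<and> S \<inter> {..<k} = T then e (l, S) else 0))" for k T
  proof (cases "k \<le> M")
    case True
    then obtain K :: "'y \<Rightarrow>\<^sub>L 'y" where K: "norm K \<le> 1"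
      "\<And>l S. S \<subseteq> {..<l} \<Longrightarrow> l < M \<Longrightarrow> blinfun_apply K (e (l, S)) = (if k \<le> l \<and> S \<inter> {..<k} = T then 0 else e (l, S))"
      using kill_descendants[of k M k T] by auto
    have "norm (id_blinfun - K) \<le> 2"
      using norm_triangle_ineq4[of id_blinfun K] K(1) norm_id_blinfun_le by simp
    then show ?thesis
      using K(2) by (intro exI[of _ "id_blinfun - K"]) (auto simp: words_def blinfun.diff_left)
  next
    case False
    then show ?thesis
      by (intro exI[of _ 0]) (auto simp: words_def)
  qed
  then obtain R :: "nat \<Rightarrow> nat set \<Rightarrow> 'y \<Rightarrow>\<^sub>L 'y" where R: "\<And>k T. norm (R k T) \<le> 2"
    "\<And>k T l S. (l, S) \<in> words M \<Longrightarrow>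
      blinfun_apply (R k T) (e (l, S)) = (if k \<le> l \<and> S \<inter> {..<k} = T then e (l, S) else 0)"
    by metis
  \<comment> \<open>Along the branch of a word the jumps telescope from the value at the root to the
    value at the word, so \<open>Q\<close> agrees with \<open>Z\<close> on all Haar functions of
    \<open>words M\<close>.\<close>
  define Q where "Q = z 0 {} *\<^sub>R id_blinfun + (\<Sum>k<M. \<Sum>T\<in>Pow {..<Suc k}. jump k T *\<^sub>R R (Suc k) T)"
  have telescope: "(\<Sum>k<l. jump k (S \<inter> {..<Suc k})) = z l (S \<inter> {..<l}) - z 0 {}" for l S
  proof (induction l)
    case (Suc l)
    have "S \<inter> {..<Suc l} \<inter> {..<l} = S \<inter> {..<l}"
      by auto
    then show ?case
      using Suc by (simp add: jump_def)
  qed simp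
  have Qe: "blinfun_apply Q (e (l, S)) = z l S *\<^sub>R e (l, S)" if lS: "(l, S) \<in> words M" for l S
  proof -
    have S: "S \<subseteq> {..<l}" "l < M"
      using lS by (auto simp: words_def)
    have "blinfun_apply (\<Sum>T\<in>Pow {..<Suc k}. jump k T *\<^sub>R R (Suc k) T) (e (l, S)) =
        (if k < l then jump k (S \<inter> {..<Suc k}) *\<^sub>R e (l, S) else 0)" for k
    proof -
      have "blinfun_apply (\<Sum>T\<in>Pow {..<Suc k}. jump k T *\<^sub>R R (Suc k) T) (e (l, S)) =
        (\<Sum>T\<in>Pow {..<Suc k}. if T = S \<inter> {..<Suc k} then (if k < l then jump k T *\<^sub>R e (l, S) else 0) else 0)"
        unfolding blinfun.sum_left blinfun.scaleR_left R(2)[OF lS] by (intro sum.cong) auto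
      then show ?thesis
        by (simp add: sum.delta)
    qed
    then have "blinfun_apply Q (e (l, S)) = z 0 {} *\<^sub>R e (l, S) +
        (\<Sum>k<M. if k < l then jump k (S \<inter> {..<Suc k}) *\<^sub>R e (l, S) else 0)"
      by (simp add: Q_def blinfun.add_left blinfun.sum_left blinfun.scaleR_left)
    also have "(\<Sum>k<M. if k < l then jump k (S \<inter> {..<Suc k}) *\<^sub>R e (l, S) else 0) =
        (\<Sum>k<l. jump k (S \<inter> {..<Suc k}) *\<^sub>R e (l, S))"
      using S by (intro sum.mono_neutral_cong_right) auto
    also have "\<dots> = (z l S - z 0 {}) *\<^sub>R e (l, S)"
      using telescope[of S l] S by (simp add: scaleR_left.sum[symmetric] Int_absorb2)
    finally show ?thesis
      by (simp add: scaleR_left_diff_distrib)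
  qed
  \<comment> \<open>There are 2 ^ (k + 1) words of length k + 1, and each subtree projection has
    norm at most 2; together this is the weight 2 ^ (k + 2).\<close>
  have "norm (\<Sum>k<M. \<Sum>T\<in>Pow {..<Suc k}. jump k T *\<^sub>R R (Suc k) T) \<le> (\<Sum>k<M. 2 ^ (k + 2) * \<epsilon> k)"
  proof (rule order_trans[OF norm_sum sum_mono])
    fix k
    have "norm (\<Sum>T\<in>Pow {..<Suc k}. jump k T *\<^sub>R R (Suc k) T) \<le> (\<Sum>T\<in>Pow {..<Suc k}. \<epsilon> k * 2)"
    proof (rule sum_norm_le)
      fix T assume "T \<in> Pow {..<Suc k}"
      then have j: "\<bar>jump k T\<bar> \<le> \<epsilon> k"
        using step by (auto simp: jump_def)
      have "\<bar>jump k T\<bar> * norm (R (Suc k) T) \<le> \<epsilon> k * 2"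
        using j R(1) by (intro mult_mono) auto
      then show "norm (jump k T *\<^sub>R R (Suc k) T) \<le> \<epsilon> k * 2"
        by simp
    qed
    then show "norm (\<Sum>T\<in>Pow {..<Suc k}. jump k T *\<^sub>R R (Suc k) T) \<le> 2 ^ (k + 2) * \<epsilon> k"
      by (simp add: card_Pow)
  qed
  moreover have "norm (z 0 {} *\<^sub>R (id_blinfun :: 'y \<Rightarrow>\<^sub>L 'y)) \<le> \<delta> * 1"
    unfolding norm_scaleR using root norm_id_blinfun_le by (intro mult_mono) auto
  ultimately have "norm Q \<le> \<eta>"
    unfolding Q_def using total[of M] norm_triangle_le by (smt (verit, best) norm_triangle_ineq)
  moreover have "blinfun_apply Z ?y = blinfun_apply Q ?y"
    unfolding apply_sum_words using z Qe by (intro sum.cong) (auto simp: words_def)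
  ultimately show "norm (blinfun_apply Z ?y) \<le> \<eta> * norm ?y"
    using norm_blinfun_le[of Q \<eta> ?y] by simp
qed

end

section \<open>The compression of a Haar multiplier by an automorphism and a selection of
  digits\<close>

definition compression ::
  "(nat \<Rightarrow> nat set \<Rightarrow> real) \<Rightarrow> (nat \<Rightarrow> nat) \<Rightarrow> (nat \<Rightarrow> nat set \<Rightarrow> bool) \<Rightarrow> nat \<Rightarrow> nat set \<Rightarrow> real" where
  "compression d n \<theta> k T = (\<Sum>S\<in>fiber n k (n k) T. d (n k) (twist \<theta> (n k) S)) / 2 ^ (n k - k)"

context haar_tree
begin

text \<open>A composition of means over the flips of single digits m in g. Flipping digit m reverses
  the Haar functions of level m, which are thereby annihilated; it permutes the longer words, which
  are thereby averaged; and it fixes the shorter ones.\<close>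

lemma averaging_operator:
  assumes "finite g"
  shows "\<exists>P :: 'y \<Rightarrow>\<^sub>L 'y. norm P \<le> 1 \<and> (\<forall>l S. S \<subseteq> {..<l} \<longrightarrow> blinfun_apply P (e (l, S)) =
    (if l \<in> g then 0
     else (1 / 2 ^ card (g \<inter> {..<l})) *\<^sub>R (\<Sum>F\<in>Pow (g \<inter> {..<l}). e (l, sym_diff S F))))"
  using assms
proof (induction g rule: finite_induct)
  case empty
  show ?case
    by (rule exI[of _ id_blinfun]) (simp add: norm_id_blinfun_le)
next
  case (insert m g)
  then obtain P :: "'y \<Rightarrow>\<^sub>L 'y" where P: "norm P \<le> 1"
    "\<And>l S. S \<subseteq> {..<l} \<Longrightarrow> blinfun_apply P (e (l, S)) = (if l \<in> g then 0
       else (1 / 2 ^ card (g \<inter> {..<l})) *\<^sub>R (\<Sum>F\<in>Pow (g \<inter> {..<l}). e (l, sym_diff S F)))"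
    by blast
  define \<theta> where "\<theta> i S \<longleftrightarrow> i = m" for i and S :: "nat set"
  obtain U :: "'y \<Rightarrow>\<^sub>L 'y" where U: "norm U \<le> 1"
    "\<And>l S. S \<subseteq> {..<l} \<Longrightarrow> blinfun_apply U (e (l, S)) = sg (\<theta> l S) *\<^sub>R e (l, twist \<theta> l S)"
    using twist_operator[of \<theta>] by blast
  have tw: "twist \<theta> l S = sym_diff S ({m} \<inter> {..<l})" if "S \<subseteq> {..<l}" for l S
    using that by (auto simp: twist_def \<theta>_def)
  have HU: "blinfun_apply (half_sum U) (e (l, S)) =
      (if l = m then 0 else (1 / 2) *\<^sub>R (e (l, S) + e (l, sym_diff S ({m} \<inter> {..<l}))))"
    if "S \<subseteq> {..<l}" for l S
    unfolding half_sum_apply U(2)[OF that] tw[OF that] by (simp add: \<theta>_def sg_def)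
  show ?case
  proof (intro exI[of _ "half_sum U o\<^sub>L P"] conjI allI impI)
    show "norm (half_sum U o\<^sub>L P) \<le> 1"
      by (intro norm_compose_le_1 norm_half_sum P U)
    fix l and S :: "nat set" assume S: "S \<subseteq> {..<l}"
    have sub: "sym_diff S F \<subseteq> {..<l}" if "F \<in> Pow (g \<inter> {..<l})" for F
      using S that by auto
    let ?c = "1 / 2 ^ card (g \<inter> {..<l})" and ?s = "\<Sum>F\<in>Pow (g \<inter> {..<l}). e (l, sym_diff S F)"
    show "blinfun_apply (half_sum U o\<^sub>L P) (e (l, S)) = (if l \<in> insert m g then 0
       else (1 / 2 ^ card (insert m g \<inter> {..<l})) *\<^sub>R (\<Sum>F\<in>Pow (insert m g \<inter> {..<l}). e (l, sym_diff S F)))"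
    proof (cases "l \<in> g")
      case True
      then show ?thesis
        using P(2)[OF S] by (simp add: blinfun.zero_right)
    next
      case False
      then have "blinfun_apply (half_sum U o\<^sub>L P) (e (l, S)) =
          ?c *\<^sub>R (\<Sum>F\<in>Pow (g \<inter> {..<l}). blinfun_apply (half_sum U) (e (l, sym_diff S F)))"
        using P(2)[OF S] by (simp add: blinfun.sum_right blinfun.scaleR_right)
      also have "\<dots> = ?c *\<^sub>R (\<Sum>F\<in>Pow (g \<inter> {..<l}).
          if l = m then 0 else (1 / 2) *\<^sub>R (e (l, sym_diff S F) + e (l, sym_diff (sym_diff S F) ({m} \<inter> {..<l}))))"
        by (intro arg_cong[of _ _ "scaleR ?c"] sum.cong refl HU sub)
      finally have eq: "blinfun_apply (half_sum U o\<^sub>L P) (e (l, S)) = \<dots>" .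
      consider "l = m" | "m < l" | "l < m" by linarith
      then show ?thesis
      proof cases
        case 1
        then show ?thesis
          unfolding eq by simp
      next
        case 2
        have ins: "insert m g \<inter> {..<l} = insert m (g \<inter> {..<l})"
          using 2 by auto
        have m: "m \<notin> g \<inter> {..<l}" "finite (g \<inter> {..<l})"
          using insert.hyps by auto
        have "(\<Sum>F\<in>Pow (insert m g \<inter> {..<l}). e (l, sym_diff S F)) =
            ?s + (\<Sum>F\<in>insert m ` Pow (g \<inter> {..<l}). e (l, sym_diff S F))"
          unfolding ins Pow_insert by (rule sum.union_disjoint) (use m in auto)
        also have "(\<Sum>F\<in>insert m ` Pow (g \<inter> {..<l}). e (l, sym_diff S F)) =
            (\<Sum>F\<in>Pow (g \<inter> {..<l}). e (l, sym_diff S (insert m F)))"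
          by (subst sum.reindex) (use m in \<open>auto intro!: inj_onI simp: o_def\<close>)
        also have "\<dots> = (\<Sum>F\<in>Pow (g \<inter> {..<l}). e (l, sym_diff (sym_diff S F) ({m} \<inter> {..<l})))"
        proof (rule sum.cong[OF refl])
          fix F assume "F \<in> Pow (g \<inter> {..<l})"
          then have "sym_diff S (insert m F) = sym_diff (sym_diff S F) ({m} \<inter> {..<l})"
            using m 2 by auto
          then show "e (l, sym_diff S (insert m F)) = e (l, sym_diff (sym_diff S F) ({m} \<inter> {..<l}))"
            by simp
        qed
        finally have s: "(\<Sum>F\<in>Pow (insert m g \<inter> {..<l}). e (l, sym_diff S F)) =
            ?s + (\<Sum>F\<in>Pow (g \<inter> {..<l}). e (l, sym_diff (sym_diff S F) ({m} \<inter> {..<l})))" .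
        have card: "card (insert m g \<inter> {..<l}) = Suc (card (g \<inter> {..<l}))"
          unfolding ins using m by simp
        then show ?thesis
          unfolding eq s card using 2 False
          by (simp add: scaleR_right.sum[symmetric] sum.distrib scaleR_right_distrib mult.commute)
      next
        case 3
        then have "insert m g \<inter> {..<l} = g \<inter> {..<l}" "{m} \<inter> {..<l} = {}"
          by auto
        then show ?thesis
          unfolding eq using 3 False by (simp add: scaleR_half_double)
      qed
    qed
  qed
qed

text \<open>The contractive left inverse of the bit selection \<open>B\<close>: after composition with the isometry
  \<open>B\<close> it becomes the average over all flips of unselected bits.\<close>

lemma select_left_inverse:
  assumes n: "strict_mono n"
  shows "\<exists>A :: 'y \<Rightarrow>\<^sub>L 'y. norm A \<le> 1 \<and> (\<forall>k S. S \<subseteq> {..<n k} \<longrightarrow>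
    blinfun_apply A (e (n k, S)) = (1 / 2 ^ (n k - k)) *\<^sub>R e (k, sel n k S))"
proof -
  obtain B :: "'y \<Rightarrow>\<^sub>L 'y" where B:
    "\<And>k T. T \<subseteq> {..<k} \<Longrightarrow> blinfun_apply B (e (k, T)) = (\<Sum>S\<in>fiber n k (n k) T. e (n k, S))"
    "\<And>y. norm (blinfun_apply B y) = norm y"
    using select_operator[OF n] by blast
  \<comment> \<open>Haar functions of unselected levels are sent to 0; at level \<open>n k\<close>
    the divisor 2 ^ (n k - k) is the number of words in a fiber.\<close>
  define f where "f = (\<lambda>(l, S). if l \<in> range n then
    (let k = inv n l in (1 / 2 ^ (l - k)) *\<^sub>R e (k, sel n k S)) else 0)"
  have f: "f (n k, S) = (1 / 2 ^ (n k - k)) *\<^sub>R e (k, sel n k S)" for k S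
    using n by (simp add: f_def inv_f_f strict_mono_imp_inj_on)
  have bound: "norm (\<Sum>w\<in>words M. a w *\<^sub>R f w) \<le> 1 * norm (\<Sum>w\<in>words M. a w *\<^sub>R e w)" for M a
  proof -
    \<comment> \<open>A word of length below \<open>M\<close> is affected only by flips at positions
      below \<open>M\<close>, so finitely many flips suffice.\<close>
    define g where "g = {..<M} - range n"
    obtain P :: "'y \<Rightarrow>\<^sub>L 'y" where P: "norm P \<le> 1" "\<And>l S. S \<subseteq> {..<l} \<Longrightarrow> blinfun_apply P (e (l, S)) =
      (if l \<in> g then 0
       else (1 / 2 ^ card (g \<inter> {..<l})) *\<^sub>R (\<Sum>F\<in>Pow (g \<inter> {..<l}). e (l, sym_diff S F)))"
      using averaging_operator[of g] by (auto simp: g_def)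
    have BP: "blinfun_apply B (f w) = blinfun_apply P (e w)" if "w \<in> words M" for w
    proof -
      obtain l S where w: "w = (l, S)" "l < M" "S \<subseteq> {..<l}"
        using \<open>w \<in> words M\<close> by (cases w) (auto simp: words_def)
      show ?thesis
      proof (cases "l \<in> range n")
        case True
        then obtain k where k: "l = n k" by blast
        have g: "g \<inter> {..<l} = {..<n k} - range n" "l \<notin> g"
          using w k by (auto simp: g_def)
        have "blinfun_apply B (f w) = (1 / 2 ^ (n k - k)) *\<^sub>R (\<Sum>S\<in>fiber n k (n k) (sel n k S). e (n k, S))"
          unfolding w k f by (subst B(1)[symmetric]) (auto simp: blinfun.scaleR_right sel_def)
        also have "(\<Sum>S\<in>fiber n k (n k) (sel n k S). e (n k, S)) =
            (\<Sum>F\<in>Pow ({..<n k} - range n). e (n k, sym_diff S F))"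
          using sum.reindex_bij_betw[OF bij_betw_sym_diff_fiber[OF n], of S k "\<lambda>S. e (n k, S)"] w k
          by simp
        finally show ?thesis
          using P(2)[OF w(3)] g card_unselected[OF n, of k] by (simp add: w k)
      next
        case False
        then have "l \<in> g"
          using w by (auto simp: g_def)
        then show ?thesis
          using P(2)[OF w(3)] False by (simp add: w f_def blinfun.zero_right)
      qed
    qed
    have "norm (\<Sum>w\<in>words M. a w *\<^sub>R f w) = norm (blinfun_apply B (\<Sum>w\<in>words M. a w *\<^sub>R f w))"
      by (simp add: B(2))
    also have "blinfun_apply B (\<Sum>w\<in>words M. a w *\<^sub>R f w) = (\<Sum>w\<in>words M. a w *\<^sub>R blinfun_apply B (f w))"
      by (simp add: blinfun.sum_right blinfun.scaleR_right)
    also have "\<dots> = blinfun_apply P (\<Sum>w\<in>words M. a w *\<^sub>R e w)"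
      unfolding apply_sum_words using BP by (intro sum.cong) auto
    finally show ?thesis
      using norm_blinfun_le[OF P(1)] by metis
  qed
  obtain A :: "'y \<Rightarrow>\<^sub>L 'y" where "\<And>l S. S \<subseteq> {..<l} \<Longrightarrow> blinfun_apply A (e (l, S)) = f (l, S)" "norm A \<le> 1"
    using operator_exists[OF zero_le_one bound] by metis
  then show ?thesis
    using f by (intro exI[of _ A]) auto
qed

text \<open>The operators are A = A0 V and B = U B0, where V inverts the automorphism operator U and
  A0 inverts the selection from the left. The sign of each swap enters through U and again through
  V, and cancels.\<close>

lemma multiplier_compression:
  assumes n: "strict_mono n"
    and D: "\<And>k T. T \<subseteq> {..<k} \<Longrightarrow> blinfun_apply D (e (k, T)) = d k T *\<^sub>R e (k, T)"
  shows "\<exists>A B :: 'y \<Rightarrow>\<^sub>L 'y. norm A * norm B \<le> 1 \<and> A o\<^sub>L B = id_blinfun \<and>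
    (\<forall>k T. T \<subseteq> {..<k} \<longrightarrow>
      blinfun_apply (A o\<^sub>L D o\<^sub>L B) (e (k, T)) = compression d n \<theta> k T *\<^sub>R e (k, T))"
proof -
  obtain A0 :: "'y \<Rightarrow>\<^sub>L 'y" where A0: "norm A0 \<le> 1" "\<And>k S. S \<subseteq> {..<n k} \<Longrightarrow>
    blinfun_apply A0 (e (n k, S)) = (1 / 2 ^ (n k - k)) *\<^sub>R e (k, sel n k S)"
    using select_left_inverse[OF n] by blast
  obtain B0 :: "'y \<Rightarrow>\<^sub>L 'y" where B0: "norm B0 \<le> 1"
    "\<And>k T. T \<subseteq> {..<k} \<Longrightarrow> blinfun_apply B0 (e (k, T)) = (\<Sum>S\<in>fiber n k (n k) T. e (n k, S))"
    using select_operator[OF n] by blast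
  obtain U :: "'y \<Rightarrow>\<^sub>L 'y" where U: "norm U \<le> 1"
    "\<And>k T. T \<subseteq> {..<k} \<Longrightarrow> blinfun_apply U (e (k, T)) = sg (\<theta> k T) *\<^sub>R e (k, twist \<theta> k T)"
    using twist_operator[of \<theta>] by blast
  obtain V :: "'y \<Rightarrow>\<^sub>L 'y" where V: "norm V \<le> 1"
    "\<And>k T. T \<subseteq> {..<k} \<Longrightarrow> blinfun_apply V (e (k, twist \<theta> k T)) = sg (\<theta> k T) *\<^sub>R e (k, T)"
    using untwist_operator[of \<theta>] by blast
  define A where "A = A0 o\<^sub>L V"
  define B where "B = U o\<^sub>L B0"
  \<comment> \<open>For \<open>D\<close> this gives the compressed entries. For the identity, with
    all entries 1, the sum over the fiber is 2 ^ (n k - k), and the same formula gives A B =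
    I.\<close>
  have compress: "blinfun_apply A (blinfun_apply C (blinfun_apply B (e (k, T)))) =
      ((\<Sum>S\<in>fiber n k (n k) T. c (n k) (twist \<theta> (n k) S)) / 2 ^ (n k - k)) *\<^sub>R e (k, T)"
    if C: "\<And>k T. T \<subseteq> {..<k} \<Longrightarrow> blinfun_apply C (e (k, T)) = c k T *\<^sub>R e (k, T)" and T: "T \<subseteq> {..<k}"
    for C :: "'y \<Rightarrow>\<^sub>L 'y" and c k T
  proof -
    have "blinfun_apply A (blinfun_apply C (blinfun_apply U (e (n k, S)))) =
        (c (n k) (twist \<theta> (n k) S) / 2 ^ (n k - k)) *\<^sub>R e (k, T)"
      if "S \<in> fiber n k (n k) T" for S
    proof -
      have S: "S \<subseteq> {..<n k}" "sel n k S = T"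
        using that by (auto simp: fiber_def)
      show ?thesis
        unfolding A_def U(2)[OF S(1)] blinfun.scaleR_right C[OF twist_subset]
          blinfun_apply_blinfun_compose V(2)[OF S(1)] A0(2)[OF S(1)]
        by (simp add: S(2) mult.left_commute)
    qed
    then show ?thesis
      unfolding B_def blinfun_apply_blinfun_compose B0(2)[OF T] blinfun.sum_right
      by (simp add: scaleR_left.sum[symmetric] sum_divide_distrib)
  qed
  have "norm A \<le> 1" "norm B \<le> 1"
    unfolding A_def B_def by (intro norm_compose_le_1 A0 B0 U V)+
  then have "norm A * norm B \<le> 1"
    by (simp add: mult_le_one)
  moreover have "A o\<^sub>L B = id_blinfun"
  proof (rule operator_eqI)
    fix k and T :: "nat set" assume T: "T \<subseteq> {..<k}"
    show "blinfun_apply (A o\<^sub>L B) (e (k, T)) = blinfun_apply id_blinfun (e (k, T))"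
      using compress[of id_blinfun "\<lambda>_ _. 1", OF _ T] card_fiber[OF n T] by simp
  qed
  moreover have "blinfun_apply (A o\<^sub>L D o\<^sub>L B) (e (k, T)) = compression d n \<theta> k T *\<^sub>R e (k, T)"
    if "T \<subseteq> {..<k}" for k T
    using compress[OF D that] by (simp add: compression_def)
  ultimately show ?thesis
    by blast
qed

end

section \<open>Stabilizing averages of a bounded function on the dyadic tree\<close>

text \<open>Greedy choice: each new term receives the sign opposite to that of the partial sum, and
  two numbers of opposite sign and absolute value at most M have a sum of absolute value at most
  M.\<close>

lemma balanced_signs:
  fixes v :: "'a \<Rightarrow> real"
  assumes "finite A" "\<And>x. x \<in> A \<Longrightarrow> \<bar>v x\<bar> \<le> M" "0 \<le> M"
  shows "\<exists>r. \<bar>\<Sum>x\<in>A. sg (r x) * v x\<bar> \<le> M"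
  using assms
proof (induction A rule: finite_induct)
  case (insert x A)
  then obtain r where r: "\<bar>\<Sum>x\<in>A. sg (r x) * v x\<bar> \<le> M"
    by auto
  define b where "b \<longleftrightarrow> (0 \<le> v x) = (0 \<le> (\<Sum>x\<in>A. sg (r x) * v x))"
  have "(\<Sum>y\<in>A. sg ((r(x := b)) y) * v y) = (\<Sum>y\<in>A. sg (r y) * v y)"
    using insert.hyps by (intro sum.cong) auto
  moreover have "\<bar>v x\<bar> \<le> M"
    using insert.prems by simp
  ultimately have "\<bar>\<Sum>y\<in>insert x A. sg ((r(x := b)) y) * v y\<bar> \<le> M"
    using insert.hyps r by (auto simp: b_def sg_def)
  then show ?case by blast
qed simp

text \<open>Recursion on the level: \<open>twist \<theta> l\<close> involves only the values of
  \<theta> below l, so \<open>\<theta> l\<close> is still free when the sums at level l have to be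
  balanced. Only levels in the range of \<open>n\<close> impose a condition.\<close>

lemma balanced_twist_exists:
  fixes \<Delta> :: "nat \<Rightarrow> nat set \<Rightarrow> real"
  assumes n: "strict_mono n" and C: "\<And>k. 0 \<le> C k"
    and \<Delta>: "\<And>k S. S \<subseteq> {..<n k} \<Longrightarrow> \<bar>\<Delta> k S\<bar> \<le> C k"
  obtains \<theta> where "\<And>k T. \<bar>\<Sum>S\<in>fiber n k (n k) T. sg (\<theta> (n k) S) * \<Delta> k (twist \<theta> (n k) S)\<bar> \<le> C k"
proof -
  define P where "P \<theta> l r \<longleftrightarrow>
    (\<forall>k T. l = n k \<longrightarrow> \<bar>\<Sum>S\<in>fiber n k l T. sg (r S) * \<Delta> k (twist \<theta> l S)\<bar> \<le> C k)"
    for \<theta> l and r :: "nat set \<Rightarrow> bool"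
  have "\<exists>\<theta>. \<forall>l. P \<theta> l (\<theta> l)"
  proof (rule dependent_wf_choice)
    show "wf less_than" by simp
    fix r and \<theta> \<theta>' :: "nat \<Rightarrow> nat set \<Rightarrow> bool" and l
    assume "\<And>z. (z, l) \<in> less_than \<Longrightarrow> \<theta> z = \<theta>' z"
    then have "twist \<theta> l = twist \<theta>' l"
      by (auto simp: twist_def fun_eq_iff)
    then show "P \<theta> l r = P \<theta>' l r"
      by (simp only: P_def)
  next
    fix l and \<theta> :: "nat \<Rightarrow> nat set \<Rightarrow> bool"
    show "\<exists>r. P \<theta> l r"
    proof (cases "l \<in> range n")
      case True
      then obtain k where k: "l = n k" by blast
      have "\<exists>r. \<bar>\<Sum>S\<in>fiber n k l T. sg (r S) * \<Delta> k (twist \<theta> l S)\<bar> \<le> C k" for T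
        using k by (intro balanced_signs C \<Delta>) auto
      then obtain r where r: "\<And>T. \<bar>\<Sum>S\<in>fiber n k l T. sg (r T S) * \<Delta> k (twist \<theta> l S)\<bar> \<le> C k"
        by metis
      \<comment> \<open>Fibers over different T are disjoint, hence every word takes the sign that
        was chosen for its own fiber.\<close>
      have "(\<Sum>S\<in>fiber n k l T. sg (r (sel n k S) S) * \<Delta> k (twist \<theta> l S)) =
          (\<Sum>S\<in>fiber n k l T. sg (r T S) * \<Delta> k (twist \<theta> l S))" for T
        by (intro sum.cong) (auto simp: fiber_def)
      then have "P \<theta> l (\<lambda>S. r (sel n k S) S)"
        using r k n by (auto simp: P_def strict_mono_eq)
      then show ?thesis
        by blast
    qed (auto simp: P_def)
  qed
  then show thesis
    using that by (auto simp: P_def)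
qed

lemma inj_on_insert_elem: "(\<And>S. S \<in> \<A> \<Longrightarrow> x \<notin> S) \<Longrightarrow> inj_on (insert x) \<A>"
  by (rule inj_onI) (metis insert_ident)

lemma twist_Suc:
  assumes "S \<subseteq> {..<m}"
  shows "twist \<theta> (Suc m) S = (if \<theta> m S then insert m (twist \<theta> m S) else twist \<theta> m S)"
    and "twist \<theta> (Suc m) (insert m S) = (if \<theta> m S then twist \<theta> m S else insert m (twist \<theta> m S))"
proof -
  have 1: "S \<inter> {..<m} = S" "insert m S \<inter> {..<m} = S" "m \<notin> S"
    using assms by auto
  have 2: "insert m S \<inter> {..<i} = S \<inter> {..<i}" if "i < m" for i
    using that by auto
  have *: "A = B" if "A \<subseteq> {..<Suc m}" "B \<subseteq> {..<Suc m}" "m \<in> A \<longleftrightarrow> m \<in> B"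
    "\<And>i. i < m \<Longrightarrow> i \<in> A \<longleftrightarrow> i \<in> B" for A B
    using that by (intro set_eqI) (metis lessThan_iff less_Suc_eq subsetD)
  have sub: "twist \<theta> m S \<subseteq> {..<Suc m}" "insert m (twist \<theta> m S) \<subseteq> {..<Suc m}"
    by (auto simp: twist_def)
  show "twist \<theta> (Suc m) S = (if \<theta> m S then insert m (twist \<theta> m S) else twist \<theta> m S)"
    by (rule *) (use 1 sub in \<open>auto simp: twist_def\<close>)
  show "twist \<theta> (Suc m) (insert m S) = (if \<theta> m S then twist \<theta> m S else insert m (twist \<theta> m S))"
    by (rule *) (use 1 2 sub in \<open>auto simp: twist_def\<close>)
qed

text \<open>All positions that define the fiber lie below p, so passing from length p to length m
  adds every extension of each word. The automorphism maps the two children of a word to the two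
  children of its image, possibly swapped, and the additivity of \<mu> makes the order
  irrelevant.\<close>

lemma fiber_sum_refine:
  fixes \<mu> :: "nat \<Rightarrow> nat set \<Rightarrow> real"
  assumes "p \<le> m" and n: "\<And>i. i < k \<Longrightarrow> n i < p"
    and \<mu>: "\<And>l S. p \<le> l \<Longrightarrow> l < m \<Longrightarrow> S \<subseteq> {..<l} \<Longrightarrow> \<mu> l S = \<mu> (Suc l) S + \<mu> (Suc l) (insert l S)"
  shows "(\<Sum>S\<in>fiber n k m T. \<mu> m (twist \<theta> m S)) = (\<Sum>S\<in>fiber n k p T. \<mu> p (twist \<theta> p S))"
  using assms(1) \<mu>
proof (induction m rule: dec_induct)
  case (step m)
  have sel: "sel n k (insert m S) = sel n k S" for S
    using n step.hyps by (fastforce simp: sel_def)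
  have fiber: "fiber n k (Suc m) T = fiber n k m T \<union> insert m ` fiber n k m T"
  proof (intro equalityI subsetI)
    fix S assume S: "S \<in> fiber n k (Suc m) T"
    then have sub: "S \<subseteq> {..<Suc m}" and T: "sel n k S = T"
      by (auto simp: fiber_def)
    show "S \<in> fiber n k m T \<union> insert m ` fiber n k m T"
    proof (cases "m \<in> S")
      case True
      then have "S = insert m (S - {m})" by auto
      moreover from this have "S - {m} \<in> fiber n k m T"
        using sub T sel[of "S - {m}"] by (auto simp: fiber_def less_Suc_eq)
      ultimately show ?thesis by blast
    next
      case False
      then show ?thesis
        using sub T by (auto simp: fiber_def less_Suc_eq subset_iff)
    qed
  next
    fix S assume "S \<in> fiber n k m T \<union> insert m ` fiber n k m T"
    then show "S \<in> fiber n k (Suc m) T"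
      using sel by (auto simp: fiber_def less_Suc_eq subset_iff)
  qed
  have notin: "m \<notin> S" if "S \<in> fiber n k m T" for S
    using that by (auto simp: fiber_def)
  have "(\<Sum>S\<in>fiber n k (Suc m) T. \<mu> (Suc m) (twist \<theta> (Suc m) S)) =
      (\<Sum>S\<in>fiber n k m T. \<mu> (Suc m) (twist \<theta> (Suc m) S)) +
      (\<Sum>S\<in>insert m ` fiber n k m T. \<mu> (Suc m) (twist \<theta> (Suc m) S))"
    unfolding fiber by (rule sum.union_disjoint) (use notin in auto)
  also have "(\<Sum>S\<in>insert m ` fiber n k m T. \<mu> (Suc m) (twist \<theta> (Suc m) S)) =
      (\<Sum>S\<in>fiber n k m T. \<mu> (Suc m) (twist \<theta> (Suc m) (insert m S)))"
    by (subst sum.reindex) (simp_all add: inj_on_insert_elem notin)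
  also have "(\<Sum>S\<in>fiber n k m T. \<mu> (Suc m) (twist \<theta> (Suc m) S)) + \<dots> =
      (\<Sum>S\<in>fiber n k m T. \<mu> m (twist \<theta> m S))"
    unfolding sum.distrib[symmetric]
  proof (rule sum.cong[OF refl])
    fix S assume "S \<in> fiber n k m T"
    then have "S \<subseteq> {..<m}" by (simp add: fiber_def)
    then show "\<mu> (Suc m) (twist \<theta> (Suc m) S) + \<mu> (Suc m) (twist \<theta> (Suc m) (insert m S)) = \<mu> m (twist \<theta> m S)"
      using step.prems[of m "twist \<theta> m S"] step.hyps by (simp add: twist_Suc)
  qed
  finally show ?case
    using step by simp
qed simp

text \<open>For k \<le> m this is the integral over the interval (k, T) of the step function with
  value \<open>d m S\<close> on each (m, S). The divisor 2 ^ m, in place of 2 ^ (m - k), makes it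
  additive over halves; at the root it is the mean over level m.\<close>

definition level_average :: "(nat \<Rightarrow> nat set \<Rightarrow> real) \<Rightarrow> nat \<Rightarrow> nat \<Rightarrow> nat set \<Rightarrow> real" where
  "level_average d m k T = (\<Sum>S | S \<subseteq> {..<m} \<and> S \<inter> {..<k} = T. d m S) / 2 ^ m"

lemma level_average_self: "T \<subseteq> {..<m} \<Longrightarrow> level_average d m m T = d m T / 2 ^ m"
proof -
  assume "T \<subseteq> {..<m}"
  then have "{S. S \<subseteq> {..<m} \<and> S \<inter> {..<m} = T} = {T}"
    by auto
  then show ?thesis
    by (simp add: level_average_def)
qed

lemma level_average_split:
  assumes "T \<subseteq> {..<k}"
  shows "level_average d m k T = level_average d m (Suc k) T + level_average d m (Suc k) (insert k T)"
proof -
  have fin: "finite {S. S \<subseteq> {..<m} \<and> Q S}" for Q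
    by (rule finite_subset[of _ "Pow {..<m}"]) auto
  have iff: "S \<inter> {..<k} = T \<longleftrightarrow> S \<inter> {..<Suc k} = T \<or> S \<inter> {..<Suc k} = insert k T" for S
  proof -
    have "S \<inter> {..<Suc k} = (if k \<in> S then insert k (S \<inter> {..<k}) else S \<inter> {..<k})"
      by (auto simp: lessThan_Suc)
    moreover have "k \<notin> T" "k \<notin> S \<inter> {..<k}"
      using assms by auto
    ultimately show ?thesis
      using insert_ident[of k "S \<inter> {..<k}" T] by auto
  qed
  have "{S. S \<subseteq> {..<m} \<and> S \<inter> {..<k} = T} =
      {S. S \<subseteq> {..<m} \<and> S \<inter> {..<Suc k} = T} \<union> {S. S \<subseteq> {..<m} \<and> S \<inter> {..<Suc k} = insert k T}"
    unfolding iff by (simp only: conj_disj_distribL Collect_disj_eq)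
  moreover have "T \<noteq> insert k T"
    using assms by auto
  ultimately have "(\<Sum>S | S \<subseteq> {..<m} \<and> S \<inter> {..<k} = T. d m S) =
      (\<Sum>S | S \<subseteq> {..<m} \<and> S \<inter> {..<Suc k} = T. d m S) +
      (\<Sum>S | S \<subseteq> {..<m} \<and> S \<inter> {..<Suc k} = insert k T. d m S)"
    using fin by (subst sum.union_disjoint[symmetric]) auto
  then show ?thesis
    by (simp add: level_average_def add_divide_distrib)
qed

text \<open>The first bound expresses that the density is at most C, once the averaging level has
  reached k. The cruder second one holds for all words and all m, as the extraction of a convergent
  subsequence requires.\<close>

lemma level_average_le:
  assumes d: "\<And>k T. T \<subseteq> {..<k} \<Longrightarrow> \<bar>d k T\<bar> \<le> C"
  shows "k \<le> m \<Longrightarrow> T \<subseteq> {..<k} \<Longrightarrow> \<bar>level_average d m k T\<bar> \<le> C / 2 ^ k"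
    and "\<bar>level_average d m k T\<bar> \<le> C"
proof -
  show "\<bar>level_average d m k T\<bar> \<le> C / 2 ^ k" if "k \<le> m" "T \<subseteq> {..<k}"
    using that
  proof (induction k arbitrary: T rule: inc_induct)
    case base
    then show ?case
      using d[of T m] by (simp add: level_average_self divide_right_mono)
  next
    case (step k)
    have "\<bar>level_average d m k T\<bar> \<le> C / 2 ^ Suc k + C / 2 ^ Suc k"
      unfolding level_average_split[OF step.prems]
      by (rule order_trans[OF abs_triangle_ineq add_mono]; rule step.IH) (use step.prems in auto)
    then show ?case
      by simp
  qed
  have fin: "finite {S. S \<subseteq> {..<m} \<and> S \<inter> {..<k} = T}"
    by (rule finite_subset[of _ "Pow {..<m}"]) auto
  have C: "0 \<le> C"
    using d[of "{}" 0] by simp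
  have "\<bar>\<Sum>S | S \<subseteq> {..<m} \<and> S \<inter> {..<k} = T. d m S\<bar> \<le> (\<Sum>S | S \<subseteq> {..<m} \<and> S \<inter> {..<k} = T. C)"
    by (rule order_trans[OF sum_abs sum_mono]) (use d in auto)
  also have "\<dots> \<le> (\<Sum>S\<in>Pow {..<m}. C)"
    by (rule sum_mono2) (use C in auto)
  finally show "\<bar>level_average d m k T\<bar> \<le> C"
    by (simp add: level_average_def card_Pow field_simps)
qed

lemma stable_compression_exists:
  fixes d :: "nat \<Rightarrow> nat set \<Rightarrow> real"
  assumes d: "\<And>k T. T \<subseteq> {..<k} \<Longrightarrow> \<bar>d k T\<bar> \<le> C"
    and r: "strict_mono r" and c: "(\<lambda>i. level_average d (r i) 0 {}) \<longlonglongrightarrow> c"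
    and \<epsilon>: "\<And>k. 0 < \<epsilon> k"
  shows "\<exists>n \<theta>. strict_mono n \<and> \<bar>compression d n \<theta> 0 {} - c\<bar> \<le> \<epsilon> 0 \<and>
    (\<forall>k T. T \<subseteq> {..<Suc k} \<longrightarrow>
      \<bar>compression d n \<theta> (Suc k) T - compression d n \<theta> k (T \<inter> {..<k})\<bar> \<le> \<epsilon> (Suc k))"
proof -
  have C: "0 \<le> C"
    using d[of "{}" 0] by simp
  have cw: "countable (\<Union>M. words M)"
    by (rule countable_UN) (auto intro: countable_finite)
  \<comment> \<open>A diagonal argument over the countably many words. The new levels form a
    subsequence of \<open>r\<close>, so the limit at the root is still c.\<close>
  obtain s where s: "strict_mono s"
    "\<And>w. w \<in> (\<Union>M. words M) \<Longrightarrow> \<exists>l. (\<lambda>i. level_average d (r (s i)) (fst w) (snd w)) \<longlonglongrightarrow> l"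
  proof (rule function_convergent_subsequence[OF cw, of "\<lambda>i w. level_average d (r i) (fst w) (snd w)" C])
    show "norm (level_average d (r i) (fst w) (snd w)) \<le> C" for i w
      using level_average_le(2)[of d C] d by simp
  qed (rule that)
  define R where "R = r \<circ> s"
  have R: "strict_mono R"
    using r s(1) by (simp add: R_def strict_mono_o)
  \<comment> \<open>\<open>L\<close> is the set function lambda. Additivity (\<open>L_split\<close>)
    and the bound on the density (\<open>L_le\<close>) pass to the limit.\<close>
  define L where "L k T = lim (\<lambda>i. level_average d (R i) k T)" for k T
  have L: "(\<lambda>i. level_average d (R i) k T) \<longlonglongrightarrow> L k T" if "T \<subseteq> {..<k}" for k T
  proof -
    have "(k, T) \<in> (\<Union>M. words M)"
      using that by (auto simp: words_def)
    then show ?thesis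
      using s(2)[of "(k, T)"] by (auto simp: L_def R_def convergent_def convergent_LIMSEQ_iff[symmetric])
  qed
  have L0: "L 0 {} = c"
    using LIMSEQ_unique[OF L[of "{}" 0]] LIMSEQ_subseq_LIMSEQ[OF c s(1)] by (simp add: R_def o_def)
  have L_split: "L k T = L (Suc k) T + L (Suc k) (insert k T)" if "T \<subseteq> {..<k}" for k T
  proof -
    have "(\<lambda>i. level_average d (R i) (Suc k) T + level_average d (R i) (Suc k) (insert k T))
        \<longlonglongrightarrow> L (Suc k) T + L (Suc k) (insert k T)"
      by (intro tendsto_add L) (use that in auto)
    then show ?thesis
      using LIMSEQ_unique[OF L[OF that]] level_average_split[OF that, of d] by simp
  qed
  have L_le: "\<bar>L k T\<bar> \<le> C / 2 ^ k" if "T \<subseteq> {..<k}" for k T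
  proof (rule LIMSEQ_le_const2[OF tendsto_rabs[OF L[OF that]]])
    have "\<bar>level_average d (R i) k T\<bar> \<le> C / 2 ^ k" if "k \<le> i" for i
      using level_average_le(1)[of d C k "R i"] d \<open>T \<subseteq> {..<k}\<close> seq_suble[OF R, of i] that by auto
    then show "\<exists>N. \<forall>i\<ge>N. \<bar>level_average d (R i) k T\<bar> \<le> C / 2 ^ k"
      by blast
  qed
  \<comment> \<open>The jump from level k to level k + 1 collects three errors: e k and e (k + 1)
    from replacing averages by \<open>L\<close>, and e k from the imbalance at level
    \<open>n k\<close>. So e k must be small compared with both \<epsilon> k and \<epsilon> (k + 1),
    and the divisor 4 leaves room for the three.\<close>
  define e where "e k = min (\<epsilon> k) (\<epsilon> (Suc k)) / 4" for k
  have e: "0 < e k" "e k \<le> \<epsilon> k / 4" "e k \<le> \<epsilon> (Suc k) / 4" for k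
    using \<epsilon>[of k] \<epsilon>[of "Suc k"] by (auto simp: e_def)
  \<comment> \<open>\<open>p\<close> is the number of digits already treated and \<open>y\<close>
    the candidate for \<open>n k\<close>. The first error is summed over at most 2 ^ p words and
    multiplied by 2 ^ k, which explains its two divisors; the last clause bounds the imbalance at
    level \<open>y\<close> after the same multiplication.\<close>
  define G where "G k p y \<longleftrightarrow> p \<le> y \<and>
    (\<forall>S\<in>Pow {..<p}. \<bar>level_average d y p S - L p S\<bar> \<le> e k / 2 ^ k / 2 ^ p) \<and> 2 ^ k * (C / 2 ^ y) \<le> e k" for k p y
  have G_ex: "\<exists>y. G k p y" for k p
  proof -
    have "\<forall>\<^sub>F i in sequentially. p \<le> R i"
      by (rule eventually_sequentiallyI[of p]) (metis seq_suble[OF R] order_trans)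
    moreover have "\<forall>\<^sub>F i in sequentially. \<forall>S\<in>Pow {..<p}. \<bar>level_average d (R i) p S - L p S\<bar> \<le> e k / 2 ^ k / 2 ^ p"
    proof (rule eventually_ball_finite, simp, rule ballI)
      fix S assume "S \<in> Pow {..<p}"
      then have "\<forall>\<^sub>F i in sequentially. dist (level_average d (R i) p S) (L p S) < e k / 2 ^ k / 2 ^ p"
        using L[of S p] e(1)[of k] by (intro tendstoD) auto
      then show "\<forall>\<^sub>F i in sequentially. \<bar>level_average d (R i) p S - L p S\<bar> \<le> e k / 2 ^ k / 2 ^ p"
        by eventually_elim (simp add: dist_real_def)
    qed
    moreover have "\<forall>\<^sub>F i in sequentially. 2 ^ k * (C / 2 ^ R i) < e k"
    proof (rule order_tendstoD(2)[OF _ e(1)])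
      have "(\<lambda>y. 2 ^ k * (C * (1 / 2) ^ y)) \<longlonglongrightarrow> 2 ^ k * (C * 0)"
        by (intro tendsto_intros LIMSEQ_power_zero) auto
      then have "((\<lambda>y. 2 ^ k * (C * (1 / 2) ^ y)) \<circ> R) \<longlonglongrightarrow> 2 ^ k * (C * 0)"
        by (rule LIMSEQ_subseq_LIMSEQ[OF _ R])
      then show "(\<lambda>i. 2 ^ k * (C / 2 ^ R i)) \<longlonglongrightarrow> 0"
        by (simp add: o_def power_one_over)
    qed
    ultimately have "\<forall>\<^sub>F i in sequentially. G k p (R i)"
      by eventually_elim (auto simp: G_def)
    then show ?thesis
      using eventually_happens by fastforce
  qed
  obtain n where n0: "G 0 0 (n 0)" and nSuc: "\<And>k. G (Suc k) (Suc (n k)) (n (Suc k))"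
    using dependent_nat_choice[of "\<lambda>k x. k = 0 \<longrightarrow> G 0 0 x" "\<lambda>k x y. G (Suc k) (Suc x) y"] G_ex
    by auto
  have n: "strict_mono n"
    unfolding strict_mono_Suc_iff using nSuc by (simp add: G_def Suc_le_eq)
  \<comment> \<open>The position right after the last digit selected before \<open>n k\<close>, so
    that the swaps at that digit are already visible in words of length \<open>p k\<close>; for k =
    0 no digit has been selected.\<close>
  define p where "p k = (case k of 0 \<Rightarrow> 0 | Suc i \<Rightarrow> Suc (n i))" for k
  have Gp: "G k (p k) (n k)" for k
    using n0 nSuc by (cases k) (auto simp: p_def)
  have np: "n i < p k" if "i < k" for i k
    using that n by (cases k) (auto simp: p_def less_Suc_eq_le strict_mono_less_eq)
  have pn: "p k \<le> n k" for k
    using Gp[of k] by (simp add: G_def)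
  define \<Delta> where "\<Delta> k S = L (Suc (n k)) S - L (Suc (n k)) (insert (n k) S)" for k S
  have "\<bar>\<Delta> k S\<bar> \<le> C / 2 ^ n k" if S: "S \<subseteq> {..<n k}" for k S
  proof -
    have "\<bar>L (Suc (n k)) S\<bar> \<le> C / 2 ^ Suc (n k)" "\<bar>L (Suc (n k)) (insert (n k) S)\<bar> \<le> C / 2 ^ Suc (n k)"
      by (rule L_le; use S in auto)+
    then have "\<bar>\<Delta> k S\<bar> \<le> C / 2 ^ Suc (n k) + C / 2 ^ Suc (n k)"
      unfolding \<Delta>_def by linarith
    then show ?thesis by simp
  qed
  then obtain \<theta> where \<theta>:
    "\<And>k T. \<bar>\<Sum>S\<in>fiber n k (n k) T. sg (\<theta> (n k) S) * \<Delta> k (twist \<theta> (n k) S)\<bar> \<le> C / 2 ^ n k"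
    using balanced_twist_exists[OF n, of "\<lambda>k. C / 2 ^ n k" \<Delta>] C by auto
  define h where "h k T = compression d n \<theta> k T" for k T
  \<comment> \<open>The lambda-mass of the image of a fiber under the automorphism. The fiber has
    measure 1 / 2 ^ k, so multiplication by 2 ^ k gives a mean density.\<close>
  define q where "q k T = (\<Sum>S\<in>fiber n k (n k) T. L (n k) (twist \<theta> (n k) S))" for k T
  have kn: "k \<le> n k" for k
    using seq_suble[OF n] .
  have hq: "\<bar>h k T - 2 ^ k * q k T\<bar> \<le> e k" for k T
  proof -
    have "h k T = 2 ^ k * (\<Sum>S\<in>fiber n k (n k) T. d (n k) (twist \<theta> (n k) S) / 2 ^ n k)"
      using kn[of k] by (simp add: h_def compression_def power_diff sum_divide_distrib[symmetric])
    also have "\<dots> = 2 ^ k * (\<Sum>S\<in>fiber n k (n k) T. level_average d (n k) (n k) (twist \<theta> (n k) S))"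
      by (simp add: level_average_self)
    \<comment> \<open>At length \<open>n k\<close> the entries of \<open>d\<close> need not be close
      to the density of \<open>L\<close>. Both sums are therefore pulled back to words of length
      \<open>p k\<close>, where \<open>G\<close> compares them.\<close>
    also have "\<dots> = 2 ^ k * (\<Sum>S\<in>fiber n k (p k) T. level_average d (n k) (p k) (twist \<theta> (p k) S))"
      by (intro arg_cong[of _ _ "(*) (2 ^ k)"] fiber_sum_refine pn np level_average_split)
    finally have h: "h k T = \<dots>" .
    have "q k T = (\<Sum>S\<in>fiber n k (p k) T. L (p k) (twist \<theta> (p k) S))"
      unfolding q_def by (intro fiber_sum_refine pn np L_split)
    then have "h k T - 2 ^ k * q k T = 2 ^ k * (\<Sum>S\<in>fiber n k (p k) T.
        level_average d (n k) (p k) (twist \<theta> (p k) S) - L (p k) (twist \<theta> (p k) S))"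
      unfolding h by (simp add: sum_subtractf right_diff_distrib)
    then have "\<bar>h k T - 2 ^ k * q k T\<bar> = 2 ^ k * \<bar>\<Sum>S\<in>fiber n k (p k) T.
        level_average d (n k) (p k) (twist \<theta> (p k) S) - L (p k) (twist \<theta> (p k) S)\<bar>"
      by (simp add: abs_mult)
    also have "\<dots> \<le> 2 ^ k * (\<Sum>S\<in>fiber n k (p k) T. e k / 2 ^ k / 2 ^ p k)"
      by (intro mult_left_mono order_trans[OF sum_abs sum_mono]) (use Gp[of k] in \<open>auto simp: G_def\<close>)
    also have "\<dots> \<le> 2 ^ k * (\<Sum>S\<in>Pow {..<p k}. e k / 2 ^ k / 2 ^ p k)"
      by (intro mult_left_mono sum_mono2) (use e(1)[of k] in \<open>auto simp: fiber_def\<close>)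
    also have "\<dots> = e k"
      by (simp add: card_Pow)
    finally show ?thesis .
  qed
  have qSuc: "\<bar>2 ^ Suc k * q (Suc k) T - 2 ^ k * q k (T \<inter> {..<k})\<bar> \<le> e k" if T: "T \<subseteq> {..<Suc k}" for k T
  proof -
    let ?m = "n k" and ?T = "T \<inter> {..<k}"
    \<comment> \<open>Digit k of T is first visible at length \<open>n k + 1\<close>: there a fiber
      for k + 1 arises from a fiber for k by appending the digit at position \<open>n k\<close> that
      T prescribes.\<close>
    define \<iota> where "\<iota> S = (if k \<in> T then insert ?m S else S)" for S
    have sel: "sel n (Suc k) S = (if ?m \<in> S then insert k (sel n k S) else sel n k S)" for S
      by (auto simp: sel_def less_Suc_eq)
    have selk: "sel n k (insert ?m S) = sel n k S" "sel n k (S - {?m}) = sel n k S" for S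
      using n by (auto simp: sel_def strict_mono_eq)
    have ksel: "k \<notin> sel n k S" for S
      by (simp add: sel_def)
    have Teq: "T = (if k \<in> T then insert k ?T else ?T)"
      using T by (auto simp: less_Suc_eq)
    have fiber: "fiber n (Suc k) (Suc ?m) T = \<iota> ` fiber n k ?m ?T"
    proof (intro equalityI subsetI)
      fix S assume "S \<in> fiber n (Suc k) (Suc ?m) T"
      then have S: "S \<subseteq> {..<Suc ?m}" "sel n (Suc k) S = T"
        by (auto simp: fiber_def)
      then have "?m \<in> S \<longleftrightarrow> k \<in> T"
        using sel[of S] ksel[of S] by (cases "?m \<in> S") auto
      then have "S = \<iota> (S - {?m})"
        by (auto simp: \<iota>_def)
      moreover have "sel n k S = ?T"
        using S(2) sel[of S] by (auto simp: sel_def)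
      then have "S - {?m} \<in> fiber n k ?m ?T"
        using S selk(2)[of S] by (auto simp: fiber_def less_Suc_eq)
      ultimately show "S \<in> \<iota> ` fiber n k ?m ?T"
        by (rule image_eqI)
    next
      fix S assume "S \<in> \<iota> ` fiber n k ?m ?T"
      then obtain S' where S': "S = \<iota> S'" "S' \<subseteq> {..<?m}" "sel n k S' = ?T"
        by (auto simp: fiber_def)
      then have "?m \<notin> S'" by auto
      then have "sel n (Suc k) S = T"
        using S' sel[of S] selk Teq by (auto simp: \<iota>_def split: if_splits)
      moreover have "S \<subseteq> {..<Suc ?m}"
        using S' by (auto simp: \<iota>_def)
      ultimately show "S \<in> fiber n (Suc k) (Suc ?m) T"
        by (simp add: fiber_def)
    qed
    have inj: "inj_on \<iota> (fiber n k ?m ?T)"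
      using inj_on_insert_elem[of "fiber n k ?m ?T" ?m] by (auto simp: \<iota>_def fiber_def inj_on_def)
    have "q (Suc k) T = (\<Sum>S\<in>fiber n (Suc k) (p (Suc k)) T. L (p (Suc k)) (twist \<theta> (p (Suc k)) S))"
      unfolding q_def by (intro fiber_sum_refine pn np L_split)
    also have "\<dots> = (\<Sum>S\<in>fiber n k ?m ?T. L (Suc ?m) (twist \<theta> (Suc ?m) (\<iota> S)))"
      unfolding p_def by (simp add: fiber sum.reindex[OF inj])
    \<comment> \<open>Each half carries half the mass of its parent plus or minus half the
      difference \<Delta>. The sign is the product of one from the prescribed digit, which is
      constant on the fiber, and one from the swap, which was chosen to balance the sum.\<close>
    also have "\<dots> = (\<Sum>S\<in>fiber n k ?m ?T. (1 / 2) * (L ?m (twist \<theta> ?m S) +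
        sg (k \<in> T) * (sg (\<theta> ?m S) * \<Delta> k (twist \<theta> ?m S))))"
    proof (rule sum.cong[OF refl])
      fix S assume "S \<in> fiber n k ?m ?T"
      then have "S \<subseteq> {..<?m}" by (simp add: fiber_def)
      then show "L (Suc ?m) (twist \<theta> (Suc ?m) (\<iota> S)) = (1 / 2) * (L ?m (twist \<theta> ?m S) +
        sg (k \<in> T) * (sg (\<theta> ?m S) * \<Delta> k (twist \<theta> ?m S)))"
        using L_split[OF twist_subset[of \<theta> ?m S]] by (simp add: \<iota>_def twist_Suc \<Delta>_def sg_def)
    qed
    also have "\<dots> = (1 / 2) * (q k ?T + sg (k \<in> T) * (\<Sum>S\<in>fiber n k ?m ?T. sg (\<theta> ?m S) * \<Delta> k (twist \<theta> ?m S)))"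
      by (simp add: sum_distrib_left[symmetric] sum.distrib q_def sum_divide_distrib[symmetric])
    finally have "2 ^ Suc k * q (Suc k) T - 2 ^ k * q k ?T =
        2 ^ k * (sg (k \<in> T) * (\<Sum>S\<in>fiber n k ?m ?T. sg (\<theta> ?m S) * \<Delta> k (twist \<theta> ?m S)))"
      by (simp add: algebra_simps)
    then have "\<bar>2 ^ Suc k * q (Suc k) T - 2 ^ k * q k ?T\<bar> =
        2 ^ k * \<bar>\<Sum>S\<in>fiber n k ?m ?T. sg (\<theta> ?m S) * \<Delta> k (twist \<theta> ?m S)\<bar>"
      by (simp add: abs_mult)
    also have "\<dots> \<le> 2 ^ k * (C / 2 ^ ?m)"
      by (intro mult_left_mono \<theta>) simp
    also have "\<dots> \<le> e k"
      using Gp[of k] by (simp add: G_def)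
    finally show ?thesis .
  qed
  have q0: "q 0 {} = c"
  proof -
    have "q 0 {} = (\<Sum>S\<in>fiber n 0 0 {}. L 0 (twist \<theta> 0 S))"
      unfolding q_def by (intro fiber_sum_refine L_split) auto
    also have "fiber n 0 0 {} = {{}}"
      by (auto simp: fiber_def sel_def)
    finally show ?thesis
      by (simp add: twist_def L0)
  qed
  have "\<bar>h 0 {} - c\<bar> \<le> \<epsilon> 0"
    using hq[of 0 "{}"] q0 e(2)[of 0] \<epsilon>[of 0] by simp
  moreover have "\<bar>h (Suc k) T - h k (T \<inter> {..<k})\<bar> \<le> \<epsilon> (Suc k)" if "T \<subseteq> {..<Suc k}" for k T
    using hq[of "Suc k" T] hq[of k "T \<inter> {..<k}"] qSuc[OF that] e(2)[of "Suc k"] e(3)[of k] \<epsilon>[of "Suc k"]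
    by linarith
  ultimately show ?thesis
    using n unfolding h_def by blast
qed

section \<open>Factorization of Haar multipliers on the tree\<close>

context haar_tree begin

lemma multiplier_projectional_factorization:
  assumes D: "\<And>k T. T \<subseteq> {..<k} \<Longrightarrow> blinfun_apply D (e (k, T)) = d k T *\<^sub>R e (k, T)"
    and r: "strict_mono r" and c: "(\<lambda>i. level_average d (r i) 0 {}) \<longlonglongrightarrow> c"
    and \<eta>: "0 < \<eta>"
  shows "projectionally_factors_through (c *\<^sub>R id_blinfun) D 1 \<eta>"
proof -
  have d: "\<bar>d k T\<bar> \<le> norm D" if T: "T \<subseteq> {..<k}" for k T
    using norm_blinfun[of D "e (k, T)"] nonzero[OF T] by (simp add: D[OF T])
  \<comment> \<open>The divisor 2 ^ (i + 2) cancels the weight in \<open>multiplier_bound\<close>;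
    the remaining geometric series contributes at most \<eta> / 2, and the root contributes the
    other half.\<close>
  define \<epsilon> where "\<epsilon> k = (case k of 0 \<Rightarrow> \<eta> / 2 | Suc i \<Rightarrow> \<eta> / 2 * (1 / 2) ^ Suc i / 2 ^ (i + 2))" for k
  have \<epsilon>: "0 < \<epsilon> k" for k
    using \<eta> by (cases k) (auto simp: \<epsilon>_def)
  have "\<exists>n \<theta>. strict_mono n \<and> \<bar>compression d n \<theta> 0 {} - c\<bar> \<le> \<epsilon> 0 \<and>
    (\<forall>k T. T \<subseteq> {..<Suc k} \<longrightarrow>
      \<bar>compression d n \<theta> (Suc k) T - compression d n \<theta> k (T \<inter> {..<k})\<bar> \<le> \<epsilon> (Suc k))"
    by (rule stable_compression_exists[OF _ r c \<epsilon>]) (rule d)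
  then obtain n \<theta> where n: "strict_mono n"
    and h0: "\<bar>compression d n \<theta> 0 {} - c\<bar> \<le> \<epsilon> 0"
    and hSuc: "\<forall>k T. T \<subseteq> {..<Suc k} \<longrightarrow>
      \<bar>compression d n \<theta> (Suc k) T - compression d n \<theta> k (T \<inter> {..<k})\<bar> \<le> \<epsilon> (Suc k)"
    by blast
  define h where "h k T = compression d n \<theta> k T" for k T
  obtain A B :: "'y \<Rightarrow>\<^sub>L 'y" where AB: "norm A * norm B \<le> 1" "A o\<^sub>L B = id_blinfun"
    and ADB: "\<forall>k T. T \<subseteq> {..<k} \<longrightarrow> blinfun_apply (A o\<^sub>L D o\<^sub>L B) (e (k, T)) = h k T *\<^sub>R e (k, T)"
    using multiplier_compression[OF n D, of \<theta>] unfolding h_def by blast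
  have "norm (c *\<^sub>R id_blinfun - (A o\<^sub>L D o\<^sub>L B)) \<le> \<eta>"
  proof (rule multiplier_bound)
    show "blinfun_apply (c *\<^sub>R id_blinfun - (A o\<^sub>L D o\<^sub>L B)) (e (k, T)) = (c - h k T) *\<^sub>R e (k, T)"
      if "T \<subseteq> {..<k}" for k T
      using ADB that by (simp add: blinfun.diff_left blinfun.scaleR_left scaleR_left_diff_distrib)
    show "\<bar>c - h 0 {}\<bar> \<le> \<epsilon> 0"
      using h0 unfolding h_def by linarith
    show "\<bar>(c - h (Suc k) T) - (c - h k (T \<inter> {..<k}))\<bar> \<le> \<epsilon> (Suc k)" if "T \<subseteq> {..<Suc k}" for k T
    proof -
      have "\<bar>h (Suc k) T - h k (T \<inter> {..<k})\<bar> \<le> \<epsilon> (Suc k)"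
        using hSuc that unfolding h_def by blast
      then show ?thesis
        by linarith
    qed
    show "\<epsilon> 0 + (\<Sum>k<M. 2 ^ (k + 2) * \<epsilon> (Suc k)) \<le> \<eta>" for M
    proof -
      have "(\<Sum>k<M. 2 ^ (k + 2) * \<epsilon> (Suc k)) = (\<Sum>k<M. \<eta> / 2 * (1 / 2) ^ Suc k)"
        by (intro sum.cong) (auto simp: \<epsilon>_def)
      also have "\<dots> = \<eta> / 2 * (1 - (1 / 2) ^ M)"
        by (induction M) (auto simp: algebra_simps)
      also have "\<dots> \<le> \<eta> / 2"
        using \<eta> by simp
      finally show ?thesis
        by (simp add: \<epsilon>_def)
    qed
  qed
  then show ?thesis
    using AB unfolding projectionally_factors_through_def by blast
qed

end

lemma cluster_point_subsequence:
  fixes x :: "nat \<Rightarrow> real"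
  assumes "c \<in> cluster_points x"
  obtains r where "strict_mono r" "(\<lambda>i. x (r i)) \<longlonglongrightarrow> c"
proof -
  have ex: "\<exists>n>m. \<bar>x n - c\<bar> < \<delta>" if "0 < \<delta>" for m \<delta>
  proof -
    have "\<exists>\<^sub>F n in sequentially. x n \<in> ball c \<delta>"
      using assms centre_in_ball[of c \<delta>] that unfolding cluster_points_def by (simp del: mem_ball)
    then show ?thesis
      unfolding frequently_sequentially by (metis Suc_le_lessD dist_real_def dist_commute mem_ball)
  qed
  obtain r where r: "\<And>i. \<bar>x (r i) - c\<bar> < 1 / real (Suc i)" "\<And>i. r i < r (Suc i)"
    using dependent_nat_choice[of "\<lambda>i n. \<bar>x n - c\<bar> < 1 / real (Suc i)" "\<lambda>i n n'. n < n'"] ex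
    by (metis of_nat_0_less_iff zero_less_Suc zero_less_divide_1_iff)
  have "(\<lambda>i. x (r i) - c) \<longlonglongrightarrow> 0"
    by (rule LIMSEQ_norm_0) (use r(1) in \<open>auto\<close>)
  then have "(\<lambda>i. x (r i)) \<longlonglongrightarrow> c"
    by (simp add: LIM_zero_iff)
  moreover have "strict_mono r"
    using r(2) by (simp add: strict_mono_Suc_iff)
  ultimately show thesis
    using that by blast
qed

section \<open>Dyadic intervals and binary digits\<close>

text \<open>Position i decides between the halves of an interval of length 1 / 2 ^ i. For a dyadic
  rational the floor yields the expansion ending in zeros, which suits intervals closed on the
  left.\<close>

definition digits :: "real \<Rightarrow> nat set" where
  "digits s = {i. odd \<lfloor>2 ^ Suc i * s\<rfloor>}"

definition left_end :: "nat set \<Rightarrow> real" where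
  "left_end T = (\<Sum>i\<in>T. 1 / 2 ^ Suc i)"

definition dyadic_interval :: "nat \<times> nat set \<Rightarrow> real set" where
  "dyadic_interval w = {left_end (snd w) ..< left_end (snd w) + 1 / 2 ^ fst w}"

lemma left_end_insert: "T \<subseteq> {..<k} \<Longrightarrow> left_end (insert k T) = left_end T + 1 / 2 ^ Suc k"
  unfolding left_end_def by (subst sum.insert) (auto intro: finite_subset)

lemma left_end_digits:
  assumes "0 \<le> s" "s < 1"
  shows "left_end (digits s \<inter> {..<k}) = \<lfloor>2 ^ k * s\<rfloor> / 2 ^ k"
proof (induction k)
  case 0
  have "\<lfloor>s\<rfloor> = 0"
    using assms by (simp add: floor_eq_iff)
  then show ?case
    by (simp add: left_end_def)
next
  case (Suc k)
  have half: "\<lfloor>2 ^ k * s\<rfloor> = \<lfloor>2 ^ Suc k * s\<rfloor> div 2"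
    using floor_divide_real_eq_div[of 2 "2 ^ Suc k * s"] by simp
  show ?case
  proof (cases "odd \<lfloor>2 ^ Suc k * s\<rfloor>")
    case True
    then have "digits s \<inter> {..<Suc k} = insert k (digits s \<inter> {..<k})"
      by (auto simp: digits_def less_Suc_eq)
    moreover have "\<lfloor>2 ^ Suc k * s\<rfloor> = 2 * \<lfloor>2 ^ k * s\<rfloor> + 1"
      using True half by presburger
    ultimately show ?thesis
      using left_end_insert[of "digits s \<inter> {..<k}" k] Suc by (simp add: field_simps)
  next
    case False
    then have "digits s \<inter> {..<Suc k} = digits s \<inter> {..<k}"
      by (auto simp: digits_def less_Suc_eq)
    moreover have "\<lfloor>2 ^ Suc k * s\<rfloor> = 2 * \<lfloor>2 ^ k * s\<rfloor>"
      using False half by presburger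
    ultimately show ?thesis
      using Suc by (simp add: field_simps)
  qed
qed

text \<open>Every multiple of 1 / 2 ^ k in [0,1) is recovered from its own digits; there are 2 ^ k
  such numbers and at most 2 ^ k left ends, so the two sets agree. The same count makes
  \<open>left_end\<close> injective.\<close>

lemma left_end_image: "left_end ` Pow {..<k} = (\<lambda>i. real i / 2 ^ k) ` {..<2 ^ k}"
proof (rule sym, rule card_seteq)
  show "(\<lambda>i. real i / 2 ^ k) ` {..<2 ^ k} \<subseteq> left_end ` Pow {..<k}"
  proof (rule image_subsetI)
    fix i :: nat assume "i \<in> {..<2 ^ k}"
    then have "real i < 2 ^ k"
      by (metis lessThan_iff of_nat_less_iff of_nat_numeral of_nat_power)
    then have "left_end (digits (real i / 2 ^ k) \<inter> {..<k}) = real i / 2 ^ k"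
      by (subst left_end_digits) auto
    then show "real i / 2 ^ k \<in> left_end ` Pow {..<k}"
      by (metis Int_lower2 PowI image_eqI)
  qed
  have "card (left_end ` Pow {..<k}) \<le> 2 ^ k"
    using card_image_le[of "Pow {..<k}" left_end] by (simp add: card_Pow)
  moreover have "card ((\<lambda>i. real i / 2 ^ k) ` {..<2 ^ k}) = 2 ^ k"
    by (subst card_image) (auto intro!: inj_onI)
  ultimately show "card (left_end ` Pow {..<k}) \<le> card ((\<lambda>i. real i / 2 ^ k) ` {..<2 ^ k})"
    by simp
qed simp

lemma inj_on_left_end: "inj_on left_end (Pow {..<k})"
proof (rule eq_card_imp_inj_on)
  have "card ((\<lambda>i. real i / 2 ^ k) ` {..<2 ^ k}) = 2 ^ k"
    by (subst card_image) (auto intro!: inj_onI)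
  then show "card (left_end ` Pow {..<k}) = card (Pow {..<k})"
    by (simp add: left_end_image card_Pow)
qed simp

lemma left_end_index:
  assumes "T \<subseteq> {..<k}"
  obtains i where "i < 2 ^ k" "left_end T = real i / 2 ^ k"
proof -
  have "left_end T \<in> (\<lambda>i. real i / 2 ^ k) ` {..<2 ^ k}"
    using assms unfolding left_end_image[symmetric] by blast
  then show thesis
    using that by auto
qed

text \<open>Membership means that the floor of 2 ^ k * s is the numerator of the left end, and
  \<open>left_end_digits\<close> identifies this floor with the first k digits.\<close>

lemma mem_dyadic_interval:
  assumes T: "T \<subseteq> {..<k}"
  shows "s \<in> dyadic_interval (k, T) \<longleftrightarrow> 0 \<le> s \<and> s < 1 \<and> digits s \<inter> {..<k} = T"
proof -
  obtain i where i: "i < 2 ^ k" "left_end T = real i / 2 ^ k"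
    using left_end_index[OF T] .
  have iff: "s \<in> dyadic_interval (k, T) \<longleftrightarrow> real i \<le> 2 ^ k * s \<and> 2 ^ k * s < real i + 1"
    by (auto simp: dyadic_interval_def i(2) field_simps)
  show ?thesis
  proof
    assume "s \<in> dyadic_interval (k, T)"
    then have s: "real i \<le> 2 ^ k * s" "2 ^ k * s < real i + 1"
      using iff by auto
    have "0 \<le> 2 ^ k * s"
      using s(1) by linarith
    then have 1: "0 \<le> s"
      by (simp only: zero_le_mult_iff) (use zero_less_power[of "2::real" k] in linarith)
    have "real i + 1 \<le> 2 ^ k"
      using i(1) by (metis Suc_leI of_nat_Suc of_nat_le_iff of_nat_numeral of_nat_power add.commute)
    then have "2 ^ k * s < 2 ^ k * 1"
      using s(2) by linarith
    then have 2: "s < 1"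
      by (simp only: mult_less_cancel_left_pos zero_less_power zero_less_numeral)
    have "\<lfloor>2 ^ k * s\<rfloor> = int i"
      using s by (simp add: floor_eq_iff)
    then have "left_end (digits s \<inter> {..<k}) = left_end T"
      using left_end_digits[OF 1 2, of k] i(2) by simp
    then have "digits s \<inter> {..<k} = T"
      using inj_on_left_end[of k] T by (auto dest: inj_onD)
    then show "0 \<le> s \<and> s < 1 \<and> digits s \<inter> {..<k} = T"
      using 1 2 by simp
  next
    assume s: "0 \<le> s \<and> s < 1 \<and> digits s \<inter> {..<k} = T"
    then have "\<lfloor>2 ^ k * s\<rfloor> / 2 ^ k = real i / 2 ^ k"
      using left_end_digits[of s k] i(2) by simp
    then have "\<lfloor>2 ^ k * s\<rfloor> = int i"
      by simp
    then show "s \<in> dyadic_interval (k, T)"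
      unfolding iff by linarith
  qed
qed

lemma left_end_mem: "T \<subseteq> {..<k} \<Longrightarrow> left_end T \<in> dyadic_interval (k, T)"
  by (simp add: dyadic_interval_def)

lemma dyadic_eq: "dyadic = dyadic_interval ` (\<Union>M. words M)"
proof (intro equalityI subsetI)
  fix I assume "I \<in> dyadic"
  then obtain i j :: nat where I: "I = {(real i - 1) / 2 ^ j ..< real i / 2 ^ j}" "1 \<le> i" "i \<le> 2 ^ j"
    by (auto simp: dyadic_def)
  then have "real (i - 1) / 2 ^ j \<in> left_end ` Pow {..<j}"
    unfolding left_end_image by (intro imageI) auto
  then obtain T where T: "T \<subseteq> {..<j}" "left_end T = real (i - 1) / 2 ^ j"
    by auto
  have "I = dyadic_interval (j, T)"
    using I T(2) by (simp add: dyadic_interval_def of_nat_diff add_divide_distrib[symmetric])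
  moreover have "(j, T) \<in> (\<Union>M. words M)"
    using T(1) by (auto simp: words_def)
  ultimately show "I \<in> dyadic_interval ` (\<Union>M. words M)"
    by blast
next
  fix I assume "I \<in> dyadic_interval ` (\<Union>M. words M)"
  then obtain k T where T: "T \<subseteq> {..<k}" "I = dyadic_interval (k, T)"
    by (auto simp: words_def)
  obtain i where i: "i < 2 ^ k" "left_end T = real i / 2 ^ k"
    using left_end_index[OF T(1)] .
  have "I = {(real (Suc i) - 1) / 2 ^ k ..< real (Suc i) / 2 ^ k}"
    by (simp add: T(2) dyadic_interval_def i(2) add_divide_distrib add.commute)
  then show "I \<in> dyadic"
    unfolding dyadic_def using i(1) by (intro CollectI exI[of _ "Suc i"] exI[of _ k]) auto
qed

lemma dyadic_interval_in_dyadic: "T \<subseteq> {..<k} \<Longrightarrow> dyadic_interval (k, T) \<in> dyadic"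
  unfolding dyadic_eq by (intro imageI) (auto simp: words_def)

lemma dyadic_interval_eq_iff:
  assumes "T \<subseteq> {..<k}" "T' \<subseteq> {..<k'}"
  shows "dyadic_interval (k, T) = dyadic_interval (k', T') \<longleftrightarrow> k = k' \<and> T = T'"
proof
  assume eq: "dyadic_interval (k, T) = dyadic_interval (k', T')"
  then have "left_end T = left_end T'" "(1::real) / 2 ^ k = 1 / 2 ^ k'"
    by (auto simp: dyadic_interval_def Ico_eq_Ico)
  then have "k = k'"
    by simp
  moreover from this have "T = T'"
    using assms inj_on_left_end[of k] \<open>left_end T = left_end T'\<close> by (auto dest: inj_onD)
  ultimately show "k = k' \<and> T = T'" ..
qed simp

lemma inj_on_dyadic_interval: "inj_on dyadic_interval (\<Union>M. words M)"
  by (rule inj_onI) (auto simp: words_def dyadic_interval_eq_iff)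

text \<open>The index of an interval of length 1 / 2 ^ k lies in [2 ^ k, 2 ^ (k + 1)). Hence the
  intervals containing a given point have distinct indices, which makes the Rademacher functions
  along a branch independent.\<close>

lemma iota_dyadic_interval_inj:
  assumes "T \<subseteq> {..<k}" "T' \<subseteq> {..<k'}"
    and eq: "iota (dyadic_interval (k, T)) = iota (dyadic_interval (k', T'))"
  shows "k = k'"
proof -
  have iota: "\<exists>i. i < 2 ^ k \<and> iota (dyadic_interval (k, T)) = 2 ^ k + i" if T: "T \<subseteq> {..<k}" for k T
  proof -
    obtain i where i: "i < 2 ^ k" "left_end T = real i / 2 ^ k"
      using left_end_index[OF T] .
    have "dyadic_interval (k, T) = {real i / 2 ^ k ..< (real i + 1) / 2 ^ k}"
      by (simp add: dyadic_interval_def i(2) add_divide_distrib)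
    then show ?thesis
      using i(1) iota_dyadic by metis
  qed
  have le: "k' \<le> k" if "2 ^ k + i = 2 ^ k' + i'" "i < 2 ^ k" for i i' k k' :: nat
  proof (rule ccontr)
    assume "\<not> k' \<le> k"
    then have "(2::nat) ^ Suc k \<le> 2 ^ k'"
      by (intro power_increasing) auto
    then show False
      using that by simp
  qed
  obtain i i' where "i < 2 ^ k" "iota (dyadic_interval (k, T)) = 2 ^ k + i"
    "i' < 2 ^ k'" "iota (dyadic_interval (k', T')) = 2 ^ k' + i'"
    using iota[OF assms(1)] iota[OF assms(2)] by blast
  then show ?thesis
    using le[of k i k' i'] le[of k' i' k i] eq by simp
qed

lemma haar_dyadic_interval:
  assumes T: "T \<subseteq> {..<k}"
  shows "haar (dyadic_interval (k, T)) s =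
    (if 0 \<le> s \<and> s < 1 \<and> digits s \<inter> {..<k} = T then sg (k \<in> digits s) else 0)"
proof -
  let ?I = "dyadic_interval (k, T)"
  have lt: "left_end T < left_end T + 1 / 2 ^ k"
    by simp
  have ends: "Inf ?I = left_end T" "Sup ?I = left_end T + 1 / 2 ^ k" "?I \<noteq> {}"
    using lt left_end_mem[OF T] by (auto simp: dyadic_interval_def)
  have mid: "(left_end T + (left_end T + 1 / 2 ^ k)) / 2 = left_end T + 1 / 2 ^ Suc k"
    "left_end T + 1 / 2 ^ k = left_end T + 1 / 2 ^ Suc k + 1 / 2 ^ Suc k"
    by (simp_all add: field_simps)
  have "left_half ?I = dyadic_interval (Suc k, T)"
    unfolding left_half_def ends mid(1) by (simp add: dyadic_interval_def)
  moreover have "right_half ?I = dyadic_interval (Suc k, insert k T)"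
    unfolding right_half_def ends mid(1) unfolding mid(2)
    by (simp only: dyadic_interval_def fst_conv snd_conv left_end_insert[OF T])
  ultimately have haar: "haar ?I s = indicator (dyadic_interval (Suc k, T)) s - indicator (dyadic_interval (Suc k, insert k T)) s"
    using ends(3) by (simp add: haar_def)
  have "T \<subseteq> {..<Suc k}" "insert k T \<subseteq> {..<Suc k}" "k \<notin> T"
    using T by auto
  moreover have "digits s \<inter> {..<Suc k} = (if k \<in> digits s then insert k (digits s \<inter> {..<k}) else digits s \<inter> {..<k})"
    by (auto simp: less_Suc_eq)
  moreover have "insert k (digits s \<inter> {..<k}) = insert k T \<longleftrightarrow> digits s \<inter> {..<k} = T"
    using \<open>k \<notin> T\<close> by (intro insert_ident) auto
  moreover have "digits s \<inter> {..<k} \<noteq> insert k T" "insert k (digits s \<inter> {..<k}) \<noteq> T" "insert k T \<noteq> T" "T \<noteq> insert k T"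
    using \<open>k \<notin> T\<close> by auto
  ultimately show ?thesis
    unfolding haar by (simp add: indicator_def mem_dyadic_interval sg_def)
qed

lemma dyadic_level_eq: "dyadic_level n = (\<lambda>T. dyadic_interval (n, T)) ` Pow {..<n}"
proof -
  have m: "measure lborel (dyadic_interval w) = 1 / 2 ^ fst w" for w
    by (simp add: dyadic_interval_def)
  show ?thesis
    unfolding dyadic_level_def dyadic_eq by (auto simp: m words_def)
qed

lemma sum_single_term:
  assumes "finite A"
  shows "(\<Sum>T\<in>A. if S = T then h T else (0::real)) = (if S \<in> A then h S else 0)"
  using assms by (simp add: sum.delta)

lemma rademacher_eq: "rademacher n s = (if 0 \<le> s \<and> s < 1 then sg (n \<in> digits s) else 0)"
proof -
  have inj: "inj_on (\<lambda>T. dyadic_interval (n, T)) (Pow {..<n})"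
    by (rule inj_onI) (auto simp: dyadic_interval_eq_iff)
  have "rademacher n s = (\<Sum>T\<in>Pow {..<n}. haar (dyadic_interval (n, T)) s)"
    unfolding rademacher_def dyadic_level_eq by (simp add: sum.reindex[OF inj])
  also have "\<dots> = (\<Sum>T\<in>Pow {..<n}. if digits s \<inter> {..<n} = T then (if 0 \<le> s \<and> s < 1 then sg (n \<in> digits s) else 0) else 0)"
    by (intro sum.cong) (auto simp: haar_dyadic_interval)
  also have "\<dots> = (if 0 \<le> s \<and> s < 1 then sg (n \<in> digits s) else 0)"
    by (subst sum_single_term) auto
  finally show ?thesis .
qed

section \<open>Step functions\<close>

definition step :: "nat \<Rightarrow> (nat set \<Rightarrow> real) \<Rightarrow> real \<Rightarrow> real" where
  "step M g s = (if 0 \<le> s \<and> s < 1 then g (digits s \<inter> {..<M}) else 0)"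

text \<open>The expectation of \<open>g\<close> for independent fair digits at the positions in
  \<open>B\<close>. A general finite \<open>B\<close> allows positions to be added one at a
  time.\<close>

definition avg :: "nat set \<Rightarrow> (nat set \<Rightarrow> real) \<Rightarrow> real" where
  "avg B g = (\<Sum>T\<in>Pow B. g T) / 2 ^ card B"

lemma step_eq_sum: "step M g s = (\<Sum>T\<in>Pow {..<M}. g T * indicator (dyadic_interval (M, T)) s)"
proof -
  have "(\<Sum>T\<in>Pow {..<M}. g T * indicator (dyadic_interval (M, T)) s) =
      (\<Sum>T\<in>Pow {..<M}. if digits s \<inter> {..<M} = T then (if 0 \<le> s \<and> s < 1 then g T else 0) else 0)"
    by (intro sum.cong) (auto simp: mem_dyadic_interval indicator_def)
  also have "\<dots> = step M g s"
    by (subst sum_single_term) (auto simp: step_def)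
  finally show ?thesis ..
qed

lemma integral_step: "(LBINT s:{0..1}. step M g s) = avg {..<M} g"
proof -
  have "(LBINT s:{0..1}. step M g s) = (\<integral>s. (\<Sum>T\<in>Pow {..<M}. g T * indicator (dyadic_interval (M, T)) s) \<partial>lborel)"
    unfolding set_lebesgue_integral_def step_eq_sum[symmetric]
    by (intro Bochner_Integration.integral_cong) (auto simp: step_def indicator_def)
  also have "\<dots> = (\<Sum>T\<in>Pow {..<M}. \<integral>s. g T * indicator (dyadic_interval (M, T)) s \<partial>lborel)"
    by (intro Bochner_Integration.integral_sum integrable_mult_right)
      (simp add: dyadic_interval_def)
  also have "\<dots> = (\<Sum>T\<in>Pow {..<M}. g T * (1 / 2 ^ M))"
    by (intro sum.cong refl) (simp add: dyadic_interval_def)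
  finally show ?thesis
    by (simp add: avg_def sum_divide_distrib)
qed

lemma set_integrable_step: "set_integrable lborel {0..1} (step M g)"
proof -
  have "integrable lborel (step M g)"
    unfolding step_eq_sum[abs_def]
    by (intro Bochner_Integration.integrable_sum integrable_mult_right) (simp add: dyadic_interval_def)
  then show ?thesis
    unfolding set_integrable_def by (intro integrable_mult_indicator) auto
qed

lemma avg_bij:
  assumes "bij_betw \<pi> (Pow B) (Pow B)"
  shows "avg B (\<lambda>T. g (\<pi> T)) = avg B g"
  unfolding avg_def using sum.reindex_bij_betw[OF assms, of g] by simp

lemma avg_insert:
  assumes "finite B" "x \<notin> B"
  shows "avg (insert x B) g = (avg B g + avg B (\<lambda>T. g (insert x T))) / 2"
proof -
  have "(\<Sum>T\<in>Pow (insert x B). g T) = (\<Sum>T\<in>Pow B. g T) + (\<Sum>T\<in>insert x ` Pow B. g T)"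
    unfolding Pow_insert by (rule sum.union_disjoint) (use assms in auto)
  also have "(\<Sum>T\<in>insert x ` Pow B. g T) = (\<Sum>T\<in>Pow B. g (insert x T))"
    by (subst sum.reindex) (use assms in \<open>auto intro!: inj_on_insert_elem\<close>)
  finally show ?thesis
    using assms by (simp add: avg_def field_simps)
qed

text \<open>Independent fair digits read at distinct positions are again independent and fair; the
  positions outside the image of \<open>f\<close> are averaged away one after the other. This fact
  underlies both the independence of the Rademacher functions and the invariance under selection of
  digits.\<close>

lemma avg_preimage:
  assumes "finite B" "finite A" "inj_on f A" "f ` A \<subseteq> B"
  shows "avg B (\<lambda>T. g {k \<in> A. f k \<in> T}) = avg A g"
proof -
  have "avg (f ` A \<union> C) (\<lambda>T. g {k \<in> A. f k \<in> T}) = avg A g" if "finite C" "C \<inter> f ` A = {}" for C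
    using that
  proof (induction C rule: finite_induct)
    case empty
    have "bij_betw (image f) (Pow A) (Pow (f ` A))"
      using assms(3) by (simp add: bij_betw_Pow inj_on_imp_bij_betw)
    then have "(\<Sum>T\<in>Pow (f ` A). g {k \<in> A. f k \<in> T}) = (\<Sum>T\<in>Pow A. g {k \<in> A. f k \<in> f ` T})"
      by (rule sum.reindex_bij_betw[symmetric])
    also have "\<dots> = (\<Sum>T\<in>Pow A. g T)"
    proof (intro sum.cong refl arg_cong[of _ _ g])
      fix T assume "T \<in> Pow A"
      then show "{k \<in> A. f k \<in> f ` T} = T"
        using assms(3) by (auto dest: inj_onD)
    qed
    finally show ?case
      using assms(3) by (simp add: avg_def card_image)
  next
    case (insert x C)
    then have x: "x \<notin> f ` A \<union> C" and eq: "{k \<in> A. f k \<in> insert x T} = {k \<in> A. f k \<in> T}" for T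
      by auto
    have fin: "finite (f ` A \<union> C)"
      using insert.hyps assms(2) by simp
    show ?case
      unfolding Un_insert_right avg_insert[OF fin x] eq using insert by auto
  qed
  from this[of "B - f ` A"] have "avg (f ` A \<union> (B - f ` A)) (\<lambda>T. g {k \<in> A. f k \<in> T}) = avg A g"
    using assms(1) by auto
  moreover have "f ` A \<union> (B - f ` A) = B"
    using assms(4) by auto
  ultimately show ?thesis
    by simp
qed

section \<open>Spans of Haar functions and distributions of step functions\<close>

lemma haar_span_add:
  assumes "x \<in> haar_span S" "y \<in> haar_span S"
  shows "(\<lambda>s. x s + y s) \<in> haar_span S"
proof -
  obtain A a where A: "x = (\<lambda>s. \<Sum>I\<in>A. a I * haar I s)" "finite A" "A \<subseteq> S"
    using assms(1) by (auto simp: haar_span_def)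
  obtain B b where B: "y = (\<lambda>s. \<Sum>I\<in>B. b I * haar I s)" "finite B" "B \<subseteq> S"
    using assms(2) by (auto simp: haar_span_def)
  define c where "c I = (if I \<in> A then a I else 0) + (if I \<in> B then b I else 0)" for I
  have "x s + y s = (\<Sum>I\<in>A \<union> B. c I * haar I s)" for s
  proof -
    have "x s = (\<Sum>I\<in>A \<union> B. (if I \<in> A then a I else 0) * haar I s)"
      unfolding A(1) using A(2) B(2) by (intro sum.mono_neutral_cong_left) auto
    moreover have "y s = (\<Sum>I\<in>A \<union> B. (if I \<in> B then b I else 0) * haar I s)"
      unfolding B(1) using A(2) B(2) by (intro sum.mono_neutral_cong_left) auto
    ultimately show ?thesis
      by (simp add: c_def distrib_right sum.distrib)
  qed
  then show ?thesis
    unfolding haar_span_def using A B by (intro CollectI exI[of _ "A \<union> B"] exI[of _ c]) auto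
qed

lemma haar_span_scale:
  assumes "x \<in> haar_span S"
  shows "(\<lambda>s. c * x s) \<in> haar_span S"
proof -
  obtain A a where A: "x = (\<lambda>s. \<Sum>I\<in>A. a I * haar I s)" "finite A" "A \<subseteq> S"
    using assms by (auto simp: haar_span_def)
  then show ?thesis
    unfolding haar_span_def
    by (intro CollectI exI[of _ A] exI[of _ "\<lambda>I. c * a I"]) (auto simp: sum_distrib_left mult.assoc)
qed

lemma haar_in_haar_span: "I \<in> S \<Longrightarrow> haar I \<in> haar_span S"
  unfolding haar_span_def by (intro CollectI exI[of _ "{I}"] exI[of _ "\<lambda>_. 1"]) auto

lemma zero_in_haar_span: "(\<lambda>s. 0) \<in> haar_span S"
  unfolding haar_span_def by (intro CollectI exI[of _ "{}"]) auto

lemma haar_span_sum: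
  assumes "finite A" "\<And>i. i \<in> A \<Longrightarrow> x i \<in> haar_span S"
  shows "(\<lambda>s. \<Sum>i\<in>A. c i * x i s) \<in> haar_span S"
  using assms by (induction A rule: finite_induct) (auto simp: zero_in_haar_span intro!: haar_span_add haar_span_scale)

text \<open>The indicator of a half is half the indicator of the interval plus or minus half its
  Haar function. The recursion starts at the constant function, which is why \<open>haar_H\<close>
  appears and not \<open>haar_H0\<close>.\<close>

lemma indicator_in_haar_H:
  "T \<subseteq> {..<k} \<Longrightarrow> (\<lambda>s. indicator (dyadic_interval (k, T)) s) \<in> haar_H"
proof (induction k arbitrary: T)
  case 0
  then have "(\<lambda>s. indicator (dyadic_interval (0, T)) s) = haar {}"
    by (auto simp: haar_def dyadic_interval_def left_end_def fun_eq_iff)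
  then show ?case
    unfolding haar_H_def by (auto simp: dyadic_plus_def intro: haar_in_haar_span)
next
  case (Suc k)
  let ?T = "T \<inter> {..<k}"
  have T': "?T \<subseteq> {..<k}" by simp
  have split: "digits s \<inter> {..<Suc k} = T \<longleftrightarrow> digits s \<inter> {..<k} = ?T \<and> (k \<in> digits s \<longleftrightarrow> k \<in> T)" for s
    using Suc.prems by (auto simp: less_Suc_eq set_eq_iff subset_iff)
  have "indicator (dyadic_interval (Suc k, T)) s =
      (1 / 2) * indicator (dyadic_interval (k, ?T)) s + (sg (k \<in> T) / 2) * haar (dyadic_interval (k, ?T)) s" for s
    unfolding haar_dyadic_interval[OF T'] indicator_def mem_dyadic_interval[OF T'] mem_dyadic_interval[OF Suc.prems] split
    by (auto simp: sg_def)
  then have eq: "(\<lambda>s. indicator (dyadic_interval (Suc k, T)) s) =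
      (\<lambda>s. (1 / 2) * indicator (dyadic_interval (k, ?T)) s + (sg (k \<in> T) / 2) * haar (dyadic_interval (k, ?T)) s)"
    by blast
  have "dyadic_interval (k, ?T) \<in> dyadic_plus"
    using dyadic_interval_in_dyadic[OF T'] by (simp add: dyadic_plus_def)
  then show ?case
    unfolding eq haar_H_def using Suc.IH[OF T']
    by (intro haar_span_add haar_span_scale haar_in_haar_span) (simp_all add: haar_H_def)
qed

lemma step_in_haar_H: "step M g \<in> haar_H"
proof -
  have "(\<lambda>s. \<Sum>T\<in>Pow {..<M}. g T * indicator (dyadic_interval (M, T)) s) \<in> haar_H"
    unfolding haar_H_def by (intro haar_span_sum) (use indicator_in_haar_H in \<open>auto simp: haar_H_def\<close>)
  then show ?thesis
    by (simp add: step_eq_sum[symmetric])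
qed

text \<open>The functions P are used as indicators of Borel sets, whose preimages under a step
  function are finite unions of dyadic intervals of one length.\<close>

lemma same_distribution_step:
  assumes "\<And>P :: real \<Rightarrow> real. avg {..<M} (\<lambda>T. P (g T)) = avg {..<M'} (\<lambda>T. P (g' T))"
  shows "same_distribution (step M g) (step M' g')"
proof -
  have meas: "step M g \<in> borel_measurable (restrict_space lborel {0..<1})" for M g
    unfolding step_eq_sum[abs_def]
    by (intro borel_measurable_sum borel_measurable_times measurable_restrict_space1)
      (auto simp: dyadic_interval_def)
  have em: "emeasure (distr (restrict_space lborel {0..<1}) borel (step M g)) A =
      ennreal (avg {..<M} (\<lambda>T. indicator A (g T)))" if A: "A \<in> sets borel" for M g A
  proof -
    have "emeasure (distr (restrict_space lborel {0..<1}) borel (step M g)) A =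
        emeasure (restrict_space lborel {0..<1}) (step M g -` A \<inter> {0..<1})"
      using emeasure_distr[OF meas A] by (simp add: space_restrict_space)
    also have "\<dots> = emeasure lborel (step M g -` A \<inter> {0..<1})"
      by (rule emeasure_restrict_space) auto
    also have "step M g -` A \<inter> {0..<1} = (\<Union>T\<in>{T \<in> Pow {..<M}. g T \<in> A}. dyadic_interval (M, T))"
      by (auto simp: mem_dyadic_interval step_def)
    also have "emeasure lborel \<dots> = (\<Sum>T\<in>{T \<in> Pow {..<M}. g T \<in> A}. emeasure lborel (dyadic_interval (M, T)))"
    proof (rule sum_emeasure[symmetric])
      show "disjoint_family_on (\<lambda>T. dyadic_interval (M, T)) {T \<in> Pow {..<M}. g T \<in> A}"
        by (auto simp: disjoint_family_on_def mem_dyadic_interval)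
    qed (auto simp: dyadic_interval_def)
    also have "\<dots> = (\<Sum>T\<in>{T \<in> Pow {..<M}. g T \<in> A}. ennreal (1 / 2 ^ M))"
      by (simp add: dyadic_interval_def)
    also have "\<dots> = ennreal (\<Sum>T\<in>{T \<in> Pow {..<M}. g T \<in> A}. 1 / 2 ^ M)"
      by (rule sum_ennreal) simp
    also have "(\<Sum>T\<in>{T \<in> Pow {..<M}. g T \<in> A}. 1 / 2 ^ M) = avg {..<M} (\<lambda>T. indicator A (g T))"
      unfolding avg_def sum_divide_distrib
      by (rule sum.mono_neutral_cong_left) (auto simp: indicator_def)
    finally show ?thesis .
  qed
  show ?thesis
    unfolding same_distribution_def using em assms by (intro measure_eqI) auto
qed

section \<open>Haar system Hardy spaces\<close>

text \<open>The value at a point of the function whose norm in \<open>X\<close> defines the norm of \<open>X(r)\<close>, in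
  terms of the contributions \<open>b k\<close> of the levels \<open>k < M\<close> at this point: \<open>ind\<close> distinguishes
  independent from constant sequences \<open>r\<close>.\<close>

definition sign_mean :: "bool \<Rightarrow> nat \<Rightarrow> (nat \<Rightarrow> real) \<Rightarrow> real" where
  "sign_mean ind M b =
    (if ind then avg {..<M} (\<lambda>T. \<bar>\<Sum>k<M. sg (k \<in> T) * b k\<bar>) else \<bar>\<Sum>k<M. b k\<bar>)"

lemma sign_mean_cong: "(\<And>k. k < M \<Longrightarrow> b k = b' k) \<Longrightarrow> sign_mean ind M b = sign_mean ind M b'"
  by (simp add: sign_mean_def)

lemma sign_mean_nonneg: "0 \<le> sign_mean ind M b"
  by (auto simp: sign_mean_def avg_def intro!: divide_nonneg_nonneg sum_nonneg)

lemma avg_const: "finite B \<Longrightarrow> avg B (\<lambda>T. x) = x"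
  by (simp add: avg_def card_Pow)

lemma sign_mean_single:
  assumes "k < M"
  shows "sign_mean ind M (\<lambda>l. if l = k then x else 0) = \<bar>x\<bar>"
proof -
  have "(\<Sum>l<M. sg (l \<in> T) * (if l = k then x else 0)) = sg (k \<in> T) * x" for T
    using assms by (simp add: if_distrib[of "\<lambda>y. _ * y"] cong: if_cong)
  then show ?thesis
    using assms by (simp add: sign_mean_def abs_mult avg_const)
qed

lemma sum_strict_mono_range:
  fixes n :: "nat \<Rightarrow> nat" and h :: "nat \<Rightarrow> 'a::comm_monoid_add"
  assumes n: "strict_mono n" and h: "\<And>l. l < n M \<Longrightarrow> l \<notin> range n \<Longrightarrow> h l = 0"
  shows "(\<Sum>l<n M. h l) = (\<Sum>k<M. h (n k))"
proof -
  have inj: "inj_on n {..<M}"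
    using n by (auto simp: inj_on_def strict_mono_eq)
  have "(\<Sum>k<M. h (n k)) = (\<Sum>l\<in>n ` {..<M}. h l)"
    by (simp add: sum.reindex[OF inj])
  also have "\<dots> = (\<Sum>l<n M. h l)"
  proof (rule sum.mono_neutral_left)
    show "n ` {..<M} \<subseteq> {..<n M}"
      using n by (auto simp: strict_mono_less)
    show "\<forall>l\<in>{..<n M} - n ` {..<M}. h l = 0"
    proof
      fix l assume l: "l \<in> {..<n M} - n ` {..<M}"
      then have "l \<notin> range n"
        using n by (auto simp: strict_mono_less)
      then show "h l = 0"
        using h l by simp
    qed
  qed simp
  finally show ?thesis ..
qed

text \<open>The levels outside the range of \<open>n\<close> contribute nothing to the sum, and in
  the independent case their signs are averaged out by \<open>avg_preimage\<close>.\<close>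

lemma sign_mean_spread:
  assumes n: "strict_mono n" and b: "\<And>k. k < M \<Longrightarrow> b' (n k) = b k"
    and zero: "\<And>l. l < n M \<Longrightarrow> l \<notin> range n \<Longrightarrow> b' l = 0"
  shows "sign_mean ind (n M) b' = sign_mean ind M b"
proof (cases ind)
  case True
  have sub: "n ` {..<M} \<subseteq> {..<n M}" and inj: "inj_on n {..<M}"
    using n by (auto simp: strict_mono_less strict_mono_eq inj_on_def)
  have "(\<Sum>l<n M. sg (l \<in> T) * b' l) = (\<Sum>k<M. sg (k \<in> {k \<in> {..<M}. n k \<in> T}) * b k)" for T
    by (subst sum_strict_mono_range[OF n]) (auto simp: zero b intro!: sum.cong)
  then have "sign_mean ind (n M) b' =
      avg {..<n M} (\<lambda>T. \<bar>\<Sum>k<M. sg (k \<in> {k \<in> {..<M}. n k \<in> T}) * b k\<bar>)"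
    using True by (simp add: sign_mean_def)
  also have "\<dots> = avg {..<M} (\<lambda>T. \<bar>\<Sum>k<M. sg (k \<in> T) * b k\<bar>)"
    by (rule avg_preimage[where g = "\<lambda>T. \<bar>\<Sum>k<M. sg (k \<in> T) * b k\<bar>"]) (use sub inj in auto)
  finally show ?thesis
    using True by (simp add: sign_mean_def)
next
  case False
  then show ?thesis
    using sum_strict_mono_range[OF n zero] b by (simp add: sign_mean_def)
qed

text \<open>The set S describes a branch of the tree. Its intervals have distinct indices, so for
  the independent family the integral is a mean over independent signs; for the constant family
  |r_0| = 1 factors out. In both cases the value does not depend on the branch.\<close>

lemma rademacher_families_sign_mean:
  assumes "r \<in> rademacher_families"
  shows "\<exists>ind. \<forall>M b S.
    (LBINT u:{0..1}. \<bar>\<Sum>k<M. r (dyadic_interval (k, S \<inter> {..<k})) u * b k\<bar>) = sign_mean ind M b"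
proof -
  consider "r = (\<lambda>I. rademacher (iota I))" | "r = (\<lambda>I. rademacher 0)"
    using assms by (auto simp: rademacher_families_def)
  then show ?thesis
  proof cases
    case 1
    have "(LBINT u:{0..1}. \<bar>\<Sum>k<M. r (dyadic_interval (k, S \<inter> {..<k})) u * b k\<bar>) = sign_mean True M b" for M b S
    proof -
      define \<iota> where "\<iota> k = iota (dyadic_interval (k, S \<inter> {..<k}))" for k
      have inj: "inj_on \<iota> {..<M}"
        by (rule inj_onI) (auto simp: \<iota>_def intro: iota_dyadic_interval_inj[rotated 2])
      define L where "L = Suc (Max (\<iota> ` {..<M}))"
      have lt: "\<iota> k < L" if "k < M" for k
        using that by (auto simp: L_def less_Suc_eq_le)
      have "\<bar>\<Sum>k<M. r (dyadic_interval (k, S \<inter> {..<k})) u * b k\<bar> =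
          step L (\<lambda>T. \<bar>\<Sum>k<M. sg (k \<in> {k \<in> {..<M}. \<iota> k \<in> T}) * b k\<bar>) u" for u
        by (auto simp: 1 \<iota>_def[symmetric] rademacher_eq step_def lt intro!: arg_cong[of _ _ abs] sum.cong)
      then have "(LBINT u:{0..1}. \<bar>\<Sum>k<M. r (dyadic_interval (k, S \<inter> {..<k})) u * b k\<bar>) =
          avg {..<L} (\<lambda>T. \<bar>\<Sum>k<M. sg (k \<in> {k \<in> {..<M}. \<iota> k \<in> T}) * b k\<bar>)"
        by (simp only: integral_step)
      also have "\<dots> = avg {..<M} (\<lambda>T. \<bar>\<Sum>k<M. sg (k \<in> T) * b k\<bar>)"
        by (rule avg_preimage[where g = "\<lambda>T. \<bar>\<Sum>k<M. sg (k \<in> T) * b k\<bar>"]) (use inj lt in auto)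
      finally show ?thesis
        by (simp add: sign_mean_def)
    qed
    then show ?thesis
      by blast
  next
    case 2
    have "(LBINT u:{0..1}. \<bar>\<Sum>k<M. r (dyadic_interval (k, S \<inter> {..<k})) u * b k\<bar>) = sign_mean False M b" for M b S
    proof -
      have "\<bar>\<Sum>k<M. r (dyadic_interval (k, S \<inter> {..<k})) u * b k\<bar> = step 0 (\<lambda>T. \<bar>\<Sum>k<M. b k\<bar>) u" for u
        by (simp add: 2 rademacher_eq step_def sum_distrib_left[symmetric] abs_mult)
      then show ?thesis
        by (simp only: integral_step) (simp add: avg_const sign_mean_def)
    qed
    then show ?thesis
      by blast
  qed
qed

lemma sum_haar_words:
  "(\<Sum>w\<in>words M. c w * haar (dyadic_interval w) s) =
    (if 0 \<le> s \<and> s < 1 then \<Sum>k<M. c (k, digits s \<inter> {..<k}) * sg (k \<in> digits s) else 0)"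
proof -
  have "(\<Sum>T\<in>Pow {..<k}. c (k, T) * haar (dyadic_interval (k, T)) s) =
      (if 0 \<le> s \<and> s < 1 then c (k, digits s \<inter> {..<k}) * sg (k \<in> digits s) else 0)" for k
  proof -
    have "(\<Sum>T\<in>Pow {..<k}. c (k, T) * haar (dyadic_interval (k, T)) s) =
      (\<Sum>T\<in>Pow {..<k}. if digits s \<inter> {..<k} = T then
        (if 0 \<le> s \<and> s < 1 then c (k, T) * sg (k \<in> digits s) else 0) else 0)"
      by (intro sum.cong) (auto simp: haar_dyadic_interval)
    then show ?thesis
      by (simp add: sum_single_term)
  qed
  then show ?thesis
    by (auto simp: sum_words)
qed

lemma haar_H0_words:
  assumes "f \<in> haar_H0"
  obtains M a where "f = (\<lambda>s. \<Sum>w\<in>words M. a w * haar (dyadic_interval w) s)"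
proof -
  obtain A a where A: "f = (\<lambda>s. \<Sum>I\<in>A. a I * haar I s)" "finite A" "A \<subseteq> dyadic"
    using assms by (auto simp: haar_H0_def haar_span_def)
  obtain W where W: "finite W" "W \<subseteq> (\<Union>M. words M)" "A = dyadic_interval ` W"
    using A(2,3) unfolding dyadic_eq by (metis finite_subset_image)
  have "\<exists>M. W \<subseteq> words M"
    using W(1,2)
  proof (induction W rule: finite_induct)
    case (insert w W)
    then obtain M M' where "W \<subseteq> words M" "w \<in> words M'"
      by auto
    then have "insert w W \<subseteq> words (max M M')"
      using words_mono[of M "max M M'"] words_mono[of M' "max M M'"] by auto
    then show ?case ..
  qed auto
  then obtain M where M: "W \<subseteq> words M" ..
  have inj: "inj_on dyadic_interval W"
    using inj_on_dyadic_interval W(2) inj_on_subset by blast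
  have "f s = (\<Sum>w\<in>words M. (if w \<in> W then a (dyadic_interval w) else 0) * haar (dyadic_interval w) s)" for s
  proof -
    have "f s = (\<Sum>w\<in>W. a (dyadic_interval w) * haar (dyadic_interval w) s)"
      by (simp add: A(1) W(3) sum.reindex[OF inj])
    also have "\<dots> = (\<Sum>w\<in>words M. (if w \<in> W then a (dyadic_interval w) else 0) * haar (dyadic_interval w) s)"
      by (rule sum.mono_neutral_cong_left) (use M in auto)
    finally show ?thesis .
  qed
  then have "f = (\<lambda>s. \<Sum>w\<in>words M. (if w \<in> W then a (dyadic_interval w) else 0) * haar (dyadic_interval w) s)"
    by (rule ext)
  then show thesis
    by (rule that)
qed

lemma haar_words_in_haar_H0:
  assumes "finite W" "W \<subseteq> (\<Union>M. words M)"
  shows "(\<lambda>s. \<Sum>w\<in>W. a w * haar (dyadic_interval w) s) \<in> haar_H0"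
  unfolding haar_H0_def
  by (rule haar_span_sum[OF assms(1)]) (use assms(2) in \<open>auto intro!: haar_in_haar_span simp: dyadic_eq\<close>)

lemma haar_H0_subset: "haar_H0 \<subseteq> haar_H"
  unfolding haar_H0_def haar_H_def haar_span_def dyadic_plus_def by blast

lemma integral_haar_rademacher:
  assumes T: "T \<subseteq> {..<k}"
  shows "(LBINT s:{0..1}. haar (dyadic_interval (k, T)) s * rademacher n s) = (if k = n then 1 / 2 ^ n else 0)"
proof -
  define m where "m = max k n"
  define G where "G S = (if S \<inter> {..<k} = T then sg (k \<in> S) * sg (n \<in> S) else 0)" for S
  have "haar (dyadic_interval (k, T)) s * rademacher n s = step (Suc m) G s" for s
    unfolding haar_dyadic_interval[OF T] rademacher_eq
    by (auto simp: step_def G_def m_def Int_assoc Int_absorb1 less_Suc_eq_le)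
  then have int: "(LBINT s:{0..1}. haar (dyadic_interval (k, T)) s * rademacher n s) = avg {..<Suc m} G"
    by (simp only: integral_step)
  show ?thesis
  proof (cases "k = n")
    case True
    have "haar (dyadic_interval (k, T)) s * rademacher n s = step n (\<lambda>S. if S = T then 1 else 0) s" for s
      unfolding haar_dyadic_interval[OF T] rademacher_eq using True by (auto simp: step_def)
    then have "(LBINT s:{0..1}. haar (dyadic_interval (k, T)) s * rademacher n s) =
        avg {..<n} (\<lambda>S. if S = T then 1 else 0)"
      by (simp only: integral_step)
    then show ?thesis
      using True T by (simp add: avg_def)
  next
    case False
    \<comment> \<open>Flipping digit m keeps the interval (k, T), which is determined by the digits
      below k, and reverses exactly one of the two factors because k and n differ.\<close>
    have bij: "bij_betw (\<lambda>S. sym_diff S {m}) (Pow {..<Suc m}) (Pow {..<Suc m})"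
      by (rule bij_betwI[where g = "\<lambda>S. sym_diff S {m}"]) auto
    have "G (sym_diff S {m}) = - G S" for S
    proof -
      have prefix: "sym_diff S {m} \<inter> {..<k} = S \<inter> {..<k}"
        by (auto simp: m_def)
      have bit: "i \<in> sym_diff S {m} \<longleftrightarrow> (i \<in> S) \<noteq> (i = m)" for i
        by auto
      have "(k = m) \<noteq> (n = m)"
        using False by (simp add: m_def max_def)
      then show ?thesis
        unfolding G_def prefix bit by (simp add: sg_def)
    qed
    then have "avg {..<Suc m} G = - avg {..<Suc m} G"
      using avg_bij[OF bij, of G] by (simp add: avg_def sum_negf)
    then show ?thesis
      using int False by simp
  qed
qed

section \<open>The Hardy space as an instance of the tree\<close>

locale hardy_space =
  fixes N :: "(real \<Rightarrow> real) \<Rightarrow> real"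
    and r :: "real set \<Rightarrow> real \<Rightarrow> real"
    and J :: "(real \<Rightarrow> real) \<Rightarrow> 'x::banach"
    and E :: "'y::banach \<Rightarrow> 'x"
    and j :: "(real \<Rightarrow> real) \<Rightarrow> 'y"
  assumes norm: "haar_system_norm N"
    and r: "r \<in> rademacher_families"
    and X: "is_hardy_space N r J"
    and Y: "is_hardy_space0 J E j"
begin

definition e :: "nat \<times> nat set \<Rightarrow> 'y" where
  "e w = j (haar (dyadic_interval w))"

lemma norm_step_cong:
  assumes "\<And>P :: real \<Rightarrow> real. avg {..<M} (\<lambda>T. P (g T)) = avg {..<M'} (\<lambda>T. P (g' T))"
    and "\<And>T. 0 \<le> g T" "\<And>T. 0 \<le> g' T"
  shows "N (step M g) = N (step M' g')"
proof -
  have "(\<lambda>s. \<bar>step M g s\<bar>) = step M g" "(\<lambda>s. \<bar>step M' g' s\<bar>) = step M' g'"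
    using assms(2,3) by (auto simp: step_def fun_eq_iff)
  moreover have "same_distribution (step M g) (step M' g')"
    by (rule same_distribution_step) (rule assms(1))
  moreover have "N x = N y" if "x \<in> haar_H" "y \<in> haar_H" "same_distribution (\<lambda>s. \<bar>x s\<bar>) (\<lambda>s. \<bar>y s\<bar>)" for x y
    using norm that unfolding haar_system_norm_def by blast
  ultimately show ?thesis
    using step_in_haar_H by simp
qed

lemma J_words:
  assumes "finite W" "W \<subseteq> (\<Union>M. words M)"
  shows "J (\<lambda>s. \<Sum>w\<in>W. a w * haar (dyadic_interval w) s) = (\<Sum>w\<in>W. a w *\<^sub>R J (haar (dyadic_interval w)))"
proof -
  have add: "J (\<lambda>s. x s + y s) = J x + J y" if "x \<in> haar_H" "y \<in> haar_H" for x y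
    using X that by (simp add: is_hardy_space_def)
  have scale: "J (\<lambda>s. c * x s) = c *\<^sub>R J x" if "x \<in> haar_H" for x c
    using X that by (simp add: is_hardy_space_def)
  have zero: "J (\<lambda>s. 0) = 0"
    using scale[of "\<lambda>s. 0" 0] zero_in_haar_span[of dyadic_plus] by (simp add: haar_H_def)
  show ?thesis
    using assms
  proof (induction W rule: finite_induct)
    case (insert w W)
    have w: "haar (dyadic_interval w) \<in> haar_H"
      using insert.prems unfolding haar_H_def
      by (intro haar_in_haar_span) (auto simp: dyadic_plus_def dyadic_eq)
    then have "(\<lambda>s. a w * haar (dyadic_interval w) s) \<in> haar_H"
      unfolding haar_H_def by (rule haar_span_scale)
    moreover have "(\<lambda>s. \<Sum>w\<in>W. a w * haar (dyadic_interval w) s) \<in> haar_H"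
      using haar_words_in_haar_H0[of W] insert.hyps insert.prems haar_H0_subset by blast
    ultimately show ?case
      using insert w by (simp add: add scale)
  qed (simp add: zero)
qed

text \<open>Linearity of \<open>j\<close> on finite sums is inherited from \<open>J\<close> through
  \<open>E\<close>, which is injective as a linear isometry.\<close>

lemma j_words:
  assumes "finite W" "W \<subseteq> (\<Union>M. words M)"
  shows "j (\<lambda>s. \<Sum>w\<in>W. a w * haar (dyadic_interval w) s) = (\<Sum>w\<in>W. a w *\<^sub>R e w)"
proof -
  have lin: "linear E" and nE: "\<And>y. norm (E y) = norm y" and Ej: "\<And>f. f \<in> haar_H0 \<Longrightarrow> E (j f) = J f"
    using Y unfolding is_hardy_space0_def by blast+
  have inj: "x = y" if "E x = E y" for x y
    using nE[of "x - y"] that lin by (simp add: linear_diff)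
  have Ee: "E (e w) = J (haar (dyadic_interval w))" if "w \<in> W" for w
    unfolding e_def using that assms(2)
    by (intro Ej) (auto simp: haar_H0_def dyadic_eq intro!: haar_in_haar_span)
  have "E (\<Sum>w\<in>W. a w *\<^sub>R e w) = (\<Sum>w\<in>W. a w *\<^sub>R J (haar (dyadic_interval w)))"
    using lin Ee by (simp add: linear_sum linear_scale)
  also have "\<dots> = E (j (\<lambda>s. \<Sum>w\<in>W. a w * haar (dyadic_interval w) s))"
    using J_words[OF assms] Ej[OF haar_words_in_haar_H0[OF assms]] by simp
  finally show ?thesis
    by (intro inj[OF sym])
qed

text \<open>At a point s only the intervals on its branch contribute, one for each level, so the
  function whose norm in X is taken is a step function with values given by
  \<open>sign_mean\<close>. One value of \<open>ind\<close> serves all M and a.\<close>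

lemma norm_words_formula:
  "\<exists>ind. \<forall>M a. norm (\<Sum>w\<in>words M. a w *\<^sub>R e w) =
    N (step M (\<lambda>S. sign_mean ind M (\<lambda>k. a (k, S \<inter> {..<k}) * sg (k \<in> S))))"
proof -
  obtain ind where ind: "\<And>M b S.
      (LBINT u:{0..1}. \<bar>\<Sum>k<M. r (dyadic_interval (k, S \<inter> {..<k})) u * b k\<bar>) = sign_mean ind M b"
    using rademacher_families_sign_mean[OF r] by blast
  have "norm (\<Sum>w\<in>words M. a w *\<^sub>R e w) =
    N (step M (\<lambda>S. sign_mean ind M (\<lambda>k. a (k, S \<inter> {..<k}) * sg (k \<in> S))))" for M and a :: "nat \<times> nat set \<Rightarrow> real"
  proof -
    have W: "finite (words M)" "words M \<subseteq> (\<Union>M. words M)"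
      by auto
    have inj: "inj_on dyadic_interval (words M)"
      using inj_on_dyadic_interval W(2) inj_on_subset by blast
    define A where "A = dyadic_interval ` words M"
    define b where "b I = a (inv_into (words M) dyadic_interval I)" for I
    have b: "b (dyadic_interval w) = a w" if "w \<in> words M" for w
      using that inj by (simp add: b_def)
    have A: "finite A" "A \<subseteq> dyadic_plus"
      using W by (auto simp: A_def dyadic_plus_def dyadic_eq)
    have "norm (\<Sum>w\<in>words M. a w *\<^sub>R e w) = norm (E (j (\<lambda>s. \<Sum>w\<in>words M. a w * haar (dyadic_interval w) s)))"
      using j_words[OF W] Y unfolding is_hardy_space0_def by simp
    also have "\<dots> = norm (J (\<lambda>s. \<Sum>w\<in>words M. a w * haar (dyadic_interval w) s))"
      using haar_words_in_haar_H0[OF W] Y unfolding is_hardy_space0_def by simp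
    also have "(\<lambda>s. \<Sum>w\<in>words M. a w * haar (dyadic_interval w) s) = (\<lambda>s. \<Sum>I\<in>A. b I * haar I s)"
      unfolding A_def by (simp add: sum.reindex[OF inj] b)
    also have "norm (J \<dots>) = N (\<lambda>s. LBINT u:{0..1}. \<bar>\<Sum>I\<in>A. r I u * b I * haar I s\<bar>)"
      using X A unfolding is_hardy_space_def by blast
    also have "(\<lambda>s. LBINT u:{0..1}. \<bar>\<Sum>I\<in>A. r I u * b I * haar I s\<bar>) =
        step M (\<lambda>S. sign_mean ind M (\<lambda>k. a (k, S \<inter> {..<k}) * sg (k \<in> S)))"
    proof
      fix s
      have eq: "(\<Sum>I\<in>A. r I u * b I * haar I s) = (if 0 \<le> s \<and> s < 1 then
          \<Sum>k<M. r (dyadic_interval (k, digits s \<inter> {..<k})) u * (a (k, digits s \<inter> {..<k}) * sg (k \<in> digits s)) else 0)" for u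
        using sum_haar_words[where c = "\<lambda>w. r (dyadic_interval w) u * a w" and M = M and s = s]
        by (simp add: A_def sum.reindex[OF inj] b mult.assoc)
      have mean: "sign_mean ind M (\<lambda>k. a (k, digits s \<inter> {..<M} \<inter> {..<k}) * sg (k \<in> digits s \<inter> {..<M})) =
          sign_mean ind M (\<lambda>k. a (k, digits s \<inter> {..<k}) * sg (k \<in> digits s))"
        by (rule sign_mean_cong) (simp add: Int_assoc Int_absorb1)
      show "(LBINT u:{0..1}. \<bar>\<Sum>I\<in>A. r I u * b I * haar I s\<bar>) =
        step M (\<lambda>S. sign_mean ind M (\<lambda>k. a (k, S \<inter> {..<k}) * sg (k \<in> S))) s"
      proof (cases "0 \<le> s \<and> s < 1")
        case True
        then show ?thesis
          unfolding eq step_def using mean by (simp add: ind)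
      next
        case False
        then show ?thesis
          unfolding eq step_def if_not_P[OF False] by simp
      qed
    qed
    finally show ?thesis .
  qed
  then show ?thesis
    by blast
qed

text \<open>Twisting the coefficients composes the step function in the norm with a bijection of the
  words of length M, which preserves its distribution.\<close>

lemma norm_twist:
  "norm (\<Sum>(k, T)\<in>words M. (a (k, twist \<theta> k T) * sg (\<theta> k T)) *\<^sub>R e (k, T)) = norm (\<Sum>w\<in>words M. a w *\<^sub>R e w)"
proof -
  obtain ind where ind: "\<And>M a. norm (\<Sum>w\<in>words M. a w *\<^sub>R e w) =
    N (step M (\<lambda>S. sign_mean ind M (\<lambda>k. a (k, S \<inter> {..<k}) * sg (k \<in> S))))"
    using norm_words_formula by blast
  define g where "g S = sign_mean ind M (\<lambda>k. a (k, S \<inter> {..<k}) * sg (k \<in> S))" for S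
  define a' where "a' = (\<lambda>(k, T). a (k, twist \<theta> k T) * sg (\<theta> k T))"
  have sg: "sg (k \<in> twist \<theta> M S) = sg (\<theta> k (S \<inter> {..<k})) * sg (k \<in> S)" if "k < M" for k S
    using that by (auto simp: twist_def sg_def)
  have "(\<lambda>S. sign_mean ind M (\<lambda>k. a' (k, S \<inter> {..<k}) * sg (k \<in> S))) = (\<lambda>S. g (twist \<theta> M S))"
    unfolding g_def by (intro ext sign_mean_cong) (simp add: a'_def sg twist_prefix mult.assoc)
  then have "norm (\<Sum>w\<in>words M. a' w *\<^sub>R e w) = N (step M (\<lambda>S. g (twist \<theta> M S)))"
    using ind[of a' M] by simp
  also have "\<dots> = N (step M g)"
  proof (rule norm_step_cong)
    show "avg {..<M} (\<lambda>T. P (g (twist \<theta> M T))) = avg {..<M} (\<lambda>T. P (g T))" for P :: "real \<Rightarrow> real"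
      by (rule avg_bij[OF bij_betw_twist])
  qed (simp_all add: g_def sign_mean_nonneg)
  also have "\<dots> = norm (\<Sum>w\<in>words M. a w *\<^sub>R e w)"
    by (simp add: ind g_def[abs_def])
  finally show ?thesis
    by (simp add: a'_def case_prod_unfold)
qed

text \<open>The coefficients are placed on the selected levels and vanish elsewhere. The step
  function in the norm then depends only on the digits at the selected positions, which are
  distributed like the first M digits.\<close>

lemma norm_select:
  assumes n: "strict_mono n"
  shows "norm (\<Sum>k<M. \<Sum>S\<in>Pow {..<n k}. a (k, sel n k S) *\<^sub>R e (n k, S)) = norm (\<Sum>w\<in>words M. a w *\<^sub>R e w)"
proof -
  obtain ind where ind: "\<And>M a. norm (\<Sum>w\<in>words M. a w *\<^sub>R e w) =
    N (step M (\<lambda>S. sign_mean ind M (\<lambda>k. a (k, S \<inter> {..<k}) * sg (k \<in> S))))"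
    using norm_words_formula by blast
  define g where "g S = sign_mean ind M (\<lambda>k. a (k, S \<inter> {..<k}) * sg (k \<in> S))" for S
  define a' where "a' = (\<lambda>(l, S). if l \<in> range n then a (inv n l, sel n (inv n l) S) else 0)"
  have a': "a' (n k, S) = a (k, sel n k S)" for k S
    using n by (simp add: a'_def strict_mono_imp_inj_on)
  have nM: "n k < n M" if "k < M" for k
    using n that by (simp add: strict_mono_less)
  have "(\<Sum>w\<in>words (n M). a' w *\<^sub>R e w) = (\<Sum>k<M. \<Sum>S\<in>Pow {..<n k}. a' (n k, S) *\<^sub>R e (n k, S))"
    unfolding sum_words by (rule sum_strict_mono_range[OF n]) (simp add: a'_def)
  then have "norm (\<Sum>k<M. \<Sum>S\<in>Pow {..<n k}. a (k, sel n k S) *\<^sub>R e (n k, S)) =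
      N (step (n M) (\<lambda>S. sign_mean ind (n M) (\<lambda>k. a' (k, S \<inter> {..<k}) * sg (k \<in> S))))"
    using ind[of a' "n M"] by (simp add: a')
  also have "(\<lambda>S. sign_mean ind (n M) (\<lambda>k. a' (k, S \<inter> {..<k}) * sg (k \<in> S))) = (\<lambda>S. g {k \<in> {..<M}. n k \<in> S})"
  proof
    fix S
    show "sign_mean ind (n M) (\<lambda>k. a' (k, S \<inter> {..<k}) * sg (k \<in> S)) = g {k \<in> {..<M}. n k \<in> S}"
      unfolding g_def
    proof (rule sign_mean_spread[OF n])
      fix k assume "k < M"
      then have "sel n k (S \<inter> {..<n k}) = {k \<in> {..<M}. n k \<in> S} \<inter> {..<k}"
        using n by (auto simp: sel_def strict_mono_less)
      then show "a' (n k, S \<inter> {..<n k}) * sg (n k \<in> S) =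
          a (k, {k \<in> {..<M}. n k \<in> S} \<inter> {..<k}) * sg (k \<in> {k \<in> {..<M}. n k \<in> S})"
        using \<open>k < M\<close> by (simp add: a')
    qed (simp add: a'_def)
  qed
  also have "N (step (n M) \<dots>) = N (step M g)"
  proof (rule norm_step_cong)
    show "avg {..<n M} (\<lambda>S. P (g {k \<in> {..<M}. n k \<in> S})) = avg {..<M} (\<lambda>T. P (g T))" for P :: "real \<Rightarrow> real"
      by (rule avg_preimage[where g = "\<lambda>T. P (g T)"])
        (use n nM in \<open>auto simp: inj_on_def strict_mono_eq\<close>)
  qed (simp_all add: g_def sign_mean_nonneg)
  also have "\<dots> = norm (\<Sum>w\<in>words M. a w *\<^sub>R e w)"
    by (simp add: ind g_def[abs_def])
  finally show ?thesis .
qed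

text \<open>The step function in the norm has the value 1 at the left end of the interval, so it is
  not the zero function, and \<open>N\<close> is definite on \<open>haar_H\<close>.\<close>

lemma e_nonzero:
  assumes T: "T \<subseteq> {..<k}"
  shows "e (k, T) \<noteq> 0"
proof
  assume zero: "e (k, T) = 0"
  obtain ind where ind: "\<And>M a. norm (\<Sum>w\<in>words M. a w *\<^sub>R e w) =
    N (step M (\<lambda>S. sign_mean ind M (\<lambda>k. a (k, S \<inter> {..<k}) * sg (k \<in> S))))"
    using norm_words_formula by blast
  define a :: "nat \<times> nat set \<Rightarrow> real" where "a w = (if w = (k, T) then 1 else 0 :: real)" for w
  define x where "x = step (Suc k) (\<lambda>S. sign_mean ind (Suc k) (\<lambda>k. a (k, S \<inter> {..<k}) * sg (k \<in> S)))"
  have "(\<Sum>w\<in>words (Suc k). a w *\<^sub>R e w) = 0"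
    using zero by (intro sum.neutral) (auto simp: a_def)
  then have "N x = 0"
    using ind[of a "Suc k"] by (simp add: x_def)
  moreover have "x \<in> haar_H"
    unfolding x_def by (rule step_in_haar_H)
  ultimately have "x (left_end T) = 0"
    using norm unfolding haar_system_norm_def by auto
  moreover have "x (left_end T) = 1"
  proof -
    have s: "0 \<le> left_end T" "left_end T < 1" "digits (left_end T) \<inter> {..<k} = T"
      using left_end_mem[OF T] mem_dyadic_interval[OF T] by auto
    define S where "S = digits (left_end T) \<inter> {..<Suc k}"
    have S: "S \<inter> {..<k} = T"
      using s(3) by (simp add: S_def Int_assoc Int_absorb1)
    have "sign_mean ind (Suc k) (\<lambda>l. a (l, S \<inter> {..<l}) * sg (l \<in> S)) =
        sign_mean ind (Suc k) (\<lambda>l. if l = k then sg (k \<in> S) else 0)"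
      by (rule sign_mean_cong) (auto simp: a_def S)
    also have "\<dots> = 1"
      by (subst sign_mean_single) auto
    finally show ?thesis
      using s by (simp add: x_def step_def S_def)
  qed
  ultimately show False
    by simp
qed

lemma e_dense: "closure {y. \<exists>M a. y = (\<Sum>w\<in>words M. a w *\<^sub>R e w)} = UNIV"
proof -
  have lin: "linear E" and nE: "\<And>y. norm (E y) = norm y" and Ej: "\<And>f. f \<in> haar_H0 \<Longrightarrow> E (j f) = J f"
    and ran: "range E = closure (J ` haar_H0)"
    using Y unfolding is_hardy_space0_def by blast+
  have "y \<in> closure {y. \<exists>M a. y = (\<Sum>w\<in>words M. a w *\<^sub>R e w)}" for y
    unfolding closure_approachable
  proof (intro allI impI)
    fix \<delta> :: real assume "0 < \<delta>"
    moreover have "E y \<in> closure (J ` haar_H0)"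
      using ran by blast
    ultimately obtain f where f: "f \<in> haar_H0" "dist (J f) (E y) < \<delta>"
      unfolding closure_approachable by blast
    obtain M a where "f = (\<lambda>s. \<Sum>w\<in>words M. a w * haar (dyadic_interval w) s)"
      using haar_H0_words[OF f(1)] .
    then have jf: "j f = (\<Sum>w\<in>words M. a w *\<^sub>R e w)"
      using j_words[of "words M" a] by auto
    have "dist (j f) y = norm (E (j f - y))"
      by (simp add: nE dist_norm)
    also have "\<dots> < \<delta>"
      using f Ej lin by (simp add: linear_diff dist_norm)
    finally show "\<exists>z\<in>{y. \<exists>M a. y = (\<Sum>w\<in>words M. a w *\<^sub>R e w)}. dist z y < \<delta>"
      using jf by blast
  qed
  then show ?thesis
    by blast
qed

sublocale haar_tree e
  using e_dense e_nonzero norm_twist norm_select by unfold_locales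

text \<open>\<open>haar_functional\<close> is a definite description, so a bounded functional with
  the right values has to be produced. Only the finitely many coefficients of level n enter, each
  controlled by \<open>coefficient_bound\<close>; the constant may depend on n.\<close>

lemma coordinate_functional_exists:
  "\<exists>\<phi> :: 'y \<Rightarrow>\<^sub>L real. \<forall>k T. T \<subseteq> {..<k} \<longrightarrow> blinfun_apply \<phi> (e (k, T)) = (if k = n then 1 / 2 ^ n else 0)"
proof -
  define f where "f = (\<lambda>(k, T :: nat set). if k = n then 1 / 2 ^ n else 0 :: real)"
  define C where "C = (\<Sum>T\<in>Pow {..<n}. 2 / norm (e (n, T)) / 2 ^ n)"
  have C: "0 \<le> C"
    unfolding C_def by (intro sum_nonneg) auto
  have bound: "norm (\<Sum>w\<in>words M. a w *\<^sub>R f w) \<le> C * norm (\<Sum>w\<in>words M. a w *\<^sub>R e w)" for M a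
  proof (cases "n < M")
    case True
    let ?y = "\<Sum>w\<in>words M. a w *\<^sub>R e w"
    have "(\<Sum>w\<in>words M. a w *\<^sub>R f w) = (\<Sum>k<M. if k = n then \<Sum>T\<in>Pow {..<k}. a (k, T) / 2 ^ n else 0)"
      unfolding sum_words by (intro sum.cong) (auto simp: f_def)
    also have "\<dots> = (\<Sum>T\<in>Pow {..<n}. a (n, T) / 2 ^ n)"
      using True by simp
    also have "norm \<dots> \<le> (\<Sum>T\<in>Pow {..<n}. 2 / norm (e (n, T)) / 2 ^ n * norm ?y)"
    proof (rule sum_norm_le)
      fix T assume "T \<in> Pow {..<n}"
      then have T: "T \<subseteq> {..<n}" "(n, T) \<in> words M"
        using True by (auto simp: words_def)
      have "\<bar>a (n, T)\<bar> \<le> 2 / norm (e (n, T)) * norm ?y"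
        using coefficient_bound[OF T(2), of a] nonzero[OF T(1)] by (simp add: field_simps)
      then show "norm (a (n, T) / 2 ^ n) \<le> 2 / norm (e (n, T)) / 2 ^ n * norm ?y"
        by (simp add: field_simps)
    qed
    finally show ?thesis
      by (simp add: C_def sum_distrib_right)
  next
    case False
    then have "(\<Sum>w\<in>words M. a w *\<^sub>R f w) = 0"
      by (intro sum.neutral) (auto simp: f_def words_def)
    then show ?thesis
      using C by simp
  qed
  obtain \<phi> :: "'y \<Rightarrow>\<^sub>L real" where "\<And>k T. T \<subseteq> {..<k} \<Longrightarrow> blinfun_apply \<phi> (e (k, T)) = f (k, T)" "norm \<phi> \<le> C"
    using operator_exists[OF C bound] by metis
  then show ?thesis
    by (intro exI[of _ \<phi>]) (auto simp: f_def)
qed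

lemma haar_functional_rademacher:
  assumes T: "T \<subseteq> {..<k}"
  shows "blinfun_apply (haar_functional j (rademacher n)) (e (k, T)) = (if k = n then 1 / 2 ^ n else 0)"
proof -
  let ?Q = "\<lambda>\<phi>. \<forall>f\<in>haar_H0. blinfun_apply \<phi> (j f) = (LBINT s:{0..1}. f s * rademacher n s)"
  have Qe: "blinfun_apply \<phi> (e (k, T)) = (if k = n then 1 / 2 ^ n else 0)" if "?Q \<phi>" "T \<subseteq> {..<k}" for \<phi> k T
  proof -
    have "haar (dyadic_interval (k, T)) \<in> haar_H0"
      unfolding haar_H0_def using that(2) by (intro haar_in_haar_span dyadic_interval_in_dyadic)
    then show ?thesis
      using that by (simp add: e_def integral_haar_rademacher)
  qed
  obtain \<phi> :: "'y \<Rightarrow>\<^sub>L real" where \<phi>: "\<forall>k T. T \<subseteq> {..<k} \<longrightarrow> blinfun_apply \<phi> (e (k, T)) = (if k = n then 1 / 2 ^ n else 0)"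
    using coordinate_functional_exists by blast
  have "?Q \<phi>"
  proof
    fix f assume "f \<in> haar_H0"
    then obtain M a where f: "f = (\<lambda>s. \<Sum>w\<in>words M. a w * haar (dyadic_interval w) s)"
      by (rule haar_H0_words)
    have int: "set_integrable lborel {0..1} (\<lambda>s. haar (dyadic_interval w) s * rademacher n s)" if "w \<in> words M" for w
    proof -
      obtain k T where w: "w = (k, T)" "T \<subseteq> {..<k}"
        using \<open>w \<in> words M\<close> by (cases w) (auto simp: words_def)
      have "haar (dyadic_interval (k, T)) s * rademacher n s = step (Suc (max k n)) (\<lambda>S. if S \<inter> {..<k} = T then sg (k \<in> S) * sg (n \<in> S) else 0) s" for s
        unfolding haar_dyadic_interval[OF w(2)] rademacher_eq
        by (auto simp: step_def Int_assoc Int_absorb1 less_Suc_eq_le)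
      then show ?thesis
        by (simp add: w(1) set_integrable_step)
    qed
    have "(LBINT s:{0..1}. f s * rademacher n s) =
        (LBINT s:{0..1}. \<Sum>w\<in>words M. a w * (haar (dyadic_interval w) s * rademacher n s))"
      by (simp add: f sum_distrib_right mult.assoc)
    also have "\<dots> = (\<Sum>w\<in>words M. a w * (LBINT s:{0..1}. haar (dyadic_interval w) s * rademacher n s))"
      using int by (simp add: set_lebesgue_integral_def set_integrable_def sum_distrib_left
          mult.left_commute Bochner_Integration.integral_sum)
    also have "\<dots> = (\<Sum>w\<in>words M. a w *\<^sub>R blinfun_apply \<phi> (e w))"
      using \<phi> by (intro sum.cong) (auto simp: words_def integral_haar_rademacher)
    also have "\<dots> = blinfun_apply \<phi> (j f)"
      unfolding f by (subst j_words) (auto simp: apply_sum_words)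
    finally show "blinfun_apply \<phi> (j f) = (LBINT s:{0..1}. f s * rademacher n s)" ..
  qed
  \<comment> \<open>Two such functionals agree on all Haar functions and therefore, by density,
    everywhere; this is the uniqueness that the description requires.\<close>
  moreover have "\<psi> = \<phi>" if "?Q \<psi>" for \<psi>
    using Qe[OF that] \<phi> by (intro operator_eqI) simp
  ultimately have "?Q (haar_functional j (rademacher n))"
    unfolding haar_functional_def by (rule theI)
  then show ?thesis
    using Qe T by blast
qed

text \<open>The factor 1 / 2 ^ n, the measure of an interval of level n, turns the sum of the
  entries at this level into their mean.\<close>

lemma rademacher_pairing_eq:
  assumes D: "\<And>k T. T \<subseteq> {..<k} \<Longrightarrow> blinfun_apply D (e (k, T)) = d k T *\<^sub>R e (k, T)"
  shows "rademacher_pairing j D n = level_average d n 0 {}"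
proof -
  define W where "W = Pair n ` Pow {..<n}"
  have inj: "inj_on (Pair n) A" for A :: "nat set set"
    by (rule inj_onI) simp
  have W: "finite W" "W \<subseteq> (\<Union>M. words M)"
    by (auto simp: W_def words_def)
  have "rademacher n = (\<lambda>s. \<Sum>w\<in>W. 1 * haar (dyadic_interval w) s)"
  proof
    fix s
    have "(\<Sum>w\<in>W. 1 * haar (dyadic_interval w) s) = (\<Sum>T\<in>Pow {..<n}. haar (dyadic_interval (n, T)) s)"
      by (simp add: W_def sum.reindex[OF inj])
    moreover have "inj_on (\<lambda>T. dyadic_interval (n, T)) (Pow {..<n})"
      by (rule inj_onI) (auto simp: dyadic_interval_eq_iff)
    ultimately show "rademacher n s = (\<Sum>w\<in>W. 1 * haar (dyadic_interval w) s)"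
      by (simp add: rademacher_def dyadic_level_eq sum.reindex)
  qed
  then have "j (rademacher n) = (\<Sum>w\<in>W. 1 *\<^sub>R e w)"
    using j_words[OF W, of "\<lambda>_. 1"] by simp
  also have "\<dots> = (\<Sum>T\<in>Pow {..<n}. e (n, T))"
    by (simp add: W_def sum.reindex[OF inj])
  finally have "rademacher_pairing j D n =
      (\<Sum>T\<in>Pow {..<n}. blinfun_apply (haar_functional j (rademacher n)) (d n T *\<^sub>R e (n, T)))"
    using D by (simp add: rademacher_pairing_def blinfun.sum_right)
  also have "\<dots> = (\<Sum>T\<in>Pow {..<n}. d n T / 2 ^ n)"
    by (intro sum.cong) (auto simp: blinfun.scaleR_right haar_functional_rademacher)
  also have "\<dots> = level_average d n 0 {}"
    by (simp add: level_average_def sum_divide_distrib Pow_def)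
  finally show ?thesis .
qed

lemma haar_multiplier_projectional_factorization:
  assumes D: "haar_multiplier j D" and c: "c \<in> cluster_points (rademacher_pairing j D)" and \<eta>: "0 < \<eta>"
  shows "projectionally_factors_through (c *\<^sub>R id_blinfun) D 1 \<eta>"
proof -
  obtain d where "\<forall>I\<in>dyadic. blinfun_apply D (j (haar I)) = d I *\<^sub>R j (haar I)"
    using D unfolding haar_multiplier_def by blast
  then have De: "blinfun_apply D (e (k, T)) = d (dyadic_interval (k, T)) *\<^sub>R e (k, T)" if "T \<subseteq> {..<k}" for k T
    using dyadic_interval_in_dyadic[OF that] by (simp add: e_def)
  obtain q where q: "strict_mono q" "(\<lambda>i. rademacher_pairing j D (q i)) \<longlonglongrightarrow> c"
    using cluster_point_subsequence[OF c] .
  have pair: "rademacher_pairing j D n = level_average (\<lambda>k T. d (dyadic_interval (k, T))) n 0 {}" for n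
    by (rule rademacher_pairing_eq) (rule De)
  show ?thesis
    by (rule multiplier_projectional_factorization[where d = "\<lambda>k T. d (dyadic_interval (k, T))", OF _ q(1) _ \<eta>])
      (use De q(2) in \<open>simp_all add: pair\<close>)
qed

end

theorem theorem3p6:
  fixes N :: "(real \<Rightarrow> real) \<Rightarrow> real"
    and r :: "real set \<Rightarrow> real \<Rightarrow> real"
    and J :: "(real \<Rightarrow> real) \<Rightarrow> 'x::banach"
    and E :: "'y::banach \<Rightarrow> 'x"
    and j :: "(real \<Rightarrow> real) \<Rightarrow> 'y"
    and D :: "'y \<Rightarrow>\<^sub>L 'y"
    and c :: real
  assumes "haar_system_norm N"
    and "r \<in> rademacher_families"
    and "is_hardy_space N r J"
    and "is_hardy_space0 J E j"
    and "haar_multiplier j D"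
    and "c \<in> cluster_points (rademacher_pairing j D)"
  shows "(\<forall>\<eta>>0. projectionally_factors_through (c *\<^sub>R id_blinfun) D 1 \<eta>) \<and>
         (c \<noteq> 0 \<longrightarrow> factors_through_plus id_blinfun D (1 / \<bar>c\<bar>)) \<and>
         (factors_through_plus id_blinfun D 2 \<or>
          factors_through_plus id_blinfun (id_blinfun - D) 2) \<and>
         (factors_through_plus id_blinfun D (min_const c) \<or>
          factors_through_plus id_blinfun (id_blinfun - D) (min_const c))"
proof -
  interpret hardy_space N r J E j
    using assms by unfold_locales
  have "projectionally_factors_through (c *\<^sub>R id_blinfun) D 1 \<eta>" if "0 < \<eta>" for \<eta>
    using haar_multiplier_projectional_factorization[OF assms(5,6) that] .
  then show ?thesis
    using factorization_dichotomy[of c D] by blast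
qed

end
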